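(* Let $\Omega\subseteq\mathbb R^n$ be open and let $\widetilde R\in\mathcal G(\Omega)$ and $\widetilde X\in\widetilde\Omega_c$ be given. The point value $\widetilde R(\widetilde X)$ of $\widetilde R$ at $\widetilde X$, defined as the class of $R(X)$ in $\widetilde{\mathbb C}$ for any representatives $R$ of $\widetilde R$ and $X$ of $\widetilde X$, where $R(X)(\boldsymbol\varphi)_\varepsilon:=R(\boldsymbol\varphi)_\varepsilon(X(\boldsymbol\varphi)_\varepsilon)$, is a well-defined element of $\widetilde{\mathbb C}$.
   Context: Basic space. $\mathbb N=\{1,2,\dots\}$, $\mathbb N_0=\mathbb N\cup\{0\}$, $I=(0,1]$. $\mathcal D(\Omega)$ is the space of test functions, $\mathcal D'(\Omega)$ the space of distributions (strong dual), $C^\infty(\Omega)$ the Fréchet space of smooth complex-valued functions. Smoothness of maps between locally convex spaces is in the sense of convenient calculus (Kriegl–Michor), $\mathrm d^k$ is the $k$-th differential, $C^\infty(E,F)$ is the space of smooth maps; powers $E^I$ carry the product topology. $\mathcal L(E,F)$ is the space of continuous linear maps with the topology of bounded convergence, $\mathrm{csn}(E)$ the set of continuous seminorms on $E$. $\mathrm{SK}(\Omega):=C^\infty(\Omega,\mathcal D(\Omega))$, isomorphic to $\mathcal L(\mathcal D'(\Omega),C^\infty(\Omega))$ via $\Phi(u)(x)=\langle u,\vec\varphi(x)\rangle$. $\mathcal E(\Omega):=C^\infty(\mathrm{SK}(\Omega)^I,C^\infty(\Omega)^I)$, with pointwise operations; write $R(\boldsymbol\varphi)_\varepsilon(x)$.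 $C^\infty(\mathrm{SK}(\Omega)^I,\Omega^I)$ is the set of smooth maps into $(\mathbb R^n)^I$ with values in $\Omega^I$. Test objects. $\boldsymbol\varphi\in\mathrm{SK}(\Omega)^I$ with corresponding operators $\boldsymbol\Phi_\varepsilon\in\mathcal L(\mathcal D'(\Omega),C^\infty(\Omega))$ is a test object, $\boldsymbol\varphi\in S(\Omega)$, if (i) $\boldsymbol\Phi_\varepsilon\to\mathrm{id}$ in $\mathcal L(\mathcal D'(\Omega),\mathcal D'(\Omega))$ as $\varepsilon\to0$; (ii) for all $p\in\mathrm{csn}(\mathcal L(\mathcal D'(\Omega),C^\infty(\Omega)))$ there is $N\in\mathbb N$ with $p(\boldsymbol\Phi_\varepsilon)=O(\varepsilon^{-N})$; (iii) for all $p\in\mathrm{csn}(\mathcal L(C^\infty(\Omega),C^\infty(\Omega)))$ and $m\in\mathbb N$, $p(\boldsymbol\Phi_\varepsilon|_{C^\infty(\Omega)}-\mathrm{id})=O(\varepsilon^m)$; (iv) every $x\in\Omega$ has a neighborhood $V$ such that for all $r>0$ there is $\varepsilon_0>0$ with $\operatorname{supp}\boldsymbol\varphi_\varepsilon(y)\subseteq B_r(y)$ for all $y\in V$, $\varepsilon<\varepsilon_0$. It is a $0$-test object, $\boldsymbol\varphi\in S^0(\Omega)$, if (ii), (iv) hold and (i), (iii) hold with $\mathrm{id}$ replaced by $0$. Generalized functions. $R\in\mathcal E(\Omega)$ is moderate (in $\mathcal E_M(\Omega)$) if for all $k\in\mathbb N_0$, $p\in\mathrm{csn}(C^\infty(\Omega))$,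 $\boldsymbol\varphi\in S(\Omega)$, $\boldsymbol\psi_1,\dots,\boldsymbol\psi_k\in S^0(\Omega)$ there is $N\in\mathbb N$ with $p(\mathrm d^kR(\boldsymbol\varphi)(\boldsymbol\psi_1,\dots,\boldsymbol\psi_k)_\varepsilon)=O(\varepsilon^{-N})$; negligible (in $\mathcal N(\Omega)$) if for all such $k,p,\boldsymbol\varphi,\boldsymbol\psi_i$ and all $m\in\mathbb N$ it is $O(\varepsilon^m)$. $\mathcal G(\Omega):=\mathcal E_M(\Omega)/\mathcal N(\Omega)$. Generalized numbers. $\mathbb C_M$ is the set of $X\in C^\infty(\mathrm{SK}(\Omega)^I,\mathbb C^I)$ such that for all $k\in\mathbb N_0$, $\boldsymbol\varphi\in S(\Omega)$, $\boldsymbol\psi_1,\dots,\boldsymbol\psi_k\in S^0(\Omega)$ there is $N\in\mathbb N$ with $|\mathrm d^kX(\boldsymbol\varphi)(\boldsymbol\psi_1,\dots,\boldsymbol\psi_k)_\varepsilon|=O(\varepsilon^{-N})$; $\mathbb C_{\mathcal N}$ is defined likewise with $O(\varepsilon^m)$ for all $m\in\mathbb N$. $\widetilde{\mathbb C}:=\mathbb C_M/\mathbb C_{\mathcal N}$. Generalized points. $\Omega_M$ is the set of $X\in C^\infty(\mathrm{SK}(\Omega)^I,\Omega^I)$ such that for all $k\in\mathbb N_0$, $\boldsymbol\varphi\in S(\Omega)$, $\boldsymbol\psi_1,\dots,\boldsymbol\psi_k\in S^0(\Omega)$ there is $N\in\mathbb N$ with $\|\mathrm d^kX(\boldsymbol\varphi)(\boldsymbol\psi_1,\dots,\boldsymbol\psi_k)_\varepsilon\|=O(\varepsilon^{-N})$.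 For $X,Y\in\Omega_M$, $X\sim Y$ means that for all such $k,\boldsymbol\varphi,\boldsymbol\psi_i$ and all $m\in\mathbb N$, $\|\mathrm d^k(X-Y)(\boldsymbol\varphi)(\boldsymbol\psi_1,\dots,\boldsymbol\psi_k)_\varepsilon\|=O(\varepsilon^m)$. $\widetilde\Omega:=\Omega_M/{\sim}$. $\widetilde\Omega_c$ (compactly supported generalized points) is the set of $\widetilde X\in\widetilde\Omega$ having a representative $X$ such that there is a compact $K\subseteq\Omega$ with: for all $\boldsymbol\varphi\in S(\Omega)$ there is $\varepsilon_0>0$ with $X(\boldsymbol\varphi)_\varepsilon\in K$ for all $\varepsilon<\varepsilon_0$. *)

theory Defs
  imports
    "HOL-Analysis.Analysis"
    "HOL-Library.Function_Algebras"
    "HOL-Library.Landau_Symbols"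
begin

instantiation "fun" :: (type, real_vector) real_vector
begin

definition scaleR_fun :: "real \<Rightarrow> ('a \<Rightarrow> 'b) \<Rightarrow> 'a \<Rightarrow> 'b" where
  "scaleR_fun r f = (\<lambda>x. r *\<^sub>R f x)"

instance
  by standard (auto simp: scaleR_fun_def fun_eq_iff scaleR_add_right scaleR_add_left)

end

class complex_vector = real_vector +
  fixes scaleC :: "complex \<Rightarrow> 'a \<Rightarrow> 'a"
  assumes scaleC_add_right: "scaleC a (x + y) = scaleC a x + scaleC a y"
    and scaleC_add_left: "scaleC (a + b) x = scaleC a x + scaleC b x"
    and scaleC_scaleC: "scaleC a (scaleC b x) = scaleC (a * b) x"
    and scaleC_of_real: "scaleC (complex_of_real r) x = r *\<^sub>R x"

instantiation complex :: complex_vector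
begin

definition scaleC_complex :: "complex \<Rightarrow> complex \<Rightarrow> complex" where
  "scaleC_complex a x = a * x"

instance
  by standard (auto simp: scaleC_complex_def algebra_simps scaleR_conv_of_real)

end

instantiation "fun" :: (type, complex_vector) complex_vector
begin

definition scaleC_fun :: "complex \<Rightarrow> ('a \<Rightarrow> 'b) \<Rightarrow> 'a \<Rightarrow> 'b" where
  "scaleC_fun a f = (\<lambda>x. scaleC a (f x))"

instance
  by standard
    (auto simp: scaleC_fun_def scaleR_fun_def fun_eq_iff scaleC_add_right scaleC_add_left
      scaleC_scaleC scaleC_of_real)

end

text \<open>
  A locally convex space is given by a linear subspace \<open>carrier\<close> of an ambient real vector space
  together with a family of seminorms generating its topology.  The values of the generating
  seminorms outside the carrier are irrelevant.  All function spaces below consist of functions that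
  vanish outside their domain of definition, so that they are linear subspaces of a full function
  type and equality of elements is equality of functions.
\<close>

record 'a lcs =
  carrier :: "'a set"
  gens :: "('a \<Rightarrow> real) set"

definition lcs_top :: "'a::real_vector lcs \<Rightarrow> 'a topology" where
  "lcs_top E = topology_generated_by
     (insert (carrier E)
       {{y \<in> carrier E. p (y - x) < r} | p x r. p \<in> gens E \<and> x \<in> carrier E \<and> 0 < r})"

lemma topspace_lcs_top [simp]: "topspace (lcs_top E) = carrier E"
  unfolding lcs_top_def topology_generated_by_topspace by auto

definition seminorm_on :: "'a::real_vector set \<Rightarrow> ('a \<Rightarrow> real) \<Rightarrow> bool" where
  "seminorm_on V p \<longleftrightarrow>
     (\<forall>x\<in>V. 0 \<le> p x) \<and>
     (\<forall>x\<in>V. \<forall>y\<in>V. p (x + y) \<le> p x + p y) \<and>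
     (\<forall>r. \<forall>x\<in>V. p (r *\<^sub>R x) = \<bar>r\<bar> * p x)"

definition csn :: "'a::real_vector lcs \<Rightarrow> ('a \<Rightarrow> real) set" where
  "csn E = {p. seminorm_on (carrier E) p \<and> continuous_map (lcs_top E) euclideanreal p}"

definition lcs_bounded :: "'a::real_vector lcs \<Rightarrow> 'a set \<Rightarrow> bool" where
  "lcs_bounded E B \<longleftrightarrow> B \<subseteq> carrier E \<and> (\<forall>p\<in>csn E. bdd_above (p ` B))"

definition normed_lcs :: "'a::real_normed_vector lcs" where
  "normed_lcs = \<lparr>carrier = UNIV, gens = {norm}\<rparr>"

definition eps_I :: "real set" where
  "eps_I = {0<..1}"

definition lcs_power :: "'a::real_vector lcs \<Rightarrow> (real \<Rightarrow> 'a) lcs" where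
  "lcs_power E =
     \<lparr>carrier = {f. (\<forall>\<epsilon>\<in>eps_I. f \<epsilon> \<in> carrier E) \<and> (\<forall>\<epsilon>. \<epsilon> \<notin> eps_I \<longrightarrow> f \<epsilon> = 0)},
      gens = {\<lambda>f. p (f \<epsilon>) | p \<epsilon>. p \<in> csn E \<and> \<epsilon> \<in> eps_I}\<rparr>"

text \<open>The space of continuous complex-linear maps with the topology of uniform convergence on
  bounded sets.\<close>

definition lcs_L :: "'a::complex_vector lcs \<Rightarrow> 'b::complex_vector lcs \<Rightarrow> ('a \<Rightarrow> 'b) lcs" where
  "lcs_L E F =
     \<lparr>carrier = {T. continuous_map (lcs_top E) (lcs_top F) T \<and>
                    (\<forall>x\<in>carrier E. \<forall>y\<in>carrier E. T (x + y) = T x + T y) \<and>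
                    (\<forall>a. \<forall>x\<in>carrier E. T (scaleC a x) = scaleC a (T x)) \<and>
                    (\<forall>x. x \<notin> carrier E \<longrightarrow> T x = 0)},
      gens = {\<lambda>T. SUP x\<in>B. p (T x) | B p. lcs_bounded E B \<and> B \<noteq> {} \<and> p \<in> csn F}\<rparr>"

definition lcs_id :: "'a::real_vector lcs \<Rightarrow> 'a \<Rightarrow> 'a" where
  "lcs_id E = (\<lambda>x. if x \<in> carrier E then x else 0)"

definition lcs_has_deriv :: "'a::real_vector lcs \<Rightarrow> (real \<Rightarrow> 'a) \<Rightarrow> 'a \<Rightarrow> real \<Rightarrow> bool" where
  "lcs_has_deriv E c l t \<longleftrightarrow>
     limitin (lcs_top E) (\<lambda>h. inverse h *\<^sub>R (c (t + h) - c t)) l (at 0)"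

definition lcs_deriv :: "'a::real_vector lcs \<Rightarrow> (real \<Rightarrow> 'a) \<Rightarrow> real \<Rightarrow> 'a" where
  "lcs_deriv E c t = (THE l. lcs_has_deriv E c l t)"

text \<open>\<open>C k\<close> is the \<open>k\<close>-th derivative of the curve \<open>c\<close>.\<close>

definition smooth_curve :: "'a::real_vector lcs \<Rightarrow> (real \<Rightarrow> 'a) \<Rightarrow> bool" where
  "smooth_curve E c \<longleftrightarrow>
     (\<exists>C. C 0 = c \<and>
       (\<forall>k t. C k t \<in> carrier E \<and> lcs_has_deriv E (C k) (C (Suc k) t) t))"

definition smooth_map ::
  "'a::real_vector lcs \<Rightarrow> 'a set \<Rightarrow> 'b::real_vector lcs \<Rightarrow> ('a \<Rightarrow> 'b) \<Rightarrow> bool" where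
  "smooth_map E U F f \<longleftrightarrow>
     (\<forall>c. smooth_curve E c \<and> range c \<subseteq> U \<longrightarrow> smooth_curve F (f \<circ> c))"

text \<open>
  The space \<open>C\<^sup>\<infinity>(U, F)\<close> for \<open>U \<subseteq> E\<close>, with the initial topology with respect to the maps
  \<open>f \<mapsto> f \<circ> c\<close> into \<open>C\<^sup>\<infinity>(\<real>, F)\<close>, where \<open>c\<close> ranges over the smooth curves in \<open>U\<close>, and \<open>C\<^sup>\<infinity>(\<real>, F)\<close>
  carries the topology of uniform convergence on compact sets of each derivative separately.
\<close>

definition smooth_space ::
  "'a::real_vector lcs \<Rightarrow> 'a set \<Rightarrow> 'b::real_vector lcs \<Rightarrow> ('a \<Rightarrow> 'b) lcs" where
  "smooth_space E U F =
     \<lparr>carrier = {f. smooth_map E U F f \<and> (\<forall>x. x \<notin> U \<longrightarrow> f x = 0)},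
      gens = {\<lambda>f. SUP t\<in>K. p ((lcs_deriv F ^^ k) (f \<circ> c) t) | c K k p.
                smooth_curve E c \<and> range c \<subseteq> U \<and> compact K \<and> K \<noteq> {} \<and> p \<in> csn F}\<rparr>"

text \<open>\<open>ddiff F f x [v\<^sub>1, \<dots>, v\<^sub>k]\<close> is the iterated differential \<open>d\<^sup>k f(x)(v\<^sub>1, \<dots>, v\<^sub>k)\<close>.\<close>

primrec ddiff ::
  "'b::real_vector lcs \<Rightarrow> ('a::real_vector \<Rightarrow> 'b) \<Rightarrow> 'a \<Rightarrow> 'a list \<Rightarrow> 'b" where
  "ddiff F f x [] = f x"
| "ddiff F f x (v # vs) = lcs_deriv F (\<lambda>t. ddiff F f (x + t *\<^sub>R v) vs) 0"

primrec times_differentiable_on ::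
  "nat \<Rightarrow> 'a::real_normed_vector set \<Rightarrow> ('a \<Rightarrow> 'b::real_normed_vector) \<Rightarrow> bool" where
  "times_differentiable_on 0 S f \<longleftrightarrow> continuous_on S f"
| "times_differentiable_on (Suc k) S f \<longleftrightarrow>
     (\<forall>x\<in>S. f differentiable (at x)) \<and>
     (\<forall>v. times_differentiable_on k S (\<lambda>x. frechet_derivative f (at x) v))"

primrec partial_deriv ::
  "'a::real_normed_vector list \<Rightarrow> ('a \<Rightarrow> 'b::real_normed_vector) \<Rightarrow> 'a \<Rightarrow> 'b" where
  "partial_deriv [] f = f"
| "partial_deriv (v # vs) f = (\<lambda>x. frechet_derivative (partial_deriv vs f) (at x) v)"

definition Cinf :: "'a::euclidean_space set \<Rightarrow> ('a \<Rightarrow> complex) lcs" where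
  "Cinf \<Omega> =
     \<lparr>carrier = {f. (\<forall>k. times_differentiable_on k \<Omega> f) \<and> (\<forall>x. x \<notin> \<Omega> \<longrightarrow> f x = 0)},
      gens = {\<lambda>f. SUP x\<in>K. norm (partial_deriv vs f x) | K vs.
                compact K \<and> K \<subseteq> \<Omega> \<and> K \<noteq> {} \<and> set vs \<subseteq> Basis}\<rparr>"

definition supp :: "('a::topological_space \<Rightarrow> 'b::zero) \<Rightarrow> 'a set" where
  "supp f = closure {x. f x \<noteq> 0}"

definition test_functions :: "'a::euclidean_space set \<Rightarrow> ('a \<Rightarrow> complex) set" where
  "test_functions \<Omega> = {\<phi> \<in> carrier (Cinf \<Omega>). compact (supp \<phi>) \<and> supp \<phi> \<subseteq> \<Omega>}"

text \<open>
  The locally convex inductive limit of the spaces of test functions with support in a fixed compact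
  set \<open>K \<subseteq> \<Omega>\<close>: its topology is generated by all seminorms whose restrictions to these spaces are
  continuous.
\<close>

definition Dspace :: "'a::euclidean_space set \<Rightarrow> ('a \<Rightarrow> complex) lcs" where
  "Dspace \<Omega> =
     \<lparr>carrier = test_functions \<Omega>,
      gens = {p. seminorm_on (test_functions \<Omega>) p \<and>
                 (\<forall>K. compact K \<and> K \<subseteq> \<Omega> \<longrightarrow>
                   continuous_map
                     (subtopology (lcs_top (Cinf \<Omega>)) {\<phi> \<in> test_functions \<Omega>. supp \<phi> \<subseteq> K})
                     euclideanreal p)}\<rparr>"

definition Distr :: "'a::euclidean_space set \<Rightarrow> (('a \<Rightarrow> complex) \<Rightarrow> complex) lcs" where
  "Distr \<Omega> = lcs_L (Dspace \<Omega>) normed_lcs"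

definition reg_distr ::
  "'a::euclidean_space set \<Rightarrow> ('a \<Rightarrow> complex) \<Rightarrow> ('a \<Rightarrow> complex) \<Rightarrow> complex" where
  "reg_distr \<Omega> f = (\<lambda>\<phi>. if \<phi> \<in> test_functions \<Omega> then (LINT x|lborel. f x * \<phi> x) else 0)"

type_synonym 'a kernel = "'a \<Rightarrow> 'a \<Rightarrow> complex"
type_synonym 'a distr_op = "(('a \<Rightarrow> complex) \<Rightarrow> complex) \<Rightarrow> 'a \<Rightarrow> complex"

definition SK :: "'a::euclidean_space set \<Rightarrow> 'a kernel lcs" where
  "SK \<Omega> = smooth_space normed_lcs \<Omega> (Dspace \<Omega>)"

definition SKI :: "'a::euclidean_space set \<Rightarrow> (real \<Rightarrow> 'a kernel) lcs" where
  "SKI \<Omega> = lcs_power (SK \<Omega>)"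

text \<open>The operator \<open>\<Phi> : D'(\<Omega>) \<rightarrow> C\<^sup>\<infinity>(\<Omega>)\<close> of a kernel, considered as an operator \<open>D'(\<Omega>) \<rightarrow> D'(\<Omega>)\<close>,
  and its restriction to \<open>C\<^sup>\<infinity>(\<Omega>)\<close>.\<close>

definition ker_op :: "'a::euclidean_space set \<Rightarrow> 'a kernel \<Rightarrow> 'a distr_op" where
  "ker_op \<Omega> \<phi> = (\<lambda>u. if u \<in> carrier (Distr \<Omega>) then (\<lambda>x. u (\<phi> x)) else 0)"

definition ker_op_distr :: "'a::euclidean_space set \<Rightarrow> 'a kernel \<Rightarrow>
    (('a \<Rightarrow> complex) \<Rightarrow> complex) \<Rightarrow> ('a \<Rightarrow> complex) \<Rightarrow> complex" where
  "ker_op_distr \<Omega> \<phi> = (\<lambda>u. if u \<in> carrier (Distr \<Omega>) then reg_distr \<Omega> (ker_op \<Omega> \<phi> u) else 0)"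

definition ker_op_smooth :: "'a::euclidean_space set \<Rightarrow> 'a kernel \<Rightarrow>
    ('a \<Rightarrow> complex) \<Rightarrow> 'a \<Rightarrow> complex" where
  "ker_op_smooth \<Omega> \<phi> = (\<lambda>f. if f \<in> carrier (Cinf \<Omega>) then ker_op \<Omega> \<phi> (reg_distr \<Omega> f) else 0)"

text \<open>The conditions on test objects with prescribed limits \<open>J\<close> on \<open>D'(\<Omega>)\<close> and \<open>J'\<close> on
  \<open>C\<^sup>\<infinity>(\<Omega>)\<close>.\<close>

definition test_objects_to :: "'a::euclidean_space set \<Rightarrow>
    ((('a \<Rightarrow> complex) \<Rightarrow> complex) \<Rightarrow> ('a \<Rightarrow> complex) \<Rightarrow> complex) \<Rightarrow>
    (('a \<Rightarrow> complex) \<Rightarrow> 'a \<Rightarrow> complex) \<Rightarrow> (real \<Rightarrow> 'a kernel) set" where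
  "test_objects_to \<Omega> J J' = {\<phi> \<in> carrier (SKI \<Omega>).
     limitin (lcs_top (lcs_L (Distr \<Omega>) (Distr \<Omega>)))
       (\<lambda>\<epsilon>. ker_op_distr \<Omega> (\<phi> \<epsilon>)) J (at_right 0) \<and>
     (\<forall>p\<in>csn (lcs_L (Distr \<Omega>) (Cinf \<Omega>)).
       \<exists>N::nat. (\<lambda>\<epsilon>. p (ker_op \<Omega> (\<phi> \<epsilon>))) \<in> O[at_right 0](\<lambda>\<epsilon>. inverse (\<epsilon> ^ N))) \<and>
     (\<forall>p\<in>csn (lcs_L (Cinf \<Omega>) (Cinf \<Omega>)).
       \<forall>m::nat. (\<lambda>\<epsilon>. p (ker_op_smooth \<Omega> (\<phi> \<epsilon>) - J')) \<in> O[at_right 0](\<lambda>\<epsilon>. \<epsilon> ^ m)) \<and>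
     (\<forall>x\<in>\<Omega>. \<exists>V. open V \<and> x \<in> V \<and> V \<subseteq> \<Omega> \<and>
       (\<forall>r>0. \<exists>\<epsilon>\<^sub>0>0. \<forall>y\<in>V. \<forall>\<epsilon>\<in>eps_I. \<epsilon> < \<epsilon>\<^sub>0 \<longrightarrow> supp (\<phi> \<epsilon> y) \<subseteq> ball y r))}"

definition test_objects :: "'a::euclidean_space set \<Rightarrow> (real \<Rightarrow> 'a kernel) set" where
  "test_objects \<Omega> = test_objects_to \<Omega> (lcs_id (Distr \<Omega>)) (lcs_id (Cinf \<Omega>))"

definition zero_test_objects :: "'a::euclidean_space set \<Rightarrow> (real \<Rightarrow> 'a kernel) set" where
  "zero_test_objects \<Omega> = test_objects_to \<Omega> 0 0"

text \<open>
  Growth conditions along all test objects on the differentials of \<open>R\<close>, a map into \<open>F\<^sup>I\<close>,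
  as measured by the function \<open>p\<close> on \<open>F\<close>.  The number of directions \<open>k\<close> is the length of
  the list \<open>\<psi>s\<close>.
\<close>

definition moderate_wrt :: "'a::euclidean_space set \<Rightarrow> 'b::real_vector lcs \<Rightarrow> ('b \<Rightarrow> real) \<Rightarrow>
    ((real \<Rightarrow> 'a kernel) \<Rightarrow> real \<Rightarrow> 'b) \<Rightarrow> bool" where
  "moderate_wrt \<Omega> F p R \<longleftrightarrow>
     (\<forall>\<phi>\<in>test_objects \<Omega>. \<forall>\<psi>s. set \<psi>s \<subseteq> zero_test_objects \<Omega> \<longrightarrow>
       (\<exists>N::nat. (\<lambda>\<epsilon>. p (ddiff (lcs_power F) R \<phi> \<psi>s \<epsilon>)) \<in> O[at_right 0](\<lambda>\<epsilon>. inverse (\<epsilon> ^ N))))"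

definition negligible_wrt :: "'a::euclidean_space set \<Rightarrow> 'b::real_vector lcs \<Rightarrow> ('b \<Rightarrow> real) \<Rightarrow>
    ((real \<Rightarrow> 'a kernel) \<Rightarrow> real \<Rightarrow> 'b) \<Rightarrow> bool" where
  "negligible_wrt \<Omega> F p R \<longleftrightarrow>
     (\<forall>\<phi>\<in>test_objects \<Omega>. \<forall>\<psi>s. set \<psi>s \<subseteq> zero_test_objects \<Omega> \<longrightarrow>
       (\<forall>m::nat. (\<lambda>\<epsilon>. p (ddiff (lcs_power F) R \<phi> \<psi>s \<epsilon>)) \<in> O[at_right 0](\<lambda>\<epsilon>. \<epsilon> ^ m)))"

text \<open>\<open>net_maps \<Omega> F\<close> is the set \<open>C\<^sup>\<infinity>(SK(\<Omega>)\<^sup>I, F\<^sup>I)\<close>.\<close>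

definition net_maps :: "'a::euclidean_space set \<Rightarrow> 'b::real_vector lcs \<Rightarrow>
    ((real \<Rightarrow> 'a kernel) \<Rightarrow> real \<Rightarrow> 'b) set" where
  "net_maps \<Omega> F = carrier (smooth_space (SKI \<Omega>) (carrier (SKI \<Omega>)) (lcs_power F))"

type_synonym 'a gfun = "(real \<Rightarrow> 'a kernel) \<Rightarrow> real \<Rightarrow> 'a \<Rightarrow> complex"
type_synonym 'a gnum = "(real \<Rightarrow> 'a kernel) \<Rightarrow> real \<Rightarrow> complex"
type_synonym 'a gpoint = "(real \<Rightarrow> 'a kernel) \<Rightarrow> real \<Rightarrow> 'a"

definition E_moderate :: "'a::euclidean_space set \<Rightarrow> 'a gfun set" where
  "E_moderate \<Omega> = {R \<in> net_maps \<Omega> (Cinf \<Omega>). \<forall>p\<in>csn (Cinf \<Omega>). moderate_wrt \<Omega> (Cinf \<Omega>) p R}"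

definition E_negligible :: "'a::euclidean_space set \<Rightarrow> 'a gfun set" where
  "E_negligible \<Omega> = {R \<in> net_maps \<Omega> (Cinf \<Omega>). \<forall>p\<in>csn (Cinf \<Omega>). negligible_wrt \<Omega> (Cinf \<Omega>) p R}"

definition gen_functions :: "'a::euclidean_space set \<Rightarrow> 'a gfun set set" where
  "gen_functions \<Omega> =
     E_moderate \<Omega> // {(R, S). R \<in> E_moderate \<Omega> \<and> S \<in> E_moderate \<Omega> \<and> R - S \<in> E_negligible \<Omega>}"

definition C_moderate :: "'a::euclidean_space set \<Rightarrow> 'a gnum set" where
  "C_moderate \<Omega> = {X \<in> net_maps \<Omega> normed_lcs. moderate_wrt \<Omega> normed_lcs norm X}"

definition C_negligible :: "'a::euclidean_space set \<Rightarrow> 'a gnum set" where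
  "C_negligible \<Omega> = {X \<in> net_maps \<Omega> normed_lcs. negligible_wrt \<Omega> normed_lcs norm X}"

definition C_rel :: "'a::euclidean_space set \<Rightarrow> 'a gnum rel" where
  "C_rel \<Omega> = {(X, Y). X \<in> C_moderate \<Omega> \<and> Y \<in> C_moderate \<Omega> \<and> X - Y \<in> C_negligible \<Omega>}"

definition gen_numbers :: "'a::euclidean_space set \<Rightarrow> 'a gnum set set" where
  "gen_numbers \<Omega> = C_moderate \<Omega> // C_rel \<Omega>"

definition gen_number_class :: "'a::euclidean_space set \<Rightarrow> 'a gnum \<Rightarrow> 'a gnum set" where
  "gen_number_class \<Omega> X = C_rel \<Omega> `` {X}"

definition point_moderate :: "'a::euclidean_space set \<Rightarrow> 'a gpoint set" where
  "point_moderate \<Omega> = {X \<in> net_maps \<Omega> normed_lcs.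
     (\<forall>\<phi>\<in>carrier (SKI \<Omega>). \<forall>\<epsilon>\<in>eps_I. X \<phi> \<epsilon> \<in> \<Omega>) \<and> moderate_wrt \<Omega> normed_lcs norm X}"

definition point_rel :: "'a::euclidean_space set \<Rightarrow> 'a gpoint rel" where
  "point_rel \<Omega> = {(X, Y). X \<in> point_moderate \<Omega> \<and> Y \<in> point_moderate \<Omega> \<and>
     negligible_wrt \<Omega> normed_lcs norm (X - Y)}"

definition gen_points :: "'a::euclidean_space set \<Rightarrow> 'a gpoint set set" where
  "gen_points \<Omega> = point_moderate \<Omega> // point_rel \<Omega>"

definition compact_gen_points :: "'a::euclidean_space set \<Rightarrow> 'a gpoint set set" where
  "compact_gen_points \<Omega> = {Xt \<in> gen_points \<Omega>. \<exists>X\<in>Xt. \<exists>K. compact K \<and> K \<subseteq> \<Omega> \<and>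
     (\<forall>\<phi>\<in>test_objects \<Omega>. \<exists>\<epsilon>\<^sub>0>0. \<forall>\<epsilon>\<in>eps_I. \<epsilon> < \<epsilon>\<^sub>0 \<longrightarrow> X \<phi> \<epsilon> \<in> K)}"

definition insert_point :: "'a gfun \<Rightarrow> 'a gpoint \<Rightarrow> 'a gnum" where
  "insert_point R X = (\<lambda>\<phi> \<epsilon>. R \<phi> \<epsilon> (X \<phi> \<epsilon>))"

end

theory Submission
  imports Defs
begin

text \<open>
  The growth conditions involve iterated directional derivatives of maps that are only known to be
  smooth along smooth curves, so neither the existence of these derivatives nor a chain rule comes
  for free; Boman's theorem provides both.  If \<open>g\<close> is smooth along all smooth curves in the plane,
  then its directional derivatives of every order are locally bounded, because a smooth curve can
  run through any rapidly converging sequence of line segments.  Djokovic's polarization identity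
  for finite differences turns this into bounds for mixed differences, so that the \<open>t\<close>-derivatives
  of \<open>(g(t, s) - g(t, 0)) / s\<close> are bounded uniformly in \<open>s\<close> and the limit for \<open>s \<rightarrow> 0\<close> is smooth.
  Hence \<open>(\<phi>, x) \<mapsto> R(\<phi>)\<^sub>\<epsilon>(x)\<close> has continuous, commuting derivatives of all orders in \<open>x\<close> and along
  kernels.

  A derivative of \<open>R(\<phi>)\<^sub>\<epsilon>(X(\<phi>)\<^sub>\<epsilon>)\<close> in the direction \<open>\<psi>\<close> is \<open>(d R(\<phi>)(\<psi>)\<^sub>\<epsilon>)(X(\<phi>)\<^sub>\<epsilon>)\<close> plus products of
  \<open>(\<partial>\<^sub>i R(\<phi>)\<^sub>\<epsilon>)(X(\<phi>)\<^sub>\<epsilon>)\<close> with the coordinates of \<open>d X(\<phi>)(\<psi>)\<^sub>\<epsilon>\<close>, and \<open>d R(\<cdot>)(\<psi>)\<close>, \<open>\<partial>\<^sub>i R\<close> satisfy the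
  same estimates as \<open>R\<close>.  Induction on the order of differentiation reduces everything to order
  zero: there, compactness bounds \<open>R\<close>, and the mean value theorem bounds \<open>R(X) - R(X')\<close>.
\<close>

section \<open>Smooth functions on the real line\<close>

text \<open>In Boman's argument a bound along every single line is not enough: it controls
  \<open>k\<close>-th differences in \<open>t\<close> by \<open>a ^ k\<close>, but without the extra
  factor \<open>s\<close> that a quotient by \<open>s\<close> requires. Polarization supplies this
  factor, since \<open>k\<close> steps in \<open>t\<close> and one in \<open>s\<close> are rewritten
  as \<open>Suc k\<close>-th differences along single directions, where the directional bounds
  apply. On the side of the estimates, families are compared at arbitrary selections of points from
  a compact set. This is equivalent to uniformity over the set, and it admits the intermediate point
  of the mean value theorem, which changes with \<open>\<epsilon>\<close>. Moderate and negligible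
  nets are both instances of a class closed under domination, sums and products with moderate nets,
  so the chain rule estimate is made once. The compact set belonging to a generalized point is known
  for one representative only. Equivalent points differ by nets tending to 0, so a slightly larger
  compact subset of \<open>\<Omega>\<close> serves any other.\<close>

primrec times_diff :: "nat \<Rightarrow> (real \<Rightarrow> 'b::real_normed_vector) \<Rightarrow> bool" where
  "times_diff 0 f \<longleftrightarrow> True"
| "times_diff (Suc n) f \<longleftrightarrow> (\<exists>f'. (\<forall>t. (f has_vector_derivative f' t) (at t)) \<and> times_diff n f')"

text \<open>Quantifying over finite orders lets each closure property be proved by induction on the
  order, with no formula for higher derivatives.\<close>

definition smooth :: "(real \<Rightarrow> 'b::real_normed_vector) \<Rightarrow> bool" where
  "smooth f \<longleftrightarrow> (\<forall>n. times_diff n f)"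

definition vd :: "(real \<Rightarrow> 'b::real_normed_vector) \<Rightarrow> real \<Rightarrow> 'b" where
  "vd f t = vector_derivative f (at t)"

lemma vd_eq: "(f has_vector_derivative l) (at t) \<Longrightarrow> vd f t = l"
  unfolding vd_def by (rule vector_derivative_at)

named_theorems smooth_intros

lemma times_diff_mono: "times_diff (Suc n) f \<Longrightarrow> times_diff n f"
  by (induction n arbitrary: f) auto

lemma smoothI:
  assumes "\<And>t. (f has_vector_derivative f' t) (at t)" "smooth f'"
  shows "smooth f"
  unfolding smooth_def
proof
  fix n show "times_diff n f"
    using assms by (cases n) (auto simp: smooth_def)
qed

lemma smooth_vd:
  assumes "smooth f"
  shows "(f has_vector_derivative vd f t) (at t)" and "smooth (vd f)"
proof -
  have *: "times_diff (Suc n) f" for n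
    using assms by (simp only: smooth_def)
  obtain f' where f': "\<And>t. (f has_vector_derivative f' t) (at t)"
    using *[of 0] by auto
  have e: "vd f = f'"
    using f' by (intro ext vd_eq)
  show "(f has_vector_derivative vd f t) (at t)"
    using f' e by simp
  show "smooth (vd f)"
    unfolding smooth_def
  proof
    fix n
    obtain g where g: "\<And>t. (f has_vector_derivative g t) (at t)" "times_diff n g"
      using *[of n] by auto
    have "g = vd f"
      using g(1) by (intro ext vd_eq[symmetric])
    then show "times_diff n (vd f)"
      using g by simp
  qed
qed

lemma smooth_continuous: "smooth f \<Longrightarrow> continuous_on A f"
  by (meson continuous_at_imp_continuous_on has_vector_derivative_continuous smooth_vd(1))

lemma smooth_isCont: "smooth f \<Longrightarrow> isCont f t"
  by (meson has_vector_derivative_continuous smooth_vd(1))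

lemma smooth_funpow: "smooth f \<Longrightarrow> smooth ((vd ^^ n) f)"
  by (induction n) (simp_all add: smooth_vd(2))

lemma smooth_const [smooth_intros]: "smooth (\<lambda>t. c)"
proof -
  have "times_diff n (\<lambda>t. 0 :: 'a)" for n
    by (induction n) (auto intro!: exI[of _ "\<lambda>t. 0"])
  then have "smooth (\<lambda>t. 0 :: 'a)"
    by (simp add: smooth_def)
  then show ?thesis
    by (rule smoothI[rotated]) auto
qed

lemma smooth_id [smooth_intros]: "smooth (\<lambda>t. t)"
  by (rule smoothI[of _ "\<lambda>t. 1"]) (auto intro: smooth_const)

lemma times_diff_add:
  "times_diff n f \<Longrightarrow> times_diff n g \<Longrightarrow> times_diff n (\<lambda>t. f t + g t)"
proof (induction n arbitrary: f g)
  case (Suc n)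
  then obtain f' g' where "\<And>t. (f has_vector_derivative f' t) (at t)" "times_diff n f'"
    "\<And>t. (g has_vector_derivative g' t) (at t)" "times_diff n g'"
    by auto
  then show ?case
    using Suc.IH[of f' g'] by (auto intro!: exI[of _ "\<lambda>t. f' t + g' t"] has_vector_derivative_add)
qed simp

lemma smooth_add [smooth_intros]: "smooth f \<Longrightarrow> smooth g \<Longrightarrow> smooth (\<lambda>t. f t + g t)"
  by (simp add: smooth_def times_diff_add)

lemma times_diff_bilinear:
  assumes B: "bounded_bilinear B" and "times_diff n f" "times_diff n g"
  shows "times_diff n (\<lambda>t. B (f t) (g t))"
  using assms(2,3)
proof (induction n arbitrary: f g)
  case (Suc n)
  then obtain f' g' where *: "\<And>t. (f has_vector_derivative f' t) (at t)" "times_diff n f'"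
    "\<And>t. (g has_vector_derivative g' t) (at t)" "times_diff n g'"
    by auto
  have "((\<lambda>t. B (f t) (g t)) has_vector_derivative B (f t) (g' t) + B (f' t) (g t)) (at t)" for t
    by (rule bounded_bilinear.has_vector_derivative[OF B *(1,3)])
  moreover have "times_diff n (\<lambda>t. B (f t) (g' t) + B (f' t) (g t))"
    by (intro times_diff_add Suc.IH * Suc.prems[THEN times_diff_mono])
  ultimately show ?case
    unfolding times_diff.simps by (intro exI conjI allI)
qed simp

lemma smooth_bilinear:
  "bounded_bilinear B \<Longrightarrow> smooth f \<Longrightarrow> smooth g \<Longrightarrow> smooth (\<lambda>t. B (f t) (g t))"
  by (simp add: smooth_def times_diff_bilinear)

lemma smooth_scaleR [smooth_intros]: "smooth f \<Longrightarrow> smooth g \<Longrightarrow> smooth (\<lambda>t. f t *\<^sub>R g t)"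
  by (rule smooth_bilinear[OF bounded_bilinear_scaleR])

lemma smooth_mult [smooth_intros]:
  fixes f g :: "real \<Rightarrow> 'b::real_normed_algebra"
  shows "smooth f \<Longrightarrow> smooth g \<Longrightarrow> smooth (\<lambda>t. f t * g t)"
  by (rule smooth_bilinear[OF bounded_bilinear_mult])

lemma smooth_linear:
  fixes f :: "real \<Rightarrow> 'b::real_normed_vector"
  assumes L: "bounded_linear L" and f: "smooth f"
  shows "smooth (\<lambda>t. L (f t))"
proof -
  have "times_diff n (\<lambda>t. L (f t))" if "times_diff n f" for n and f :: "real \<Rightarrow> 'b"
    using that
  proof (induction n arbitrary: f)
    case (Suc n)
    then obtain f' where *: "\<And>t. (f has_vector_derivative f' t) (at t)" "times_diff n f'"
      by auto
    have "((\<lambda>t. L (f t)) has_vector_derivative L (f' t)) (at t)" for t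
      by (rule bounded_linear.has_vector_derivative[OF L *(1)])
    then show ?case
      using Suc.IH[OF *(2)] unfolding times_diff.simps by (intro exI conjI allI)
  qed simp
  then show ?thesis
    using f by (simp add: smooth_def)
qed

lemma smooth_minus [smooth_intros]: "smooth f \<Longrightarrow> smooth (\<lambda>t. - f t)"
  by (rule smooth_linear[OF bounded_linear_minus[OF bounded_linear_ident]])

lemma smooth_diff [smooth_intros]: "smooth f \<Longrightarrow> smooth g \<Longrightarrow> smooth (\<lambda>t. f t - g t)"
  using smooth_add[OF _ smooth_minus, of f g] by simp

lemma smooth_comp:
  fixes f :: "real \<Rightarrow> 'b::real_normed_vector" and a :: "real \<Rightarrow> real"
  assumes "smooth f" "smooth a"
  shows "smooth (\<lambda>t. f (a t))"
proof -
  have "times_diff n (\<lambda>t. f (a t))" if "times_diff n f" "times_diff n a" for n a and f :: "real \<Rightarrow> 'b"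
    using that
  proof (induction n arbitrary: f a)
    case (Suc n)
    then obtain f' a' where *: "\<And>t. (f has_vector_derivative f' t) (at t)" "times_diff n f'"
      "\<And>t. (a has_vector_derivative a' t) (at t)" "times_diff n a'"
      by auto
    have "((f \<circ> a) has_vector_derivative a' t *\<^sub>R f' (a t)) (at t)" for t
      by (rule vector_diff_chain_at[OF *(3) *(1)])
    moreover have "times_diff n (\<lambda>t. a' t *\<^sub>R f' (a t))"
      by (rule times_diff_bilinear[OF bounded_bilinear_scaleR *(4)
            Suc.IH[OF *(2) Suc.prems(2)[THEN times_diff_mono]]])
    ultimately show ?case
      unfolding times_diff.simps o_def by (intro exI conjI allI)
  qed simp
  then show ?thesis
    using assms by (simp add: smooth_def)
qed

text \<open>Near a point a function is often replaced by a cut-off version defined on the whole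
  line; the two agree as germs, which is all that differentiation sees.\<close>

lemma smooth_local:
  fixes f :: "real \<Rightarrow> 'b::real_normed_vector"
  assumes "\<And>t. \<exists>g. smooth g \<and> (\<forall>\<^sub>F s in nhds t. f s = g s)"
  shows "smooth f"
proof -
  have "times_diff n f" if "\<And>t. \<exists>g. smooth g \<and> (\<forall>\<^sub>F s in nhds t. f s = g s)"
    for n and f :: "real \<Rightarrow> 'b"
    using that
  proof (induction n arbitrary: f)
    case (Suc n)
    have D: "(f has_vector_derivative vd g t) (at t)"
      if "smooth g" "\<forall>\<^sub>F s in nhds t. f s = g s" for g t
      using smooth_vd(1)[OF that(1), of t] that(2)
      by (subst has_vector_derivative_cong_ev[where g = g and S = UNIV])
         (auto elim: eventually_mono dest: eventually_nhds_x_imp_x)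
    have E: "\<exists>g. smooth g \<and> (\<forall>\<^sub>F s in nhds t. vd f s = g s)" for t
    proof -
      obtain g where g: "smooth g" "\<forall>\<^sub>F s in nhds t. f s = g s"
        using Suc.prems by blast
      have "\<forall>\<^sub>F s in nhds t. \<forall>\<^sub>F r in nhds s. f r = g r"
        using g(2) by (simp add: eventually_eventually)
      then have "\<forall>\<^sub>F s in nhds t. vd f s = vd g s"
        by eventually_elim (use D g(1) vd_eq in blast)
      then show ?thesis
        using smooth_vd(2)[OF g(1)] by blast
    qed
    have "(f has_vector_derivative vd f t) (at t)" for t
      using Suc.prems[of t] D vd_eq by metis
    then show ?case
      using Suc.IH[OF E] unfolding times_diff.simps by (intro exI conjI allI)
  qed simp
  then show ?thesis
    using assms by (simp add: smooth_def)
qed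

lemma vd_cong_ev:
  assumes "\<forall>\<^sub>F s in nhds t. f s = g s"
  shows "vd f t = vd g t"
  unfolding vd_def
  by (rule vector_derivative_cong_eq) (use assms in auto)

lemma funpow_vd_cong_ev:
  assumes "\<forall>\<^sub>F s in nhds t. f s = g s"
  shows "\<forall>\<^sub>F s in nhds t. (vd ^^ n) f s = (vd ^^ n) g s"
proof (induction n)
  case (Suc n)
  then have "\<forall>\<^sub>F s in nhds t. \<forall>\<^sub>F r in nhds s. (vd ^^ n) f r = (vd ^^ n) g r"
    by (simp add: eventually_eventually)
  then show ?case
    by eventually_elim (simp add: vd_cong_ev)
qed (use assms in simp)

lemma vd_affine:
  assumes "smooth f"
  shows "vd (\<lambda>t. f (a + b * t)) = (\<lambda>t. b *\<^sub>R vd f (a + b * t))"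
proof
  fix t
  have "((\<lambda>t. a + b * t) has_vector_derivative b) (at t)"
    by (auto intro!: derivative_eq_intros)
  then have "((f \<circ> (\<lambda>t. a + b * t)) has_vector_derivative b *\<^sub>R vd f (a + b * t)) (at t)"
    using smooth_vd(1)[OF assms] by (rule vector_diff_chain_at)
  then show "vd (\<lambda>t. f (a + b * t)) t = b *\<^sub>R vd f (a + b * t)"
    by (simp add: o_def vd_eq)
qed

lemma vd_scaleR: "smooth f \<Longrightarrow> vd (\<lambda>t. c *\<^sub>R f t) = (\<lambda>t. c *\<^sub>R vd f t)"
  by (intro ext vd_eq has_vector_derivative_scaleR[where f="\<lambda>_. c" and f'=0, simplified]) (auto intro: smooth_vd)

lemma vd_add: "smooth f \<Longrightarrow> smooth g \<Longrightarrow> vd (\<lambda>t. f t + g t) = (\<lambda>t. vd f t + vd g t)"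
  by (intro ext vd_eq has_vector_derivative_add) (auto intro: smooth_vd)

lemma vd_diff: "smooth f \<Longrightarrow> smooth g \<Longrightarrow> vd (\<lambda>t. f t - g t) = (\<lambda>t. vd f t - vd g t)"
  by (intro ext vd_eq has_vector_derivative_diff) (auto intro: smooth_vd)

lemma vd_scaleR_left: "smooth f \<Longrightarrow> vd (\<lambda>t. f t *\<^sub>R c) = (\<lambda>t. vd f t *\<^sub>R c)"
  by (intro ext vd_eq bounded_linear.has_vector_derivative[OF bounded_linear_scaleR_left])
     (rule smooth_vd)

lemma smooth_scaleR_left: "smooth f \<Longrightarrow> smooth (\<lambda>t. f t *\<^sub>R c)"
  by (rule smooth_linear[OF bounded_linear_scaleR_left])

lemma funpow_vd_scaleR_left:
  "smooth f \<Longrightarrow> (vd ^^ n) (\<lambda>t. f t *\<^sub>R c) = (\<lambda>t. (vd ^^ n) f t *\<^sub>R c)"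
  by (induction n) (auto simp: vd_scaleR_left smooth_funpow)

lemma funpow_vd_scaleR: "smooth f \<Longrightarrow> (vd ^^ n) (\<lambda>t. c *\<^sub>R f t) = (\<lambda>t. c *\<^sub>R (vd ^^ n) f t)"
  by (induction n) (auto simp: vd_scaleR smooth_funpow)

lemma funpow_vd_add:
  "smooth f \<Longrightarrow> smooth g \<Longrightarrow> (vd ^^ n) (\<lambda>t. f t + g t) = (\<lambda>t. (vd ^^ n) f t + (vd ^^ n) g t)"
  by (induction n) (auto simp: vd_add smooth_funpow)

lemma smooth_affine: "smooth f \<Longrightarrow> smooth (\<lambda>t. f (a + b * t))"
  by (erule smooth_comp) (intro smooth_intros)

lemma funpow_vd_affine:
  assumes "smooth f"
  shows "(vd ^^ n) (\<lambda>t. f (a + b * t)) = (\<lambda>t. b ^ n *\<^sub>R (vd ^^ n) f (a + b * t))"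
proof (induction n)
  case (Suc n)
  then show ?case
    using assms
    by (simp add: vd_scaleR vd_affine smooth_funpow smooth_affine)
       (simp add: mult.commute)
qed simp

section \<open>Bump functions\<close>

text \<open>The classical flat function \<open>exp (- 1 / x)\<close> with a polynomial factor in
  \<open>1 / x\<close>, which makes the family closed under differentiation.\<close>

definition flat :: "real poly \<Rightarrow> real \<Rightarrow> real" where
  "flat p x = (if x > 0 then poly p (1 / x) * exp (- (1 / x)) else 0)"

lemma poly_exp_decay: "((\<lambda>y::real. poly p y * exp (- y)) \<longlongrightarrow> 0) at_top"
proof -
  have "((\<lambda>y::real. coeff p i * y ^ i * exp (- y)) \<longlongrightarrow> 0) at_top" for i
    using tendsto_mult_right_zero[OF tendsto_power_div_exp_0[of i], of "coeff p i"]
    by (simp add: exp_minus divide_inverse algebra_simps)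
  then have "((\<lambda>y::real. \<Sum>i\<le>degree p. coeff p i * y ^ i * exp (- y)) \<longlongrightarrow> 0) at_top"
    by (intro tendsto_null_sum)
  then show ?thesis
    by (simp add: poly_altdef sum_distrib_right)
qed

text \<open>With \<open>y = 1 / x\<close>, the derivative of \<open>p(y) exp(-y)\<close> is
  \<open>y^2 (p(y) - p'(y)) exp(-y)\<close>. At 0 the right-hand difference quotient is
  \<open>y p(y) exp(-y)\<close>, again of decaying type.\<close>

lemma flat_deriv:
  "(flat p has_vector_derivative flat ([:0, 0, 1:] * (p - pderiv p)) x) (at x)"
proof (cases "x = 0")
  case True
  have r: "((\<lambda>h. flat p h / h) \<longlongrightarrow> 0) (at_right 0)"
  proof -
    have "((\<lambda>h::real. poly (pCons 0 p) (inverse h) * exp (- inverse h)) \<longlongrightarrow> 0) (at_right 0)"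
      by (rule filterlim_compose[OF poly_exp_decay filterlim_inverse_at_top_right])
    then show ?thesis
      by (rule Lim_transform_eventually)
         (auto simp: eventually_at_right_less flat_def field_simps eventually_at_filter)
  qed
  have l: "((\<lambda>h. flat p h / h) \<longlongrightarrow> 0) (at_left 0)"
    by (rule Lim_transform_eventually[OF tendsto_const]) (auto simp: eventually_at_filter flat_def)
  have "((\<lambda>h. flat p h / h) \<longlongrightarrow> 0) (at 0)"
    using l r by (simp add: filterlim_split_at)
  then have "(flat p has_field_derivative 0) (at 0)"
    by (simp add: has_field_derivative_iff flat_def)
  then show ?thesis
    using True by (simp add: flat_def has_real_derivative_iff_has_vector_derivative)
next
  case False
  then consider "x > 0" | "x < 0" by linarith
  then show ?thesis
  proof cases
    case 1
    have "((\<lambda>x. poly p (1 / x) * exp (- (1 / x))) has_field_derivative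
        flat ([:0, 0, 1:] * (p - pderiv p)) x) (at x)"
      using 1 by (auto intro!: derivative_eq_intros DERIV_chain2[OF poly_DERIV] simp: flat_def field_simps power2_eq_square)
    moreover have "\<forall>\<^sub>F y in nhds x. flat p y = poly p (1 / y) * exp (- (1 / y))"
      using eventually_nhds_in_open[of "{0<..}" x] 1 by (auto elim!: eventually_mono simp: flat_def)
    ultimately have "(flat p has_field_derivative
        flat ([:0, 0, 1:] * (p - pderiv p)) x) (at x)"
      by (subst DERIV_cong_ev[OF refl _ refl])
    then show ?thesis
      by (simp add: has_real_derivative_iff_has_vector_derivative)
  next
    case 2
    have "\<forall>\<^sub>F y in nhds x. flat p y = 0"
      using eventually_nhds_in_open[of "{..<0}" x] 2 by (auto elim!: eventually_mono simp: flat_def)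
    then have "(flat p has_field_derivative 0) (at x)"
      by (subst DERIV_cong_ev[OF refl _ refl]) auto
    then show ?thesis
      using 2 by (simp add: has_real_derivative_iff_has_vector_derivative flat_def)
  qed
qed

lemma smooth_flat: "smooth (flat p)"
proof -
  have "times_diff n (flat p)" for n
    by (induction n arbitrary: p) (use flat_deriv in \<open>simp; blast\<close>)+
  then show ?thesis
    by (simp add: smooth_def)
qed

text \<open>The normalized integral \<open>T\<close> of a bump supported in \<open>[0, 1]\<close> is
  a smooth step; the plateau is the product of a shifted copy of \<open>T\<close> and its mirror
  image.\<close>

lemma plateau_exists:
  obtains \<eta> :: "real \<Rightarrow> real" where "smooth \<eta>"
    "\<And>t. \<bar>t\<bar> \<le> 1 \<Longrightarrow> \<eta> t = 1" "\<And>t. \<bar>t\<bar> \<ge> 2 \<Longrightarrow> \<eta> t = 0" "\<And>t. 0 \<le> \<eta> t" "\<And>t. \<eta> t \<le> 1"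
proof -
  define b where "b = (\<lambda>t. flat 1 t * flat 1 (1 - t))"
  have sb: "smooth b"
    unfolding b_def by (intro smooth_mult smooth_flat smooth_comp[OF smooth_flat] smooth_diff smooth_const smooth_id)
  have b0: "b t \<ge> 0" for t
    by (simp add: b_def flat_def)
  \<comment> \<open>The lower limit \<open>-1\<close> lies strictly left of the support of
    \<open>b\<close>. So the derivative of the integral, available for \<open>t > -1\<close>, and
    the vanishing of \<open>S\<close> on the negative axis cover the line with overlap.\<close>
  define S where "S = (\<lambda>x. integral {-1..x} b)"
  have cb: "continuous_on A b" for A
    by (rule smooth_continuous[OF sb])
  have i: "b integrable_on {x..y}" for x y
    by (rule integrable_continuous_interval[OF cb])
  have dS: "(S has_vector_derivative b t) (at t)" if "t > -1" for t
  proof -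
    have "(S has_vector_derivative b t) (at t within {-1..t+1})"
      unfolding S_def by (rule integral_has_vector_derivative[OF cb]) (use that in auto)
    then show ?thesis
      using that by (simp add: at_within_Icc_at)
  qed
  have S0: "S t = 0" if "t \<le> 0" for t
  proof -
    have "S t = integral {-1..t} (\<lambda>_. 0)"
      unfolding S_def by (rule integral_cong) (use that in \<open>auto simp: b_def flat_def\<close>)
    then show ?thesis by simp
  qed
  have dS': "(S has_vector_derivative b t) (at t)" for t
  proof (cases "t > -1")
    case False
    have "\<forall>\<^sub>F y in nhds t. S y = 0"
      using eventually_nhds_in_open[of "{..<0}" t] False by (auto elim!: eventually_mono simp: S0)
    then have "(S has_field_derivative 0) (at t)"
      by (subst DERIV_cong_ev[OF refl _ refl]) auto
    moreover have "b t = 0"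
      using False by (simp add: b_def flat_def)
    ultimately show ?thesis
      by (simp add: has_real_derivative_iff_has_vector_derivative)
  qed (rule dS)
  have sS: "smooth S"
    using dS' sb by (rule smoothI)
  have Sc: "S t = S 1" if "t \<ge> 1" for t
  proof -
    have "S t = S 1 + integral {1..t} b"
      unfolding S_def using that i by (intro Henstock_Kurzweil_Integration.integral_combine[symmetric]) auto
    moreover have "integral {1..t} b = integral {1..t} (\<lambda>_. 0)"
      by (rule integral_cong) (auto simp: b_def flat_def)
    ultimately show ?thesis by simp
  qed
  have mono: "S x \<le> S y" if "x \<le> y" for x y
    using dS' b0 that
    by (intro DERIV_nonneg_imp_nondecreasing[of x y S]) (auto simp: has_real_derivative_iff_has_vector_derivative)
  have pos: "S 1 > 0"
  proof -
    have "S (1/4) < S (3/4)"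
    proof (rule DERIV_pos_imp_increasing[of "1/4" "3/4" S])
      fix x :: real assume x: "1/4 \<le> x" "x \<le> 3/4"
      have "b x > 0"
        using x by (simp add: b_def flat_def)
      then show "\<exists>y. (S has_real_derivative y) (at x) \<and> 0 < y"
        using dS' by (auto simp: has_real_derivative_iff_has_vector_derivative)
    qed simp
    moreover have "S (3/4) \<le> S 1" "S (1/4) \<ge> S 0"
      by (auto intro: mono)
    ultimately show ?thesis using S0[of 0] by simp
  qed
  define T where "T = (\<lambda>t. S t / S 1)"
  have sT: "smooth T"
  proof -
    have "smooth (\<lambda>t. S t * inverse (S 1))"
      by (intro smooth_mult sS smooth_const)
    then show ?thesis unfolding T_def by (simp add: divide_inverse)
  qed
  have T: "T t = 0" if "t \<le> 0" for t
    using S0 that by (simp add: T_def)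
  have T1: "T t = 1" if "t \<ge> 1" for t
    using Sc[OF that] pos by (simp add: T_def)
  have T01: "0 \<le> T t" "T t \<le> 1" for t
  proof -
    have "0 \<le> S t"
      using S0[of "min t 0"] mono[of "min t 0" t] by simp
    moreover have "S t \<le> S 1"
      using Sc[of "max t 1"] mono[of t "max t 1"] by simp
    ultimately show "0 \<le> T t" "T t \<le> 1"
      using pos by (simp_all add: T_def)
  qed
  show thesis
  \<comment> \<open>For \<open>|t| \<le> 1\<close> both arguments of \<open>T\<close> are at least
    1; for \<open>|t| \<ge> 2\<close> one of them is at most 0.\<close>
  proof (rule that[of "\<lambda>t. T (t + 2) * T (2 - t)"])
    show "smooth (\<lambda>t. T (t + 2) * T (2 - t))"
      by (intro smooth_mult smooth_comp[OF sT] smooth_diff smooth_add smooth_const smooth_id)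
  next
    fix t :: real assume "\<bar>t\<bar> \<ge> 2"
    then have "t + 2 \<le> 0 \<or> 2 - t \<le> 0"
      by linarith
    then show "T (t + 2) * T (2 - t) = 0"
      by (auto simp: T)
  qed (auto simp: T T1 T01 intro!: mult_le_one)
qed

text \<open>Precomposition with \<open>\<rho>\<close> confines a curve to its values near
  \<open>t0\<close> without changing its germ there, so curves that leave an open set elsewhere
  become admissible.\<close>

lemma localizer:
  fixes \<delta> t0 :: real
  assumes "\<delta> > 0"
  obtains \<rho> where "smooth \<rho>" "\<And>t. \<bar>\<rho> t - t0\<bar> < \<delta>" "\<forall>\<^sub>F t in nhds t0. \<rho> t = t"
    "\<And>t. \<bar>t - t0\<bar> \<le> \<delta> / 3 \<Longrightarrow> \<rho> t = t"
proof -
  obtain \<eta> :: "real \<Rightarrow> real" where \<eta>: "smooth \<eta>"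
    "\<And>t. \<bar>t\<bar> \<le> 1 \<Longrightarrow> \<eta> t = 1" "\<And>t. \<bar>t\<bar> \<ge> 2 \<Longrightarrow> \<eta> t = 0" "\<And>t. 0 \<le> \<eta> t" "\<And>t. \<eta> t \<le> 1"
    using plateau_exists by blast
  \<comment> \<open>The cut-off acts between the distances \<open>\<delta> / 3\<close> and
    \<open>2 \<delta> / 3\<close> from \<open>t0\<close>: closer in, \<open>\<rho>\<close> is the
    identity; farther out, it is constantly \<open>t0\<close>.\<close>
  define \<rho> where "\<rho> = (\<lambda>t. t0 + (t - t0) * \<eta> (3 / \<delta> * (t - t0)))"
  have eq: "\<rho> t = t" if "\<bar>t - t0\<bar> \<le> \<delta> / 3" for t
  proof -
    have "3 / \<delta> * \<bar>t - t0\<bar> \<le> 3 / \<delta> * (\<delta> / 3)"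
      using that assms by (intro mult_left_mono) auto
    then have "\<bar>3 / \<delta> * (t - t0)\<bar> \<le> 1"
      unfolding abs_mult using assms by simp
    then show ?thesis by (simp add: \<rho>_def \<eta>)
  qed
  show thesis
  proof (rule that[of \<rho>])
    show "smooth \<rho>"
      unfolding \<rho>_def by (intro smooth_mult smooth_comp[OF \<eta>(1)] smooth_diff smooth_add smooth_const smooth_id)
    show "\<bar>\<rho> t - t0\<bar> < \<delta>" for t
    proof (cases "\<bar>3 / \<delta> * (t - t0)\<bar> \<ge> 2")
      case True
      then show ?thesis
        using assms by (simp add: \<rho>_def \<eta>)
    next
      case False
      then have "\<bar>t - t0\<bar> < \<delta>"
        using assms by (simp add: abs_mult field_simps)
      moreover have "\<bar>t - t0\<bar> * \<bar>\<eta> (3 / \<delta> * (t - t0))\<bar> \<le> \<bar>t - t0\<bar> * 1"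
        using \<eta>(4,5) by (intro mult_left_mono) auto
      ultimately show ?thesis
        by (simp add: \<rho>_def abs_mult)
    qed
    show "\<forall>\<^sub>F t in nhds t0. \<rho> t = t"
      unfolding eventually_nhds_metric
      by (rule exI[of _ "\<delta> / 3"]) (use assms eq in \<open>auto simp: dist_real_def\<close>)
  qed (rule eq)
qed

section \<open>Special curves\<close>

text \<open>Termwise differentiation under the Weierstrass M-test. In the induction \<open>f\<close>
  is replaced by its derivatives, whose majorants are those of the next order.\<close>

lemma smooth_suminf:
  fixes f :: "nat \<Rightarrow> real \<Rightarrow> 'b::banach"
  assumes "\<And>j. smooth (f j)"
    and "\<And>k. \<exists>M. summable M \<and> (\<forall>j t. norm ((vd ^^ k) (f j) t) \<le> M j)"
  shows "smooth (\<lambda>t. \<Sum>j. f j t)"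
proof -
  have "times_diff n (\<lambda>t. \<Sum>j. f j t)"
    if "\<And>j. smooth (f j)" "\<And>k. \<exists>M. summable M \<and> (\<forall>j t. norm ((vd ^^ k) (f j) t) \<le> M j)"
    for n and f :: "nat \<Rightarrow> real \<Rightarrow> 'b"
    using that
  proof (induction n arbitrary: f)
    case (Suc n)
    obtain M where M: "summable M" "\<And>j t. norm (vd (f j) t) \<le> M j"
      using Suc.prems(2)[of 1] by auto
    obtain M0 where M0: "summable M0" "\<And>j t. norm (f j t) \<le> M0 j"
      using Suc.prems(2)[of 0] by auto
    have ul: "uniform_limit UNIV (\<lambda>n t. \<Sum>i<n. vd (f i) t) (\<lambda>t. \<Sum>i. vd (f i) t) sequentially"
      by (rule Weierstrass_m_test) (use M in auto)
    have sm: "(\<lambda>j. f j t) sums (\<Sum>j. f j t)" for t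
      by (intro summable_sums summable_comparison_test'[OF M0(1), of 0]) (use M0 in auto)
    have "\<exists>g. \<forall>x\<in>UNIV. (\<lambda>n. f n x) sums (g x) \<and>
        (g has_derivative (\<lambda>h. h *\<^sub>R (\<Sum>i. vd (f i) x))) (at x within UNIV)"
    proof (rule has_derivative_series[where f' = "\<lambda>i x h. h *\<^sub>R vd (f i) x"])
      show "(f n has_derivative (\<lambda>h. h *\<^sub>R vd (f n) x)) (at x within UNIV)" for n x
        using smooth_vd(1)[OF Suc.prems(1), of n x] by (simp add: has_vector_derivative_def)
      fix e :: real assume "e > 0"
      from uniform_limitD[OF ul this]
      show "\<forall>\<^sub>F n in sequentially. \<forall>x\<in>UNIV. \<forall>h.
          norm ((\<Sum>i<n. h *\<^sub>R vd (f i) x) - h *\<^sub>R (\<Sum>i. vd (f i) x)) \<le> e * norm h"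
      proof eventually_elim
        case (elim n)
        have "norm ((\<Sum>i<n. h *\<^sub>R vd (f i) x) - h *\<^sub>R (\<Sum>i. vd (f i) x)) =
            \<bar>h\<bar> * dist (\<Sum>i<n. vd (f i) x) (\<Sum>i. vd (f i) x)" for x h
          by (simp add: dist_norm scaleR_sum_right[symmetric] scaleR_diff_right[symmetric])
        moreover have "dist (\<Sum>i<n. vd (f i) x) (\<Sum>i. vd (f i) x) \<le> e" for x
          using elim by (simp add: less_imp_le)
        ultimately show ?case
          by (auto simp: mult.commute[of e] intro!: mult_left_mono)
      qed
    qed (use sm in auto)
    then obtain g where g: "\<And>x. (\<lambda>n. f n x) sums g x"
      "\<And>x. (g has_derivative (\<lambda>h. h *\<^sub>R (\<Sum>i. vd (f i) x))) (at x)"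
      by auto
    have "g = (\<lambda>t. \<Sum>j. f j t)"
      using g(1) by (auto simp: sums_iff)
    then have D: "((\<lambda>t. \<Sum>j. f j t) has_vector_derivative (\<Sum>i. vd (f i) x)) (at x)" for x
      using g(2) by (simp add: has_vector_derivative_def)
    have "\<exists>M. summable M \<and> (\<forall>j t. norm ((vd ^^ k) (vd (f j)) t) \<le> M j)" for k
      using Suc.prems(2)[of "Suc k"] by (simp only: funpow_Suc_right o_def)
    then have "times_diff n (\<lambda>t. \<Sum>i. vd (f i) t)"
      by (intro Suc.IH) (auto intro: smooth_vd(2)[OF Suc.prems(1)])
    with D show ?case
      unfolding times_diff.simps by (intro exI conjI allI)
  qed simp
  then show ?thesis
    using assms unfolding smooth_def by blast
qed

lemma funpow_vd_const0: "(vd ^^ n) (\<lambda>t. 0) = (\<lambda>t. 0)"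
proof (induction n)
  case (Suc n)
  have "vd (\<lambda>t. 0 :: 'a) = (\<lambda>t. 0)"
    by (intro ext vd_eq) simp
  with Suc show ?case by simp
qed simp

lemma compact_support_bounded_derivs:
  fixes f :: "real \<Rightarrow> 'b::real_normed_vector"
  assumes "smooth f" "\<And>t. \<bar>t\<bar> \<ge> 2 \<Longrightarrow> f t = 0"
  obtains B where "0 \<le> B" "\<And>t. norm ((vd ^^ k) f t) \<le> B"
proof -
  have "compact ((vd ^^ k) f ` {-2..2})"
    by (intro compact_continuous_image smooth_continuous smooth_funpow assms) auto
  then have "bounded ((vd ^^ k) f ` {-2..2})"
    by (rule compact_imp_bounded)
  then obtain B where B: "0 < B" "\<And>t. t \<in> {-2..2} \<Longrightarrow> norm ((vd ^^ k) f t) \<le> B"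
    unfolding bounded_pos by auto
  have "norm ((vd ^^ k) f t) \<le> B" for t
  proof (cases "t \<in> {-2..2}")
    case False
    then have "\<bar>t\<bar> > 2" by auto
    then have "\<forall>\<^sub>F s in nhds t. \<bar>s\<bar> > 2"
      by (intro order_tendstoD(1)[of "\<lambda>s. \<bar>s\<bar>" "\<bar>t\<bar>"]) (auto intro!: tendsto_rabs tendsto_ident_at filterlim_ident)
    then have "\<forall>\<^sub>F s in nhds t. f s = 0"
      by eventually_elim (use assms in auto)
    from funpow_vd_cong_ev[OF this, of k] show ?thesis
      using B(1) by (auto simp: funpow_vd_const0 dest: eventually_nhds_x_imp_x)
  qed (use B in auto)
  then show thesis
    using that[of B] B(1) by simp
qed

text \<open>The decay \<open>1 / j!\<close> beats all powers of the time scale \<open>2\<^sup>-\<^sup>j\<close> on which the \<open>j\<close>-th piece is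
  inserted, so the series of pieces converges with all derivatives.\<close>

lemma special_curve:
  fixes p q :: "nat \<Rightarrow> 'b::banach"
  assumes p: "\<And>j. norm (p j) \<le> 1 / fact j" and q: "\<And>j. norm (q j) \<le> 1 / fact j"
  obtains c where "smooth c" "c 0 = 0"
    "\<And>j. \<forall>\<^sub>F t in nhds ((1/2) ^ j). c t = p j + (t - (1/2) ^ j) *\<^sub>R q j"
proof -
  obtain \<eta> :: "real \<Rightarrow> real" where \<eta>: "smooth \<eta>"
    "\<And>t. \<bar>t\<bar> \<le> 1 \<Longrightarrow> \<eta> t = 1" "\<And>t. \<bar>t\<bar> \<ge> 2 \<Longrightarrow> \<eta> t = 0"
    using plateau_exists by metis
  \<comment> \<open>Carries the linear term: a time scale \<open>b j\<close> multiplies its slope by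
    \<open>b j\<close>, which the factor \<open>inverse (b j)\<close> in \<open>f\<close>
    undoes.\<close>
  define \<theta> where "\<theta> = (\<lambda>t. t * \<eta> t)"
  have \<theta>: "smooth \<theta>" "\<And>t. \<bar>t\<bar> \<ge> 2 \<Longrightarrow> \<theta> t = 0"
    unfolding \<theta>_def by (intro smooth_intros \<eta>) (auto simp: \<eta>)
  \<comment> \<open>The rescaled time \<open>b j * t - 8\<close> vanishes at
    \<open>t = (1/2) ^ j\<close>. While \<open>b j * t\<close> lies in \<open>[7, 9]\<close>, any
    other index gives at most 5 or at least 14, which is outside the window \<open>(6, 10)\<close>
    where a piece is alive. At \<open>t = 0\<close> every argument is \<open>-8\<close>, whence
    \<open>c 0 = 0\<close>.\<close>
  define b :: "nat \<Rightarrow> real" where "b = (\<lambda>j. 8 * 2 ^ j)"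
  have b: "b j \<ge> 1" for j
    unfolding b_def using one_le_power[of "2::real" j] by linarith
  define f where "f = (\<lambda>j t. \<eta> (- 8 + b j * t) *\<^sub>R p j + \<theta> (- 8 + b j * t) *\<^sub>R (inverse (b j) *\<^sub>R q j))"
  define c where "c = (\<lambda>t. \<Sum>j. f j t)"
  have sf: "smooth (f j)" for j
    unfolding f_def by (intro smooth_add smooth_scaleR_left smooth_affine \<eta> \<theta>)
  have df: "(vd ^^ k) (f j) = (\<lambda>t. b j ^ k *\<^sub>R ((vd ^^ k) \<eta> (- 8 + b j * t) *\<^sub>R p j
       + (vd ^^ k) \<theta> (- 8 + b j * t) *\<^sub>R (inverse (b j) *\<^sub>R q j)))" for j k
    unfolding f_def
    by (simp only: funpow_vd_add funpow_vd_scaleR_left funpow_vd_affine smooth_affine smooth_scaleR_left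
          \<eta>(1) \<theta>(1)) (simp add: scaleR_add_right mult.assoc)
  have "smooth c"
    unfolding c_def
  proof (rule smooth_suminf[OF sf])
    fix k
    obtain B where B: "0 \<le> B" "\<And>t. norm ((vd ^^ k) \<eta> t) \<le> B"
      using compact_support_bounded_derivs[OF \<eta>(1,3)] by blast
    obtain B' where B': "0 \<le> B'" "\<And>t. norm ((vd ^^ k) \<theta> t) \<le> B'"
      using compact_support_bounded_derivs[OF \<theta>] by blast
    define M :: "nat \<Rightarrow> real" where "M = (\<lambda>j. b j ^ k * ((B + B') / fact j))"
    have "M = (\<lambda>j. (8 ^ k * (B + B')) * (inverse (fact j) * (2 ^ k) ^ j))"
      by (auto simp: M_def b_def fun_eq_iff field_simps power_mult[symmetric] power_mult_distrib mult.commute)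
    then have "summable M"
      using summable_mult[OF summable_exp, of "8 ^ k * (B + B')" "2 ^ k :: real"] by simp
    moreover have "norm ((vd ^^ k) (f j) t) \<le> M j" for j t
    proof -
      have 1: "norm ((vd ^^ k) \<eta> (- 8 + b j * t) *\<^sub>R p j) \<le> B * (1 / fact j)"
        unfolding norm_scaleR using B p[of j] by (intro mult_mono) (auto simp del: real_norm_def simp: real_norm_def[symmetric])
      have "norm (inverse (b j) *\<^sub>R q j) \<le> 1 * norm (q j)"
        unfolding norm_scaleR using b[of j] by (intro mult_right_mono) (auto simp: field_simps)
      then have 2: "norm ((vd ^^ k) \<theta> (- 8 + b j * t) *\<^sub>R (inverse (b j) *\<^sub>R q j)) \<le> B' * (1 / fact j)"
        unfolding norm_scaleR[of "(vd ^^ k) \<theta> (- 8 + b j * t)"] using B' q[of j] by (intro mult_mono) (auto simp del: real_norm_def simp: real_norm_def[symmetric])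
      have "norm ((vd ^^ k) \<eta> (- 8 + b j * t) *\<^sub>R p j
       + (vd ^^ k) \<theta> (- 8 + b j * t) *\<^sub>R (inverse (b j) *\<^sub>R q j)) \<le> (B + B') / fact j"
        using norm_triangle_mono[OF 1 2] by (simp add: add_divide_distrib)
      then show ?thesis
        using b[of j] unfolding df M_def norm_scaleR by (intro mult_mono) auto
    qed
    ultimately show "\<exists>M. summable M \<and> (\<forall>j t. norm ((vd ^^ k) (f j) t) \<le> M j)"
      by blast
  qed
  moreover have "c 0 = 0"
    by (simp add: c_def f_def \<eta> \<theta>)
  moreover have "\<forall>\<^sub>F t in nhds ((1/2) ^ j). c t = p j + (t - (1/2) ^ j) *\<^sub>R q j" for j
  proof -
    have eq: "c t = p j + (t - (1/2) ^ j) *\<^sub>R q j" if t: "\<bar>t - (1/2) ^ j\<bar> < 1 / b j" for t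
    proof -
      have u: "- 8 + b j * t = b j * (t - (1/2) ^ j)"
        by (simp add: b_def algebra_simps power_one_over)
      have "b j * \<bar>t - (1/2) ^ j\<bar> \<le> b j * (1 / b j)"
        using t b[of j] by (intro mult_left_mono) auto
      then have bt: "\<bar>b j * (t - (1/2) ^ j)\<bar> \<le> 1"
        unfolding abs_mult using b[of j] by simp
      then have fj: "f j t = p j + (t - (1/2) ^ j) *\<^sub>R q j"
        unfolding f_def u \<theta>_def using b[of j] by (simp add: \<eta>)
      have "f i t = 0" if "i \<noteq> j" for i
      proof -
        have tb: "t * b j \<ge> 7" "t * b j \<le> 9"
          using bt u by (simp_all add: abs_le_iff mult.commute[of t])
        have "\<bar>- 8 + b i * t\<bar> \<ge> 2"
        proof (cases "i < j")
          case True
          then obtain d where d: "j = Suc (i + d)"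
            by (metis less_imp_Suc_add)
          have e: "b j = 2 * 2 ^ d * b i"
            unfolding b_def d by (simp only: power_Suc power_add mult_ac)
          have "t > 0"
            using tb(1) b[of j] mult_nonpos_nonneg[of t "b j"] by linarith
          then have "t * b i * 1 \<le> t * b i * 2 ^ d"
            using b[of i] by (intro mult_left_mono) auto
          then have "2 * (t * b i) \<le> t * b j"
            by (simp add: e algebra_simps)
          moreover have "b i * t = t * b i"
            by (rule mult.commute)
          ultimately have "b i * t \<le> 5"
            using tb by linarith
          then show ?thesis
            using abs_ge_minus_self[of "- 8 + b i * t"] by linarith
        next
          case False
          then obtain d where d: "i = Suc (j + d)"
            using \<open>i \<noteq> j\<close> less_imp_Suc_add[of j i] by (auto simp: not_less)
          have e: "b i = 2 * 2 ^ d * b j"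
            unfolding b_def d by (simp only: power_Suc power_add mult_ac)
          have "t * b j * 1 \<le> t * b j * 2 ^ d"
            using tb by (intro mult_left_mono) auto
          then have "2 * (t * b j) \<le> t * b i"
            by (simp add: e algebra_simps)
          moreover have "b i * t = t * b i"
            by (rule mult.commute)
          ultimately have "b i * t \<ge> 14"
            using tb by linarith
          then show ?thesis
            using abs_ge_self[of "- 8 + b i * t"] by linarith
        qed
        then show ?thesis
          by (simp add: f_def \<eta> \<theta>)
      qed
      then have "c t = (\<Sum>i\<in>{j}. f i t)"
        unfolding c_def by (intro suminf_finite) auto
      then show ?thesis
        using fj by simp
    qed
    show ?thesis
      unfolding eventually_nhds_metric
      by (rule exI[of _ "1 / b j"]) (use b[of j] eq in \<open>auto simp: dist_real_def\<close>)
  qed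
  ultimately show thesis
    using that by blast
qed

section \<open>Finite differences\<close>

text \<open>The \<open>n\<close>-th forward difference up to the sign \<open>(-1) ^ n\<close>,
  summed over subsets instead of with binomial coefficients to match the polarization
  identity.\<close>

definition sdiff :: "nat \<Rightarrow> ('v::real_vector \<Rightarrow> 'b::real_vector) \<Rightarrow> 'v \<Rightarrow> 'v \<Rightarrow> 'b" where
  "sdiff n f a y = (\<Sum>J\<in>Pow {1..n}. (-1) ^ card J *\<^sub>R f (y + real (card J) *\<^sub>R a))"

lemma sum_Pow_insert:
  assumes "finite B" "j \<notin> B"
  shows "(\<Sum>A\<in>Pow (insert j B). F A) = (\<Sum>A\<in>Pow B. F A) + (\<Sum>A\<in>Pow B. F (insert j A))"
proof -
  have "inj_on (insert j) (Pow B)"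
    using assms(2) by (intro inj_onI) (metis PowD insert_ident subsetD)
  moreover have "Pow B \<inter> insert j ` Pow B = {}"
    using assms(2) by auto
  ultimately show ?thesis
    using assms by (simp add: Pow_insert sum.union_disjoint sum.reindex)
qed

lemma sdiff_0 [simp]: "sdiff 0 f a y = f y"
  by (simp add: sdiff_def)

lemma sdiff_Suc: "sdiff (Suc n) f a y = sdiff n f a y - sdiff n f a (y + a)"
proof -
  have "{1..Suc n} = insert (Suc n) {1..n}"
    by auto
  moreover have "card (insert (Suc n) A) = Suc (card A)" if "A \<in> Pow {1..n}" for A
    using that by (subst card_insert_disjoint) (auto intro: finite_subset)
  ultimately show ?thesis
    by (simp add: sdiff_def sum_Pow_insert scaleR_add_left add.assoc add.commute[of a] sum_negf del: PowI Pow_iff cong: sum.cong)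
qed

text \<open>Expanding the differences on the right, all terms but \<open>J = {}\<close> cancel: for \<open>j = card J > 0\<close>
  the argument \<open>x + (\<Sum>r\<in>A. (1 - j / r) *\<^sub>R h r)\<close> does not depend on whether \<open>j \<in> A\<close>.\<close>

lemma djokovic_identity:
  fixes f :: "'v::real_vector \<Rightarrow> 'b::real_vector"
  shows "(\<Sum>A\<in>Pow {1..n}. (-1) ^ card A *\<^sub>R f (x + (\<Sum>r\<in>A. h r))) =
    (\<Sum>A\<in>Pow {1..n}. (-1) ^ card A *\<^sub>R
       sdiff n f (- (\<Sum>r\<in>A. (1 / real r) *\<^sub>R h r)) (x + (\<Sum>r\<in>A. h r)))"
proof -
  define G where "G = (\<lambda>j A. (-1) ^ card A *\<^sub>R f (x + (\<Sum>r\<in>A. (1 - real j / real r) *\<^sub>R h r)))"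
  have arg: "x + (\<Sum>r\<in>A. h r) + real j *\<^sub>R (- (\<Sum>r\<in>A. (1 / real r) *\<^sub>R h r)) =
      x + (\<Sum>r\<in>A. (1 - real j / real r) *\<^sub>R h r)" for j A
    by (simp add: scaleR_sum_right sum_negf scaleR_diff_left sum_subtractf)
  have vanish: "(\<Sum>A\<in>Pow {1..n}. G j A) = 0" if "j \<in> {1..n}" for j
  proof -
    have "{1..n} = insert j ({1..n} - {j})"
      using that by auto
    moreover have "G j (insert j A) = - G j A" if "A \<in> Pow ({1..n} - {j})" for A
    proof -
      have "finite A" "j \<notin> A"
        using that by (auto intro: finite_subset)
      then show ?thesis
        using \<open>j \<in> {1..n}\<close> by (simp add: G_def)
    qed
    ultimately show ?thesis
      using sum_Pow_insert[of "{1..n} - {j}" j "G j"] by (simp add: sum_negf del: Pow_iff cong: sum.cong)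
  qed
  have "(\<Sum>A\<in>Pow {1..n}. (-1) ^ card A *\<^sub>R
       sdiff n f (- (\<Sum>r\<in>A. (1 / real r) *\<^sub>R h r)) (x + (\<Sum>r\<in>A. h r))) =
     (\<Sum>A\<in>Pow {1..n}. \<Sum>J\<in>Pow {1..n}. (-1) ^ card J *\<^sub>R G (card J) A)"
    unfolding sdiff_def arg G_def by (simp add: scaleR_sum_right mult.commute)
  also have "\<dots> = (\<Sum>J\<in>Pow {1..n}. (-1) ^ card J *\<^sub>R (\<Sum>A\<in>Pow {1..n}. G (card J) A))"
    by (subst sum.swap) (simp add: scaleR_sum_right)
  also have "\<dots> = (\<Sum>J\<in>{{} :: nat set}. (-1) ^ card J *\<^sub>R (\<Sum>A\<in>Pow {1..n}. G (card J) A))"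
  proof (rule sum.mono_neutral_right)
    show "\<forall>J\<in>Pow {1..n} - {{}}. (-1) ^ card J *\<^sub>R (\<Sum>A\<in>Pow {1..n}. G (card J) A) = 0"
    proof
      fix J assume J: "J \<in> Pow {1..n} - {{}}"
      then have "finite J" by (auto intro: finite_subset)
      then have "card J \<in> {1..n}"
        using J card_mono[of "{1..n}" J] by (auto simp: Suc_le_eq card_gt_0_iff)
      then show "(-1) ^ card J *\<^sub>R (\<Sum>A\<in>Pow {1..n}. G (card J) A) = 0"
        by (simp only: vanish scaleR_zero_right)
    qed
  qed auto
  finally show ?thesis
    by (simp add: G_def)
qed

lemma sdiff_has_vector_derivative:
  assumes "smooth h"
  shows "((\<lambda>u. sdiff k h a u) has_vector_derivative sdiff k (vd h) a u) (at u)"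
proof (induction k arbitrary: u)
  case (Suc k)
  have "((\<lambda>u. u + a) has_vector_derivative 1) (at u)"
    by (auto intro!: derivative_eq_intros)
  from vector_diff_chain_at[OF this Suc.IH[of "u + a"]]
  show ?case
    unfolding sdiff_Suc by (intro has_vector_derivative_diff Suc.IH) (simp add: o_def)
next
  case 0
  have "sdiff 0 h a = h"
    by (simp add: fun_eq_iff)
  then show ?case
    using smooth_vd(1)[OF assms] by simp
qed

text \<open>Mean value inequality, iterated: the derivative of \<open>G\<close> is the same defect
  for \<open>vd h\<close> with one difference less, already bounded on \<open>[t, t + a]\<close>.
  With \<open>L = 0\<close> a derivative bounds a difference; with \<open>L\<close> the derivative
  at \<open>t\<close>, differences recover the derivative.\<close>

lemma sdiff_mean_value:
  fixes h :: "real \<Rightarrow> 'b::real_normed_vector"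
  assumes "smooth h" "0 \<le> a"
    and "\<And>u. t \<le> u \<Longrightarrow> u \<le> t + real k * a \<Longrightarrow> norm ((vd ^^ k) h u - L) \<le> e"
  shows "norm ((-1) ^ k *\<^sub>R sdiff k h a t - a ^ k *\<^sub>R L) \<le> a ^ k * e"
  using assms(1,3)
proof (induction k arbitrary: h t)
  case (Suc k)
  define G where "G = (\<lambda>u. (-1) ^ k *\<^sub>R sdiff k h a u - (a ^ k * u) *\<^sub>R L)"
  define G' where "G' = (\<lambda>u. (-1) ^ k *\<^sub>R sdiff k (vd h) a u - a ^ k *\<^sub>R L)"
  have "(G has_vector_derivative G' u) (at u)" for u
    unfolding G_def G'_def
    by (intro has_vector_derivative_diff bounded_linear.has_vector_derivative[OF bounded_linear_scaleR_right]
         bounded_linear.has_vector_derivative[OF bounded_linear_scaleR_left] sdiff_has_vector_derivative Suc.prems(1))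
       (auto intro!: derivative_eq_intros)
  then have D: "(G has_derivative (\<lambda>x. x *\<^sub>R G' u)) (at u within {t..t+a})" for u
    by (simp add: has_vector_derivative_def has_derivative_at_withinI)
  have "norm (G' u) \<le> a ^ k * e" if "u \<in> {t..t+a}" for u
    unfolding G'_def
  proof (rule Suc.IH)
    fix w assume "u \<le> w" "w \<le> u + real k * a"
    then have "norm ((vd ^^ Suc k) h w - L) \<le> e"
      using that by (intro Suc.prems(2)) (auto simp: algebra_simps)
    then show "norm ((vd ^^ k) (vd h) w - L) \<le> e"
      by (simp only: funpow_Suc_right o_def)
  qed (rule smooth_vd(2)[OF Suc.prems(1)])
  then have "norm (G (t + a) - G t) \<le> (a ^ k * e) * norm (t + a - t)"
    by (intro differentiable_bound[OF convex_real_interval(5) D])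
       (auto intro!: onorm_le simp: mult.commute mult_left_mono assms(2))
  moreover have "G (t + a) - G t = (-1) ^ Suc k *\<^sub>R sdiff (Suc k) h a t - a ^ Suc k *\<^sub>R L"
    by (simp add: G_def sdiff_Suc algebra_simps)
  ultimately show ?case
    using assms(2) by (simp add: mult.commute mult.left_commute)
qed simp

section \<open>Smoothness along curves in the plane\<close>

text \<open>The right side has the shape of \<open>lcs_has_deriv\<close>, so it links derivatives in
  normed spaces to those in locally convex spaces.\<close>

lemma has_vector_derivative_quotient:
  "(f has_vector_derivative l) (at t) \<longleftrightarrow>
     ((\<lambda>h. inverse h *\<^sub>R (f (t + h) - f t)) \<longlongrightarrow> l) (at 0)"
proof -
  have eq: "norm (f (t + h) - f t - h *\<^sub>R l) / \<bar>h\<bar> = norm (inverse h *\<^sub>R (f (t + h) - f t) - l)"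
    if "h \<noteq> 0" for h
  proof -
    have "inverse h *\<^sub>R (f (t + h) - f t) - l = inverse h *\<^sub>R (f (t + h) - f t - h *\<^sub>R l)"
      using that by (simp add: scaleR_diff_right)
    then show ?thesis
      by (simp add: divide_inverse mult.commute)
  qed
  have "(f has_vector_derivative l) (at t) \<longleftrightarrow>
      ((\<lambda>h. norm (f (t + h) - f t - h *\<^sub>R l) / norm h) \<longlongrightarrow> 0) (at 0)"
    by (simp add: has_vector_derivative_def has_derivative_at bounded_linear_scaleR_left)
  also have "\<dots> \<longleftrightarrow> ((\<lambda>h. norm (inverse h *\<^sub>R (f (t + h) - f t) - l)) \<longlongrightarrow> 0) (at 0)"
    by (intro filterlim_cong refl) (auto simp: eventually_at_filter eq intro!: always_eventually)
  also have "\<dots> \<longleftrightarrow> ((\<lambda>h. inverse h *\<^sub>R (f (t + h) - f t)) \<longlongrightarrow> l) (at 0)"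
    by (simp add: tendsto_norm_zero_iff LIM_zero_iff)
  finally show ?thesis .
qed

text \<open>Bounded second derivatives make difference quotients approximate derivatives at a rate
  independent of \<open>m\<close>. Pointwise convergence of the quotients then forces the
  derivatives to be Cauchy, and their limit is the derivative of \<open>H\<close>; the argument
  repeats for the sequence of derivatives.\<close>

lemma limit_of_smooth_sequence:
  fixes h :: "nat \<Rightarrow> real \<Rightarrow> 'b::banach"
  assumes "\<And>m. smooth (h m)"
    and lim: "\<And>t. (\<lambda>m. h m t) \<longlonglongrightarrow> H t"
    and bdd: "\<And>k T. \<exists>M. \<forall>m t. \<bar>t\<bar> \<le> T \<longrightarrow> norm ((vd ^^ k) (h m) t) \<le> M"
  shows "smooth H" and "(\<lambda>m. vd (h m) t) \<longlonglongrightarrow> vd H t"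
proof -
  have step: "\<exists>L. (\<lambda>m. vd (h m) t) \<longlonglongrightarrow> L \<and> (H has_vector_derivative L) (at t)"
    if sh: "\<And>m. smooth (h m)" and lim: "\<And>t. (\<lambda>m. h m t) \<longlonglongrightarrow> H t"
    and bdd: "\<And>k T. \<exists>M. \<forall>m t. \<bar>t\<bar> \<le> T \<longrightarrow> norm ((vd ^^ k) (h m) t) \<le> M"
    for h :: "nat \<Rightarrow> real \<Rightarrow> 'b" and H t
  proof -
    obtain M where "\<And>m s. \<bar>s\<bar> \<le> \<bar>t\<bar> + 1 \<Longrightarrow> norm ((vd ^^ 2) (h m) s) \<le> M"
      using bdd[of "\<bar>t\<bar> + 1" 2] by blast
    then have M: "\<And>m s. \<bar>s\<bar> \<le> \<bar>t\<bar> + 1 \<Longrightarrow> norm (vd (vd (h m)) s) \<le> M"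
      by (simp add: numeral_2_eq_2)
    have M0: "M \<ge> 0"
      using M[of 0 0] norm_ge_zero by (rule order_trans[rotated]) simp
    define Q where "Q = (\<lambda>f u. inverse u *\<^sub>R (f (t + u) - f t) :: 'b)"
    have Q: "norm (Q (h m) u - vd (h m) t) \<le> M * \<bar>u\<bar>" if u: "u \<noteq> 0" "\<bar>u\<bar> \<le> 1" for m u
    proof -
      have sub: "closed_segment t (t + u) \<subseteq> {s. \<bar>s\<bar> \<le> \<bar>t\<bar> + 1}"
        using u by (auto simp: closed_segment_eq_real_ivl split: if_splits)
      have D: "norm (vd (h m) s - vd (h m) t) \<le> M * \<bar>u\<bar>" if "s \<in> closed_segment t (t + u)" for s
      proof -
        have "norm (vd (h m) s - vd (h m) t) \<le> M * norm (s - t)"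
        proof (rule differentiable_bound[of "closed_segment t (t+u)" "vd (h m)" "\<lambda>s x. x *\<^sub>R vd (vd (h m)) s"])
          show "(vd (h m) has_derivative (\<lambda>x. x *\<^sub>R vd (vd (h m)) s)) (at s within closed_segment t (t+u))" for s
            using smooth_vd(1)[OF smooth_vd(2)[OF sh], of m s]
            by (simp add: has_vector_derivative_def has_derivative_at_withinI)
          show "onorm (\<lambda>x. x *\<^sub>R vd (vd (h m)) s) \<le> M" if "s \<in> closed_segment t (t + u)" for s
            using M[of s m] sub that by (intro onorm_le) (auto simp: mult.commute[of M] intro!: mult_left_mono)
        qed (use that in auto)
        also have "\<dots> \<le> M * \<bar>u\<bar>"
          using that M0 by (intro mult_left_mono) (auto simp: closed_segment_eq_real_ivl split: if_splits)
        finally show ?thesis .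
      qed
      have "norm (h m (t + u) - h m t - (t + u - t) *\<^sub>R vd (h m) t) \<le> norm (t + u - t) * (M * \<bar>u\<bar>)"
        by (rule vector_differentiable_bound_linearization[where S = "closed_segment t (t + u)"])
           (auto intro: D has_vector_derivative_at_within smooth_vd(1)[OF sh])
      moreover have "h m (t + u) - h m t - u *\<^sub>R vd (h m) t = u *\<^sub>R (Q (h m) u - vd (h m) t)"
        using u by (simp add: Q_def algebra_simps)
      ultimately have "\<bar>u\<bar> * norm (Q (h m) u - vd (h m) t) \<le> \<bar>u\<bar> * (M * \<bar>u\<bar>)"
        by simp
      then show ?thesis
        using u by (subst (asm) mult_le_cancel_left_pos) auto
    qed
    have limQ: "(\<lambda>m. Q (h m) u) \<longlonglongrightarrow> Q H u" for u
      unfolding Q_def by (intro tendsto_intros lim)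
    have "Cauchy (\<lambda>m. vd (h m) t)"
    proof (rule metric_CauchyI)
      fix e :: real assume e: "e > 0"
      \<comment> \<open>Chosen so that the error \<open>M * u\<close> of the quotient is at most
        \<open>e / 4\<close>; the summand 1 covers \<open>M = 0\<close>.\<close>
      define u where "u = min 1 (e / (4 * (M + 1)))"
      have u: "u > 0" "u \<le> 1" and "u \<le> e / (4 * (M + 1))"
        using e M0 by (auto simp: u_def)
      then have "M * u \<le> (M + 1) * (e / (4 * (M + 1)))"
        using M0 by (intro mult_mono) auto
      also have "\<dots> = e / 4"
        using M0 by (simp add: field_simps)
      finally have Mu: "M * \<bar>u\<bar> \<le> e / 4"
        using u by simp
      obtain N where N: "\<And>m n. m \<ge> N \<Longrightarrow> n \<ge> N \<Longrightarrow> dist (Q (h m) u) (Q (h n) u) < e / 2"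
        using metric_CauchyD[OF LIMSEQ_imp_Cauchy[OF limQ], of "e/2" u] e by auto
      have "dist (vd (h m) t) (vd (h n) t) < e" if "m \<ge> N" "n \<ge> N" for m n
      proof -
        have "dist (vd (h m) t) (vd (h n) t) \<le> dist (vd (h m) t) (Q (h m) u) +
            dist (Q (h m) u) (Q (h n) u) + dist (Q (h n) u) (vd (h n) t)"
          by metric
        also have "\<dots> < e / 4 + e / 2 + e / 4"
          using Q[of u m] Q[of u n] u Mu N[OF that] by (auto simp: dist_norm norm_minus_commute)
        finally show ?thesis by simp
      qed
      then show "\<exists>N. \<forall>m\<ge>N. \<forall>n\<ge>N. dist (vd (h m) t) (vd (h n) t) < e"
        by blast
    qed
    then obtain L where L: "(\<lambda>m. vd (h m) t) \<longlonglongrightarrow> L"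
      by (auto simp: Cauchy_convergent_iff convergent_def)
    have QL: "norm (Q H u - L) \<le> M * \<bar>u\<bar>" if u: "u \<noteq> 0" "\<bar>u\<bar> \<le> 1" for u
      by (rule LIMSEQ_le_const2[OF tendsto_norm[OF tendsto_diff[OF limQ L]]]) (use Q[OF u] in auto)
    have "(Q H \<longlongrightarrow> L) (at 0)"
    proof (rule Lim_null[THEN iffD2], rule Lim_null_comparison)
      show "\<forall>\<^sub>F u in at 0. norm (Q H u - L) \<le> M * \<bar>u\<bar>"
        unfolding eventually_at by (rule exI[of _ 1]) (auto intro: QL)
      show "((\<lambda>u. M * \<bar>u\<bar>) \<longlongrightarrow> 0) (at 0)"
        by (rule tendsto_eq_intros tendsto_rabs_zero tendsto_ident_at refl | simp)+
    qed
    then have "(H has_vector_derivative L) (at t)"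
      unfolding has_vector_derivative_quotient Q_def .
    with L show ?thesis by blast
  qed
  have "times_diff n H"
    if "\<And>m. smooth (h m)" and "\<And>t. (\<lambda>m. h m t) \<longlonglongrightarrow> H t"
    and "\<And>k T. \<exists>M. \<forall>m t. \<bar>t\<bar> \<le> T \<longrightarrow> norm ((vd ^^ k) (h m) t) \<le> M"
    for n and h :: "nat \<Rightarrow> real \<Rightarrow> 'b" and H
    using that
  proof (induction n arbitrary: h H)
    case (Suc n)
    obtain L where L: "\<And>t. (\<lambda>m. vd (h m) t) \<longlonglongrightarrow> L t" "\<And>t. (H has_vector_derivative L t) (at t)"
      using step[OF Suc.prems] by metis
    have "\<exists>M. \<forall>m t. \<bar>t\<bar> \<le> T \<longrightarrow> norm ((vd ^^ k) (vd (h m)) t) \<le> M" for k T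
      using Suc.prems(3)[of T "Suc k"] by (simp only: funpow_Suc_right o_def)
    then have "times_diff n L"
      using Suc.IH[of "\<lambda>m. vd (h m)" L] L(1) smooth_vd(2)[OF Suc.prems(1)] by blast
    with L(2) show ?case
      unfolding times_diff.simps by (intro exI conjI allI)
  qed simp
  then show "smooth H"
    using assms unfolding smooth_def by blast
  show "(\<lambda>m. vd (h m) t) \<longlonglongrightarrow> vd H t"
    using step[OF assms, of t] vd_eq by blast
qed

text \<open>The hypothesis of Boman's theorem in the plane: as a function of two variables,
  \<open>g\<close> is not even assumed to be continuous.\<close>

definition smooth2 :: "(real \<Rightarrow> real \<Rightarrow> 'b::real_normed_vector) \<Rightarrow> bool" where
  "smooth2 g \<longleftrightarrow> (\<forall>a b. smooth a \<longrightarrow> smooth b \<longrightarrow> smooth (\<lambda>t. g (a t) (b t)))"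

lemma smooth2D: "smooth2 g \<Longrightarrow> smooth a \<Longrightarrow> smooth b \<Longrightarrow> smooth (\<lambda>t. g (a t) (b t))"
  by (simp add: smooth2_def)

lemma smooth2_swap: "smooth2 g \<Longrightarrow> smooth2 (\<lambda>s t. g t s)"
  by (simp add: smooth2_def)

lemma smooth2_line: "smooth2 g \<Longrightarrow> smooth (\<lambda>t. g (x + t * \<alpha>) (y + t * \<beta>))"
  by (rule smooth2D) (intro smooth_intros | assumption)+

lemma smooth2_left: "smooth2 g \<Longrightarrow> smooth (\<lambda>t. g t y)"
  using smooth2D[OF _ smooth_id smooth_const] .

lemma smooth2_right: "smooth2 g \<Longrightarrow> smooth (\<lambda>s. g x s)"
  using smooth2D[OF _ smooth_const smooth_id] .

text \<open>Factorial speed is the rate demanded by \<open>special_curve\<close>;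
  \<open>j \<le> r j\<close> lets lower bounds that grow with the index survive the
  reindexing.\<close>

lemma fast_subsequence:
  fixes X :: "nat \<Rightarrow> 'b::metric_space"
  assumes "X \<longlonglongrightarrow> l"
  obtains r where "\<And>j. j \<le> r j" "\<And>j. dist (X (r j)) l \<le> 1 / fact j"
proof -
  have "\<exists>N. j \<le> N \<and> dist (X N) l \<le> 1 / fact j" for j
  proof -
    obtain N where "\<And>n. n \<ge> N \<Longrightarrow> dist (X n) l < 1 / fact j"
      using metric_LIMSEQ_D[OF assms, of "1 / fact j"] by auto
    then show ?thesis
      by (intro exI[of _ "max j N"]) (auto intro: less_imp_le)
  qed
  then show thesis
    using that by metis
qed

text \<open>If the bound failed, a special curve would run through points at which the derivatives
  explode, and the composition with it would have an unbounded derivative on \<open>[0, 1]\<close>.\<close>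

lemma smooth2_directional_bound:
  fixes g :: "real \<Rightarrow> real \<Rightarrow> 'b::banach"
  assumes g: "smooth2 g"
  obtains M where "\<And>x y \<alpha> \<beta>. \<bar>x\<bar> \<le> T \<Longrightarrow> \<bar>y\<bar> \<le> T \<Longrightarrow> \<bar>\<alpha>\<bar> \<le> 1 \<Longrightarrow> \<bar>\<beta>\<bar> \<le> 1 \<Longrightarrow>
      norm ((vd ^^ n) (\<lambda>t. g (x + t * \<alpha>) (y + t * \<beta>)) 0) \<le> M"
proof (rule ccontr)
  assume "\<not> thesis"
  then have "\<exists>x y \<alpha> \<beta>. \<bar>x\<bar> \<le> T \<and> \<bar>y\<bar> \<le> T \<and> \<bar>\<alpha>\<bar> \<le> 1 \<and> \<bar>\<beta>\<bar> \<le> 1 \<and>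
      norm ((vd ^^ n) (\<lambda>t. g (x + t * \<alpha>) (y + t * \<beta>)) 0) > M" for M
    using that by (meson not_le)
  \<comment> \<open>The \<open>j\<close>-th segment will be traversed at speed
    \<open>1 / fact j\<close>, which multiplies the \<open>n\<close>-th derivative by
    \<open>(1 / fact j) ^ n\<close>; this threshold leaves more than \<open>j\<close>.\<close>
  then have "\<forall>j. \<exists>x y \<alpha> \<beta>. \<bar>x\<bar> \<le> T \<and> \<bar>y\<bar> \<le> T \<and> \<bar>\<alpha>\<bar> \<le> 1 \<and> \<bar>\<beta>\<bar> \<le> 1 \<and>
      norm ((vd ^^ n) (\<lambda>t. g (x + t * \<alpha>) (y + t * \<beta>)) 0) > real j * fact j ^ n"
    by blast
  then obtain x y \<alpha> \<beta> :: "nat \<Rightarrow> real" where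
    X: "\<And>j. \<bar>x j\<bar> \<le> T" "\<And>j. \<bar>y j\<bar> \<le> T" "\<And>j. \<bar>\<alpha> j\<bar> \<le> 1" "\<And>j. \<bar>\<beta> j\<bar> \<le> 1"
    "\<And>j. norm ((vd ^^ n) (\<lambda>t. g (x j + t * \<alpha> j) (y j + t * \<beta> j)) 0) > real j * fact j ^ n"
    unfolding choice_iff by blast
  have sc: "seq_compact ({-T..T} \<times> {-T..T})"
    by (intro compact_imp_seq_compact compact_Times compact_Icc)
  have box: "\<forall>j. (x j, y j) \<in> {-T..T} \<times> {-T..T}"
    using X(1,2) by (simp add: abs_le_iff minus_le_iff)
  obtain l r0 where l: "strict_mono r0" "((\<lambda>j. (x j, y j)) \<circ> r0) \<longlonglongrightarrow> l"
    using seq_compactE[OF sc box] by metis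
  obtain r1 where r1: "\<And>j. j \<le> r1 j" "\<And>j. dist (((\<lambda>j. (x j, y j)) \<circ> r0) (r1 j)) l \<le> 1 / fact j"
    using fast_subsequence[OF l(2)] by metis
  define r where "r = r0 \<circ> r1"
  have rj: "j \<le> r j" for j
    using r1(1)[of j] strict_mono_imp_increasing[OF l(1), of "r1 j"] by (simp add: r_def)
  have dx: "norm (x (r j) - fst l) \<le> 1 / fact j" and dy: "norm (y (r j) - snd l) \<le> 1 / fact j" for j
    using r1(2)[of j] dist_fst_le[of "(x (r j), y (r j))" l] dist_snd_le[of "(x (r j), y (r j))" l]
    by (auto simp: r_def dist_norm)
  have qb: "norm (inverse (fact j) * \<gamma>) \<le> 1 / fact j" if "\<bar>\<gamma>\<bar> \<le> 1" for j and \<gamma> :: real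
    using that by (simp add: abs_mult field_simps)
  obtain a where a: "smooth a" "a 0 = 0" "\<And>j. \<forall>\<^sub>F t in nhds ((1/2) ^ j). a t = (x (r j) - fst l) +
      (t - (1/2) ^ j) *\<^sub>R (inverse (fact j) * \<alpha> (r j))"
    by (rule special_curve[where p = "\<lambda>j. x (r j) - fst l" and q = "\<lambda>j. inverse (fact j) * \<alpha> (r j)",
          OF dx qb[OF X(3)]]) (rule that)
  obtain b where b: "smooth b" "b 0 = 0" "\<And>j. \<forall>\<^sub>F t in nhds ((1/2) ^ j). b t = (y (r j) - snd l) +
      (t - (1/2) ^ j) *\<^sub>R (inverse (fact j) * \<beta> (r j))"
    by (rule special_curve[where p = "\<lambda>j. y (r j) - snd l" and q = "\<lambda>j. inverse (fact j) * \<beta> (r j)",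
          OF dy qb[OF X(4)]]) (rule that)
  define h where "h = (\<lambda>t. g (fst l + a t) (snd l + b t))"
  have sh: "smooth h"
    unfolding h_def by (intro smooth2D[OF g] smooth_add smooth_const a b)
  have big: "norm ((vd ^^ n) h ((1/2) ^ j)) > real j" for j
  proof -
    define G where "G = (\<lambda>t. g (x (r j) + t * \<alpha> (r j)) (y (r j) + t * \<beta> (r j)))"
    have sG: "smooth G"
      unfolding G_def by (rule smooth2_line[OF g])
    define \<mu> :: real where "\<mu> = inverse (fact j)"
    have "\<forall>\<^sub>F t in nhds ((1/2) ^ j). h t = G (- \<mu> * (1/2) ^ j + \<mu> * t)"
      using a(3)[of j] b(3)[of j]
    proof eventually_elim
      case (elim t)
      have "fst l + a t = x (r j) + (- \<mu> * (1/2) ^ j + \<mu> * t) * \<alpha> (r j)"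
        "snd l + b t = y (r j) + (- \<mu> * (1/2) ^ j + \<mu> * t) * \<beta> (r j)"
        using elim by (simp_all add: \<mu>_def algebra_simps)
      then show ?case
        by (simp only: h_def G_def)
    qed
    from eventually_nhds_x_imp_x[OF funpow_vd_cong_ev[OF this, of n]]
    have "(vd ^^ n) h ((1/2) ^ j) = \<mu> ^ n *\<^sub>R (vd ^^ n) G 0"
      by (simp only: funpow_vd_affine[OF sG]) simp
    then have n: "norm ((vd ^^ n) h ((1/2) ^ j)) = \<mu> ^ n * norm ((vd ^^ n) G 0)"
      by (simp add: \<mu>_def)
    have "real j * fact j ^ n \<le> real (r j) * fact (r j) ^ n"
      using rj[of j] by (intro mult_mono power_mono fact_mono) auto
    also have "\<dots> < norm ((vd ^^ n) G 0)"
      unfolding G_def by (rule X(5))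
    finally have "\<mu> ^ n * (real j * fact j ^ n) < \<mu> ^ n * norm ((vd ^^ n) G 0)"
      by (intro mult_strict_left_mono) (auto simp: \<mu>_def)
    moreover have "\<mu> ^ n * (real j * fact j ^ n) = real j"
      by (simp add: \<mu>_def power_inverse)
    ultimately show ?thesis
      unfolding n by simp
  qed
  have "compact ((vd ^^ n) h ` {0..1})"
    by (intro compact_continuous_image smooth_continuous smooth_funpow sh) auto
  then have "bounded ((vd ^^ n) h ` {0..1})"
    by (rule compact_imp_bounded)
  then obtain B where B: "\<forall>t\<in>{0..1}. norm ((vd ^^ n) h t) \<le> B"
    unfolding bounded_iff by auto
  obtain j where j: "B < real j"
    using reals_Archimedean2 by blast
  have "norm ((vd ^^ n) h ((1/2) ^ j)) \<le> B"
    by (rule B[rule_format]) (auto simp: power_le_one)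
  with j big[of j] show False by simp
qed

text \<open>Polarization with \<open>k\<close> increments \<open>(a, 0)\<close> and one increment
  \<open>(0, a)\<close>: the left side of \<open>djokovic_identity\<close> becomes the mixed
  difference, and the right side consists of \<open>Suc k\<close>-th differences along single
  vectors of size \<open>O(a)\<close>, each controlled by the directional bound.\<close>

lemma smooth2_mixed_difference:
  fixes g :: "real \<Rightarrow> real \<Rightarrow> 'b::banach"
  assumes g: "smooth2 g"
  obtains C where "\<And>t y a. \<bar>t\<bar> \<le> T \<Longrightarrow> \<bar>y\<bar> \<le> T \<Longrightarrow> 0 < a \<Longrightarrow> a \<le> 1 \<Longrightarrow>
    norm (sdiff k (\<lambda>t. g t y) a t - sdiff k (\<lambda>t. g t (y + a)) a t) \<le> C * a ^ Suc k"
proof -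
  define n where "n = Suc k"
  define f where "f = (\<lambda>p. g (fst p) (snd p))"
  \<comment> \<open>Base points move by at most \<open>n a \<le> n\<close> in each coordinate, and a
    difference of order \<open>n\<close> with step \<open>b \<le> n\<close> reaches at most
    \<open>n b \<le> R\<close> farther; hence the box of size \<open>T + real n + R\<close>
    below.\<close>
  define R where "R = real n * real n"
  obtain M where M: "\<And>x y \<alpha> \<beta>. \<bar>x\<bar> \<le> T + real n + R \<Longrightarrow> \<bar>y\<bar> \<le> T + real n + R \<Longrightarrow> \<bar>\<alpha>\<bar> \<le> 1 \<Longrightarrow> \<bar>\<beta>\<bar> \<le> 1 \<Longrightarrow>
      norm ((vd ^^ n) (\<lambda>t. g (x + t * \<alpha>) (y + t * \<beta>)) 0) \<le> M"
    using smooth2_directional_bound[OF g, where T = "T + real n + R" and n = n] by blast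
  have bound: "norm (sdiff n f v z) \<le> (real n * a) ^ n * M"
    if v: "\<bar>fst v\<bar> \<le> real n * a" "\<bar>snd v\<bar> \<le> real n * a" and z: "\<bar>fst z\<bar> \<le> T + real n" "\<bar>snd z\<bar> \<le> T + real n"
    and a: "0 < a" "a \<le> 1" for v z a
  proof -
    \<comment> \<open>Normalizes the increment: \<open>v\<close> is \<open>b\<close> times a vector
      with coordinates at most 1, so the difference in the plane becomes a difference with step
      \<open>b\<close> of the one-variable function \<open>G\<close>.\<close>
    define b where "b = real n * a"
    have b: "b > 0" "b \<le> real n"
      using a by (auto simp: b_def n_def mult_le_cancel_left1)
    define \<alpha> \<beta> where "\<alpha> = fst v / b" and "\<beta> = snd v / b"
    have \<alpha>\<beta>: "\<bar>\<alpha>\<bar> \<le> 1" "\<bar>\<beta>\<bar> \<le> 1"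
      using v b by (auto simp: \<alpha>_def \<beta>_def b_def[symmetric])
    define G where "G = (\<lambda>t. g (fst z + t * \<alpha>) (snd z + t * \<beta>))"
    have sG: "smooth G"
      unfolding G_def by (rule smooth2_line[OF g])
    have eq: "sdiff n f v z = sdiff n G b 0"
      using b by (simp add: sdiff_def f_def G_def \<alpha>_def \<beta>_def)
    have "norm ((-1) ^ n *\<^sub>R sdiff n G b 0 - b ^ n *\<^sub>R 0) \<le> b ^ n * M"
    proof (rule sdiff_mean_value[OF sG])
      fix u assume u: "0 \<le> u" "u \<le> 0 + real n * b"
      moreover have "real n * b \<le> real n * real n"
        using b by (intro mult_left_mono) auto
      ultimately have uR: "\<bar>u\<bar> \<le> R"
        by (simp add: R_def)
      have "\<bar>u\<bar> * \<bar>\<alpha>\<bar> \<le> R * 1" "\<bar>u\<bar> * \<bar>\<beta>\<bar> \<le> R * 1"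
        using uR \<alpha>\<beta> by (intro mult_mono; simp)+
      then have "\<bar>u * \<alpha>\<bar> \<le> R" "\<bar>u * \<beta>\<bar> \<le> R"
        by (simp_all add: abs_mult)
      then have "norm ((vd ^^ n) (\<lambda>t. g ((fst z + u * \<alpha>) + t * \<alpha>) ((snd z + u * \<beta>) + t * \<beta>)) 0) \<le> M"
        using z \<alpha>\<beta> by (intro M) (auto simp: abs_le_iff)
      moreover have "(\<lambda>t. g ((fst z + u * \<alpha>) + t * \<alpha>) ((snd z + u * \<beta>) + t * \<beta>)) = (\<lambda>t. G (u + 1 * t))"
        by (simp add: G_def algebra_simps)
      ultimately show "norm ((vd ^^ n) G u - 0) \<le> M"
        by (simp only: funpow_vd_affine[OF sG]) simp
    qed (use b in auto)
    then show ?thesis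
      unfolding eq b_def[symmetric] by simp
  qed
  have "norm (sdiff k (\<lambda>t. g t y) a t - sdiff k (\<lambda>t. g t (y + a)) a t) \<le> (2 ^ n * (real n ^ n * M)) * a ^ Suc k"
    if t: "\<bar>t\<bar> \<le> T" and y: "\<bar>y\<bar> \<le> T" and a: "0 < a" "a \<le> 1" for t y a
  proof -
    define h :: "nat \<Rightarrow> real \<times> real" where "h = (\<lambda>r. if r \<le> k then (a, 0) else (0, a))"
    have n_ins: "{1..n} = insert n {1..k}"
      by (auto simp: n_def)
    have hB: "(\<Sum>r\<in>B. h r) = (real (card B) * a, 0)" if "B \<in> Pow {1..k}" for B
    proof -
      have "(\<Sum>r\<in>B. h r) = (\<Sum>r\<in>B. (a, 0))"
        using that by (intro sum.cong) (auto simp: h_def)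
      then show ?thesis by (simp add: sum_prod[symmetric] prod_eq_iff fst_sum snd_sum)
    qed
    have ins: "card (insert n B) = Suc (card B)" "(\<Sum>r\<in>insert n B. h r) = (real (card B) * a, a)"
      if "B \<in> Pow {1..k}" for B
    proof -
      have "finite B" "n \<notin> B"
        using that by (auto simp: n_def intro: finite_subset)
      then show "card (insert n B) = Suc (card B)" "(\<Sum>r\<in>insert n B. h r) = (real (card B) * a, a)"
        by (simp_all add: hB[OF that]) (simp add: h_def n_def)
    qed
    have "(\<Sum>A\<in>Pow {1..n}. (-1) ^ card A *\<^sub>R f ((t, y) + (\<Sum>r\<in>A. h r))) =
        sdiff k (\<lambda>t. g t y) a t - sdiff k (\<lambda>t. g t (y + a)) a t"
      unfolding n_ins
      by (subst sum_Pow_insert)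
         (auto simp: n_def[symmetric] hB ins f_def sdiff_def sum_negf simp del: Pow_iff cong: sum.cong, simp add: n_def)
    then have "sdiff k (\<lambda>t. g t y) a t - sdiff k (\<lambda>t. g t (y + a)) a t = (\<Sum>A\<in>Pow {1..n}. (-1) ^ card A *\<^sub>R
       sdiff n f (- (\<Sum>r\<in>A. (1 / real r) *\<^sub>R h r)) ((t, y) + (\<Sum>r\<in>A. h r)))"
      using djokovic_identity[of f "(t, y)" h n] by simp
    also have "norm \<dots> \<le> (\<Sum>A\<in>Pow {1..n}. (real n * a) ^ n * M)"
    proof (rule sum_norm_le)
      fix A assume A: "A \<in> Pow {1..n}"
      then have cA: "card A \<le> n"
        using card_mono[of "{1..n}" A] by auto
      have h1: "\<bar>fst (h r)\<bar> \<le> a" "\<bar>snd (h r)\<bar> \<le> a" for r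
        using a by (auto simp: h_def)
      have h2: "\<bar>1 / real r * fst (h r)\<bar> \<le> a" "\<bar>1 / real r * snd (h r)\<bar> \<le> a" if "r \<in> A" for r
      proof -
        have "r \<ge> 1" using that A by auto
        then have "\<bar>1 / real r\<bar> \<le> 1" by simp
        then show "\<bar>1 / real r * fst (h r)\<bar> \<le> a" "\<bar>1 / real r * snd (h r)\<bar> \<le> a"
          unfolding abs_mult using h1[of r] a
          by (metis abs_ge_zero mult_mono mult_1 zero_le_one)+
      qed
      have s: "\<bar>\<Sum>r\<in>A. \<phi> r\<bar> \<le> real n * a" if "\<And>r. r \<in> A \<Longrightarrow> \<bar>\<phi> r\<bar> \<le> a" for \<phi> :: "nat \<Rightarrow> real"
      proof -
        have "\<bar>\<Sum>r\<in>A. \<phi> r\<bar> \<le> (\<Sum>r\<in>A. a)"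
          by (rule order_trans[OF sum_abs sum_mono]) (rule that)
        also have "\<dots> \<le> real n * a"
          using cA a by (simp add: mult_right_mono)
        finally show ?thesis .
      qed
      have na: "real n * a \<le> real n"
        using a by (simp add: mult_left_le)
      have "norm (sdiff n f (- (\<Sum>r\<in>A. (1 / real r) *\<^sub>R h r)) ((t, y) + (\<Sum>r\<in>A. h r))) \<le> (real n * a) ^ n * M"
      proof (rule bound)
        show "\<bar>fst (- (\<Sum>r\<in>A. (1 / real r) *\<^sub>R h r))\<bar> \<le> real n * a"
          "\<bar>snd (- (\<Sum>r\<in>A. (1 / real r) *\<^sub>R h r))\<bar> \<le> real n * a"
          using s[OF h2(1)] s[OF h2(2)] by (simp_all add: fst_sum snd_sum)
        show "\<bar>fst ((t, y) + (\<Sum>r\<in>A. h r))\<bar> \<le> T + real n"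
          using s[of "\<lambda>r. fst (h r)"] h1(1) t na by (simp add: fst_sum)
        show "\<bar>snd ((t, y) + (\<Sum>r\<in>A. h r))\<bar> \<le> T + real n"
          using s[of "\<lambda>r. snd (h r)"] h1(2) y na by (simp add: snd_sum)
      qed (use a in auto)
      then show "norm ((-1) ^ card A *\<^sub>R sdiff n f (- (\<Sum>r\<in>A. (1 / real r) *\<^sub>R h r)) ((t, y) + (\<Sum>r\<in>A. h r))) \<le> (real n * a) ^ n * M"
        by simp
    qed
    also have "\<dots> = (2 ^ n * (real n ^ n * M)) * a ^ Suc k"
      by (simp add: card_Pow power_mult_distrib n_def del: power_Suc)
    finally show ?thesis .
  qed
  then show thesis by (rule that)
qed

text \<open>Subdividing \<open>[0, s]\<close> into \<open>l\<close> steps of length \<open>a = s / l\<close> and summing up the mixed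
  differences gives \<open>O(s a\<^sup>k)\<close> for the \<open>k\<close>-th differences with step \<open>a\<close>; then \<open>l \<rightarrow> \<infinity>\<close>.\<close>

lemma smooth2_difference_bound:
  fixes g :: "real \<Rightarrow> real \<Rightarrow> 'b::banach"
  assumes g: "smooth2 g"
  obtains C where "\<And>t s. \<bar>t\<bar> \<le> T \<Longrightarrow> 0 < s \<Longrightarrow> s \<le> 1 \<Longrightarrow>
    norm ((vd ^^ k) (\<lambda>t. g t s - g t 0) t) \<le> C * s"
proof -
  \<comment> \<open>The subdivision points run through \<open>[0, s]\<close>, a subset of
    \<open>[0, 1]\<close>; the box must contain them even if \<open>T < 1\<close>.\<close>
  obtain C where C: "\<And>t y a. \<bar>t\<bar> \<le> max T 1 \<Longrightarrow> \<bar>y\<bar> \<le> max T 1 \<Longrightarrow> 0 < a \<Longrightarrow> a \<le> 1 \<Longrightarrow>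
    norm (sdiff k (\<lambda>t. g t y) a t - sdiff k (\<lambda>t. g t (y + a)) a t) \<le> C * a ^ Suc k"
    using smooth2_mixed_difference[OF g] by metis
  have "norm ((vd ^^ k) (\<lambda>t. g t s - g t 0) t) \<le> C * s" if t: "\<bar>t\<bar> \<le> T" and s: "0 < s" "s \<le> 1" for t s
  proof (rule field_le_epsilon)
    fix e :: real assume e: "e > 0"
    define H where "H = (\<lambda>t. g t s - g t 0)"
    have sH: "smooth H"
      unfolding H_def by (intro smooth_diff smooth2_left g)
    have "isCont ((vd ^^ k) H) t"
      by (intro smooth_isCont smooth_funpow sH)
    then obtain d where d: "d > 0" "\<And>u. dist u t < d \<Longrightarrow> dist ((vd ^^ k) H u) ((vd ^^ k) H t) < e"
      using e unfolding continuous_at_eps_delta by blast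
    \<comment> \<open>So fine a subdivision that \<open>a \<le> 1\<close> and that on the range
      \<open>[t, t + k a]\<close> of the difference the \<open>k\<close>-th derivative stays within
      \<open>e\<close> of its value at \<open>t\<close>.\<close>
    obtain l where l: "real l > max 1 (real k * s / d)"
      using reals_Archimedean2 by blast
    define a where "a = s / real l"
    have a: "a > 0" "a \<le> 1" and ls: "real l * a = s"
      using s l by (auto simp: a_def)
    have kd: "real k * a < d"
      using l d(1) by (simp add: a_def field_simps)
    define F where "F = (\<lambda>y. sdiff k (\<lambda>t. g t y) a t)"
    have "sdiff k H a t = F s - F 0"
      by (simp add: F_def H_def sdiff_def scaleR_diff_right sum_subtractf)
    also have "F s - F 0 = (\<Sum>i<l. F (real (Suc i) * a) - F (real i * a))"
      by (subst sum_lessThan_telescope) (simp add: ls)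
    also have "norm \<dots> \<le> (\<Sum>i<l. C * a ^ Suc k)"
    proof (rule sum_norm_le)
      fix i assume "i \<in> {..<l}"
      then have "real i * a \<le> real l * a"
        using a by (intro mult_right_mono) auto
      then have "norm (F (real i * a) - F (real i * a + a)) \<le> C * a ^ Suc k"
        unfolding F_def using ls s t a by (intro C) auto
      then show "norm (F (real (Suc i) * a) - F (real i * a)) \<le> C * a ^ Suc k"
        by (simp add: algebra_simps norm_minus_commute)
    qed
    also have "\<dots> = C * s * a ^ k"
      by (simp add: ls[symmetric])
    finally have 1: "norm ((-1) ^ k *\<^sub>R sdiff k H a t) \<le> a ^ k * (C * s)"
      by (simp add: mult.commute)
    have "norm ((-1) ^ k *\<^sub>R sdiff k H a t - a ^ k *\<^sub>R (vd ^^ k) H t) \<le> a ^ k * e"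
    proof (rule sdiff_mean_value[OF sH])
      fix u assume "t \<le> u" "u \<le> t + real k * a"
      then show "norm ((vd ^^ k) H u - (vd ^^ k) H t) \<le> e"
        using d(2)[of u] kd by (auto simp: dist_norm)
    qed (use a in auto)
    with 1 have "norm (a ^ k *\<^sub>R (vd ^^ k) H t) \<le> a ^ k * (C * s) + a ^ k * e"
      by (smt (verit, best) norm_triangle_sub norm_minus_commute)
    then have "a ^ k * norm ((vd ^^ k) H t) \<le> a ^ k * (C * s + e)"
      using a by (simp add: algebra_simps)
    then show "norm ((vd ^^ k) (\<lambda>t. g t s - g t 0) t) \<le> C * s + e"
      using a by (simp add: H_def)
  qed
  then show thesis by (rule that)
qed

text \<open>The second claim keeps the convergence of the differentiated quotients, from which the
  symmetry of mixed derivatives is read off.\<close>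

lemma smooth2_quotients:
  fixes g :: "real \<Rightarrow> real \<Rightarrow> 'b::banach"
  assumes g: "smooth2 g"
  shows "smooth (\<lambda>t. vd (g t) 0)"
    and "(\<lambda>m. real (Suc m) *\<^sub>R (vd (\<lambda>t. g t (1 / real (Suc m))) t - vd (\<lambda>t. g t 0) t)) \<longlonglongrightarrow>
      vd (\<lambda>t. vd (g t) 0) t"
proof -
  define h where "h = (\<lambda>m t. real (Suc m) *\<^sub>R (g t (1 / real (Suc m)) - g t 0))"
  have sh: "smooth (h m)" for m
    unfolding h_def by (intro smooth_scaleR smooth_const smooth_diff smooth2_left g)
  have lim: "(\<lambda>m. h m t) \<longlonglongrightarrow> vd (g t) 0" for t
  proof -
    have "((\<lambda>u. inverse u *\<^sub>R (g t u - g t 0)) \<longlongrightarrow> vd (g t) 0) (at 0)"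
      using smooth_vd(1)[OF smooth2_right[OF g], of t 0] unfolding has_vector_derivative_quotient by simp
    moreover have "filterlim (\<lambda>m. 1 / real (Suc m)) (at 0) sequentially"
      by (rule filterlim_atI[OF LIMSEQ_Suc[OF lim_1_over_n]]) simp
    ultimately have "(\<lambda>m. inverse (1 / real (Suc m)) *\<^sub>R (g t (1 / real (Suc m)) - g t 0)) \<longlonglongrightarrow> vd (g t) 0"
      by (rule filterlim_compose)
    then show ?thesis
      by (simp add: h_def)
  qed
  have bdd: "\<exists>M. \<forall>m t. \<bar>t\<bar> \<le> T \<longrightarrow> norm ((vd ^^ k) (h m) t) \<le> M" for k T
  proof -
    obtain C where C: "\<And>t s. \<bar>t\<bar> \<le> T \<Longrightarrow> 0 < s \<Longrightarrow> s \<le> 1 \<Longrightarrow>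
        norm ((vd ^^ k) (\<lambda>t. g t s - g t 0) t) \<le> C * s"
      using smooth2_difference_bound[OF g] by metis
    have "norm ((vd ^^ k) (h m) t) \<le> C" if "\<bar>t\<bar> \<le> T" for m t
    proof -
      have "norm ((vd ^^ k) (h m) t) = real (Suc m) * norm ((vd ^^ k) (\<lambda>t. g t (1 / real (Suc m)) - g t 0) t)"
        unfolding h_def by (subst funpow_vd_scaleR[OF smooth_diff[OF smooth2_left[OF g] smooth2_left[OF g]]]) simp
      also have "\<dots> \<le> real (Suc m) * (C * (1 / real (Suc m)))"
        using that by (intro mult_left_mono C) auto
      finally show ?thesis by simp
    qed
    then show ?thesis by blast
  qed
  show "smooth (\<lambda>t. vd (g t) 0)"
    by (rule limit_of_smooth_sequence(1)[OF sh lim bdd])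
  have eq: "vd (h m) t = real (Suc m) *\<^sub>R (vd (\<lambda>t. g t (1 / real (Suc m))) t - vd (\<lambda>t. g t 0) t)" for m
    unfolding h_def by (simp only: vd_scaleR vd_diff smooth_diff smooth2_left[OF g])
  then show "(\<lambda>m. real (Suc m) *\<^sub>R (vd (\<lambda>t. g t (1 / real (Suc m))) t - vd (\<lambda>t. g t 0) t)) \<longlonglongrightarrow>
      vd (\<lambda>t. vd (g t) 0) t"
    using limit_of_smooth_sequence(2)[OF sh lim bdd, of t] unfolding eq by blast
qed

lemmas smooth2_partial = smooth2_quotients(1)

text \<open>One sequence, two limits: the \<open>t\<close>-derivatives of the quotients in
  \<open>s\<close> tend to the derivative of \<open>vd (g t) 0\<close>, and they are at the same
  time difference quotients in \<open>s\<close> of the \<open>t\<close>-derivative.\<close>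

lemma smooth2_partial_commute:
  fixes g :: "real \<Rightarrow> real \<Rightarrow> 'b::banach"
  assumes g: "smooth2 g"
  shows "vd (\<lambda>t. vd (g t) 0) 0 = vd (\<lambda>s. vd (\<lambda>t. g t s) 0) 0"
proof -
  have s: "smooth (\<lambda>s. vd (\<lambda>t. g t s) 0)"
    by (rule smooth2_partial[OF smooth2_swap[OF g]])
  define K where "K = (\<lambda>s. vd (\<lambda>t. g t s) 0)"
  have "((\<lambda>u. inverse u *\<^sub>R (K u - K 0)) \<longlongrightarrow> vd K 0) (at 0)"
    using smooth_vd(1)[OF s, of 0] unfolding has_vector_derivative_quotient K_def by simp
  moreover have "filterlim (\<lambda>m. 1 / real (Suc m)) (at 0) sequentially"
    by (rule filterlim_atI[OF LIMSEQ_Suc[OF lim_1_over_n]]) simp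
  ultimately have "(\<lambda>m. inverse (1 / real (Suc m)) *\<^sub>R (K (1 / real (Suc m)) - K 0)) \<longlonglongrightarrow> vd K 0"
    by (rule filterlim_compose)
  then have "(\<lambda>m. real (Suc m) *\<^sub>R (vd (\<lambda>t. g t (1 / real (Suc m))) 0 - vd (\<lambda>t. g t 0) 0)) \<longlonglongrightarrow> vd K 0"
    by (simp add: K_def)
  from LIMSEQ_unique[OF smooth2_quotients(2)[OF g] this]
  show ?thesis
    by (simp add: K_def)
qed

section \<open>Directional derivatives of functions smooth along curves\<close>

text \<open>The coordinates are changed one at a time; each change is a one-variable increment,
  compared with the partial derivative at \<open>x\<close> by the mean value inequality and
  continuity.\<close>

lemma continuous_partials_imp_has_derivative:
  fixes f :: "'a::euclidean_space \<Rightarrow> 'b::real_normed_vector"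
  assumes "open S" "x \<in> S"
    and f': "\<And>i y. i \<in> Basis \<Longrightarrow> y \<in> S \<Longrightarrow> ((\<lambda>s. f (y + s *\<^sub>R i)) has_vector_derivative f' i y) (at 0)"
    and cont: "\<And>i. i \<in> Basis \<Longrightarrow> continuous_on S (f' i)"
  shows "(f has_derivative (\<lambda>h. \<Sum>i\<in>Basis. (h \<bullet> i) *\<^sub>R f' i x)) (at x)"
proof -
  have P: "\<exists>d>0. \<forall>y h. dist y x < d \<and> norm h < d \<longrightarrow>
      norm (f (y + (\<Sum>i\<in>A. (h \<bullet> i) *\<^sub>R i)) - f y - (\<Sum>i\<in>A. (h \<bullet> i) *\<^sub>R f' i x)) \<le> e * norm h"
    if "A \<subseteq> Basis" "e > 0" for A e
    using finite_subset[OF that(1) finite_Basis] that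
  proof (induction A arbitrary: e rule: finite_induct)
    case empty
    then show ?case by (auto intro!: exI[of _ 1])
  next
    case (insert j A)
    have j: "j \<in> Basis" using insert by auto
    obtain d where d: "d > 0" "\<And>y h. dist y x < d \<Longrightarrow> norm h < d \<Longrightarrow>
        norm (f (y + (\<Sum>i\<in>A. (h \<bullet> i) *\<^sub>R i)) - f y - (\<Sum>i\<in>A. (h \<bullet> i) *\<^sub>R f' i x)) \<le> e / 2 * norm h"
      using insert.IH[of "e / 2"] insert.prems by auto
    obtain r where r: "r > 0" "ball x r \<subseteq> S"
      using assms(1,2) openE by blast
    have "isCont (f' j) x"
      using cont[OF j] assms(1,2) by (simp add: continuous_on_eq_continuous_at)
    then obtain d1 where d1: "d1 > 0" "\<And>y. dist y x < d1 \<Longrightarrow> dist (f' j y) (f' j x) < e / 2"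
      using insert.prems unfolding continuous_at_eps_delta by (metis half_gt_zero)
    \<comment> \<open>All points met on the way lie within \<open>n * \<delta>\<close> of
      \<open>x\<close>: one \<open>\<delta>\<close> for \<open>y\<close>, one for each index in
      \<open>A\<close> and one for \<open>j\<close>.\<close>
    define n where "n = real (card A) + 2"
    define \<delta> where "\<delta> = min d (min d1 r / n)"
    have n: "n \<ge> 2" by (simp add: n_def)
    have \<delta>: "\<delta> > 0" "\<delta> \<le> d" "n * \<delta> \<le> min d1 r"
      using d(1) d1(1) r(1) n by (auto simp: \<delta>_def min_def field_simps)
    have "norm (f (y + (\<Sum>i\<in>insert j A. (h \<bullet> i) *\<^sub>R i)) - f y - (\<Sum>i\<in>insert j A. (h \<bullet> i) *\<^sub>R f' i x)) \<le> e * norm h"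
      if y: "dist y x < \<delta>" and h: "norm h < \<delta>" for y h
    proof -
      define y' where "y' = y + (\<Sum>i\<in>A. (h \<bullet> i) *\<^sub>R i)"
      have "norm (\<Sum>i\<in>A. (h \<bullet> i) *\<^sub>R i) \<le> (\<Sum>i\<in>A. norm h)"
        using insert.prems Basis_le_norm by (intro sum_norm_le) (auto simp: subset_iff)
      then have y'x: "dist y' x \<le> dist y x + real (card A) * norm h"
        unfolding y'_def dist_norm using norm_triangle_ineq[of "y - x" "\<Sum>i\<in>A. (h \<bullet> i) *\<^sub>R i"]
        by (simp add: algebra_simps)
      have near: "dist (y' + s *\<^sub>R j) x < n * \<delta>" if "\<bar>s\<bar> \<le> \<bar>h \<bullet> j\<bar>" for s
      proof -
        have "dist (y' + s *\<^sub>R j) x \<le> dist y' x + \<bar>s\<bar>"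
          using norm_triangle_ineq[of "y' - x" "s *\<^sub>R j"] j by (simp add: dist_norm algebra_simps)
        also have "\<dots> \<le> dist y x + real (card A) * norm h + norm h"
          using y'x that Basis_le_norm[OF j, of h] by linarith
        also have "\<dots> < \<delta> + real (card A) * \<delta> + \<delta>"
          using y h by (intro add_less_le_mono add_le_less_mono add_less_le_mono mult_left_mono) auto
        finally show ?thesis by (simp add: n_def algebra_simps)
      qed
      define u where "u = (\<lambda>s. f (y' + s *\<^sub>R j))"
      have inS: "y' + s *\<^sub>R j \<in> S" if "\<bar>s\<bar> \<le> \<bar>h \<bullet> j\<bar>" for s
        using near[OF that] \<delta> r(2) by (auto simp: subset_iff dist_commute)
      have u: "(u has_vector_derivative f' j (y' + s *\<^sub>R j)) (at s)" if "\<bar>s\<bar> \<le> \<bar>h \<bullet> j\<bar>" for s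
        using f'[OF j inS[OF that]] unfolding has_vector_derivative_quotient u_def
        by (simp add: algebra_simps)
      have near': "norm (f' j (y' + s *\<^sub>R j) - f' j x) \<le> e / 2" if "\<bar>s\<bar> \<le> \<bar>h \<bullet> j\<bar>" for s
        using d1(2)[of "y' + s *\<^sub>R j"] near[OF that] \<delta> by (simp add: dist_norm)
      define w where "w = (\<lambda>s. u s - s *\<^sub>R f' j x)"
      have w: "norm (w (h \<bullet> j) - w 0) \<le> e / 2 * norm (h \<bullet> j - 0)"
      proof (rule differentiable_bound[where S = "closed_segment 0 (h \<bullet> j)"
            and f' = "\<lambda>s k. k *\<^sub>R (f' j (y' + s *\<^sub>R j) - f' j x)"])
        fix s assume "s \<in> closed_segment 0 (h \<bullet> j)"
        then have s: "\<bar>s\<bar> \<le> \<bar>h \<bullet> j\<bar>"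
          by (auto simp: closed_segment_eq_real_ivl split: if_splits)
        have "(w has_vector_derivative f' j (y' + s *\<^sub>R j) - f' j x) (at s)"
          unfolding w_def
          by (intro has_vector_derivative_diff u[OF s]
               bounded_linear.has_vector_derivative[OF bounded_linear_scaleR_left, where g = "\<lambda>s. s" and g' = 1, simplified])
        then show "(w has_derivative (\<lambda>k. k *\<^sub>R (f' j (y' + s *\<^sub>R j) - f' j x))) (at s within closed_segment 0 (h \<bullet> j))"
          by (simp add: has_vector_derivative_def has_derivative_at_withinI)
        show "onorm (\<lambda>k. k *\<^sub>R (f' j (y' + s *\<^sub>R j) - f' j x)) \<le> e / 2"
        proof (rule onorm_le)
          fix k :: real
          show "norm (k *\<^sub>R (f' j (y' + s *\<^sub>R j) - f' j x)) \<le> e / 2 * norm k"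
            using mult_left_mono[OF near'[OF s], of "\<bar>k\<bar>"] by (simp add: mult.commute)
        qed
      qed auto
      have "e / 2 * norm (h \<bullet> j - 0) \<le> e / 2 * norm h"
        using Basis_le_norm[OF j, of h] insert.prems by (intro mult_left_mono) auto
      with w have 1: "norm (w (h \<bullet> j) - w 0) \<le> e / 2 * norm h"
        by linarith
      have 2: "norm (f y' - f y - (\<Sum>i\<in>A. (h \<bullet> i) *\<^sub>R f' i x)) \<le> e / 2 * norm h"
        unfolding y'_def using y h \<delta> by (intro d) auto
      have eq: "f (y + (\<Sum>i\<in>insert j A. (h \<bullet> i) *\<^sub>R i)) - f y - (\<Sum>i\<in>insert j A. (h \<bullet> i) *\<^sub>R f' i x) =
          (w (h \<bullet> j) - w 0) + (f y' - f y - (\<Sum>i\<in>A. (h \<bullet> i) *\<^sub>R f' i x))"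
        using insert.hyps by (simp add: w_def u_def y'_def algebra_simps)
      show ?thesis
        unfolding eq using norm_triangle_mono[OF 1 2] by simp
    qed
    then show ?case
      using \<delta>(1) by blast
  qed
  have bl: "bounded_linear (\<lambda>h. \<Sum>i\<in>Basis. (h \<bullet> i) *\<^sub>R f' i x)"
    by (intro bounded_linear_sum bounded_linear_scaleR_const bounded_linear_inner_left)
  show ?thesis
    unfolding has_derivative_within_alt
  proof (intro conjI bl allI impI)
    fix e :: real assume "e > 0"
    then obtain d where d: "d > 0" "\<And>y h. dist y x < d \<Longrightarrow> norm h < d \<Longrightarrow>
      norm (f (y + (\<Sum>i\<in>Basis. (h \<bullet> i) *\<^sub>R i)) - f y - (\<Sum>i\<in>Basis. (h \<bullet> i) *\<^sub>R f' i x)) \<le> e * norm h"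
      using P[OF subset_refl] by blast
    have "norm (f y - f x - (\<Sum>i\<in>Basis. ((y - x) \<bullet> i) *\<^sub>R f' i x)) \<le> e * norm (y - x)"
      if "norm (y - x) < d" for y
      using d(2)[of x "y - x"] d(1) that by (simp add: euclidean_representation)
    with d(1) show "\<exists>d>0. \<forall>y\<in>UNIV. norm (y - x) < d \<longrightarrow>
        norm (f y - f x - (\<Sum>i\<in>Basis. ((y - x) \<bullet> i) *\<^sub>R f' i x)) \<le> e * norm (y - x)"
      by blast
  qed
qed

section \<open>Functions of a direction variable and a point\<close>

text \<open>The nets of kernels as a bare real vector space; its topology returns only when these
  functions are related to \<open>Cinf\<close> and to the power spaces.\<close>

locale direction_space =
  fixes V :: "'e::real_vector set"
  assumes zero_V: "0 \<in> V"
    and add_V: "\<phi> \<in> V \<Longrightarrow> \<psi> \<in> V \<Longrightarrow> \<phi> + \<psi> \<in> V"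
    and scaleR_V: "\<phi> \<in> V \<Longrightarrow> r *\<^sub>R \<phi> \<in> V"
begin

text \<open>Testing smoothness on the curves in finite-dimensional subspaces suffices below, and these
  curves are visibly stable under the required reparametrizations.\<close>

inductive fcurve :: "(real \<Rightarrow> 'e) \<Rightarrow> bool" where
  fcurve_zero: "fcurve (\<lambda>t. 0)"
| fcurve_add: "fcurve c \<Longrightarrow> smooth b \<Longrightarrow> v \<in> V \<Longrightarrow> fcurve (\<lambda>t. c t + b t *\<^sub>R v)"

lemma line_V: "\<phi> \<in> V \<Longrightarrow> v \<in> V \<Longrightarrow> \<phi> + s *\<^sub>R v \<in> V"
  by (intro add_V scaleR_V)

lemma fcurve_in: "fcurve c \<Longrightarrow> c t \<in> V"
  by (induction rule: fcurve.induct) (auto intro: zero_V add_V scaleR_V)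

lemma fcurve_comp: "fcurve c \<Longrightarrow> smooth a \<Longrightarrow> fcurve (\<lambda>t. c (a t))"
proof (induction rule: fcurve.induct)
  case (fcurve_add c b v)
  then show ?case
    using fcurve.fcurve_add[of "\<lambda>t. c (a t)" "\<lambda>t. b (a t)" v] smooth_comp by blast
qed (rule fcurve_zero)

lemma fcurve_const: "\<phi> \<in> V \<Longrightarrow> fcurve (\<lambda>t. \<phi>)"
  using fcurve_add[OF fcurve_zero smooth_const[of 1], of \<phi>] by simp

lemma fcurve_line: "\<phi> \<in> V \<Longrightarrow> v \<in> V \<Longrightarrow> smooth b \<Longrightarrow> fcurve (\<lambda>t. \<phi> + b t *\<^sub>R v)"
  by (rule fcurve_add[OF fcurve_const])

text \<open>Kernel and point are tested together along product curves. The curves of points stay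
  inside \<open>\<Omega>\<close>, the only place where \<open>F\<close> is controlled, and this is
  what makes the localizers necessary.\<close>

definition jsmooth :: "'a::euclidean_space set \<Rightarrow> ('e \<Rightarrow> 'a \<Rightarrow> 'b::banach) \<Rightarrow> bool" where
  "jsmooth \<Omega> F \<longleftrightarrow>
     (\<forall>c x. fcurve c \<and> smooth x \<and> range x \<subseteq> \<Omega> \<longrightarrow> smooth (\<lambda>t. F (c t) (x t)))"

definition Dir :: "'e \<Rightarrow> ('e \<Rightarrow> 'a \<Rightarrow> 'b::real_normed_vector) \<Rightarrow> 'e \<Rightarrow> 'a \<Rightarrow> 'b" where
  "Dir v F \<phi> x = vd (\<lambda>s. F (\<phi> + s *\<^sub>R v) x) 0"

text \<open>Taken as a Frechet derivative in order to agree with \<open>partial_deriv\<close>, and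
  thereby with the seminorms of \<open>Cinf\<close>.\<close>

definition pd :: "'a \<Rightarrow> ('e \<Rightarrow> 'a \<Rightarrow> 'b) \<Rightarrow> 'e \<Rightarrow> 'a::euclidean_space \<Rightarrow> 'b::real_normed_vector" where
  "pd v F \<phi> x = frechet_derivative (F \<phi>) (at x) v"

lemma jsmoothD: "jsmooth \<Omega> F \<Longrightarrow> fcurve c \<Longrightarrow> smooth x \<Longrightarrow> (\<And>t. x t \<in> \<Omega>) \<Longrightarrow> smooth (\<lambda>t. F (c t) (x t))"
  unfolding jsmooth_def by blast

lemma jsmooth_cong:
  fixes F G :: "'e \<Rightarrow> 'a::euclidean_space \<Rightarrow> 'b::banach"
  assumes "\<And>\<phi> x. \<phi> \<in> V \<Longrightarrow> x \<in> \<Omega> \<Longrightarrow> F \<phi> x = G \<phi> x"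
  shows "jsmooth \<Omega> F \<longleftrightarrow> jsmooth \<Omega> G"
proof -
  have "(\<lambda>t. F (c t) (x t)) = (\<lambda>t. G (c t) (x t))" if "fcurve c" "range x \<subseteq> \<Omega>" for c and x :: "real \<Rightarrow> 'a"
    using that assms fcurve_in by blast
  then show ?thesis
    unfolding jsmooth_def by (metis (no_types, lifting))
qed

text \<open>For fixed curves \<open>c\<close> and \<open>x\<close>, the function of \<open>t\<close>
  in question is the \<open>s\<close>-derivative at 0 of a function smooth along plane curves, so
  \<open>smooth2_partial\<close> applies.\<close>

lemma jsmooth_Dir:
  fixes F :: "'e \<Rightarrow> 'a::euclidean_space \<Rightarrow> 'b::banach"
  assumes F: "jsmooth \<Omega> F" and v: "v \<in> V"
  shows "jsmooth \<Omega> (Dir v F)"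
  unfolding jsmooth_def
proof (intro allI impI, elim conjE)
  fix c and x :: "real \<Rightarrow> 'a" assume c: "fcurve c" and x: "smooth x" "range x \<subseteq> \<Omega>"
  have "smooth2 (\<lambda>t s. F (c t + s *\<^sub>R v) (x t))"
    unfolding smooth2_def using x v
    by (auto intro!: jsmoothD[OF F] fcurve_add fcurve_comp[OF c] smooth_comp[OF x(1)])
  from smooth2_partial[OF this] show "smooth (\<lambda>t. Dir v F (c t) (x t))"
    by (simp add: Dir_def)
qed

lemma Dir_has_vector_derivative:
  assumes F: "jsmooth \<Omega> F" and "\<phi> \<in> V" "v \<in> V" "x \<in> \<Omega>"
  shows "((\<lambda>s. F (\<phi> + s *\<^sub>R v) x) has_vector_derivative Dir v F (\<phi> + s *\<^sub>R v) x) (at s)"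
proof -
  define f where "f = (\<lambda>s. F (\<phi> + s *\<^sub>R v) x)"
  have f: "smooth f"
    unfolding f_def using assms by (intro jsmoothD[OF F] fcurve_line smooth_id smooth_const)
  have "Dir v F (\<phi> + s *\<^sub>R v) x = vd (\<lambda>r. f (s + 1 * r)) 0"
    by (simp add: Dir_def f_def algebra_simps)
  also have "\<dots> = vd f s"
    using vd_affine[OF f, of s 1] by simp
  finally show ?thesis
    using smooth_vd(1)[OF f, of s] by (simp add: f_def)
qed

text \<open>A failure of continuity would show along points converging at factorial speed; a smooth
  curve through them turns it into a discontinuity of a smooth function of one variable.\<close>

lemma jsmooth_continuous:
  fixes F :: "'e \<Rightarrow> 'a::euclidean_space \<Rightarrow> 'b::banach"
  assumes F: "jsmooth \<Omega> F" and "open \<Omega>" and \<phi>: "\<phi> \<in> V" "v \<in> V"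
  shows "continuous_on (UNIV \<times> \<Omega>) (\<lambda>(s, x). F (\<phi> + s *\<^sub>R v) x)"
proof -
  define f where "f = (\<lambda>z. F (\<phi> + fst z *\<^sub>R v) (snd z))"
  have "continuous_on (UNIV \<times> \<Omega>) f"
    unfolding continuous_on_iff
  proof (intro ballI allI impI, rule ccontr)
    fix z0 :: "real \<times> 'a" and e :: real assume z0: "z0 \<in> UNIV \<times> \<Omega>" "e > 0"
    assume "\<not> (\<exists>d>0. \<forall>z\<in>(UNIV :: real set) \<times> \<Omega>. dist z z0 < d \<longrightarrow> dist (f z) (f z0) < e)"
    then have nc: "\<exists>z\<in>(UNIV :: real set) \<times> \<Omega>. dist z z0 < d \<and> \<not> dist (f z) (f z0) < e" if "d > 0" for d
      using that by auto
    have "\<exists>z. z \<in> UNIV \<times> \<Omega> \<and> dist z z0 < 1 / fact j \<and> \<not> dist (f z) (f z0) < e" for j :: nat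
      using nc[of "1 / fact j"] by auto
    then obtain z where z: "\<And>j. z j \<in> UNIV \<times> \<Omega>" "\<And>j::nat. dist (z j) z0 < 1 / fact j"
      "\<And>j. \<not> dist (f (z j)) (f z0) < e"
      by metis
    have p: "norm (z j - z0) \<le> 1 / fact j" for j
      using z(2)[of j] by (simp add: dist_norm)
    have q: "norm (0 :: real \<times> 'a) \<le> 1 / fact j" for j
      by simp
    obtain c where c: "smooth c" "c 0 = 0"
      "\<And>j. \<forall>\<^sub>F t in nhds ((1/2) ^ j). c t = (z j - z0) + (t - (1/2) ^ j) *\<^sub>R 0"
      by (rule special_curve[where p = "\<lambda>j. z j - z0", OF p q]) (rule that)
    have cj: "c ((1/2) ^ j) = z j - z0" for j
      using eventually_nhds_x_imp_x[OF c(3)[of j]] by simp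
    obtain r where r: "r > 0" "ball z0 r \<subseteq> UNIV \<times> \<Omega>"
      using openE[OF open_Times[OF open_UNIV \<open>open \<Omega>\<close>] z0(1)] by blast
    have "isCont c 0"
      by (rule smooth_isCont[OF c(1)])
    then obtain d where d: "d > 0" "\<And>t. dist t 0 < d \<Longrightarrow> dist (c t) (c 0) < r"
      using r(1) unfolding continuous_at_eps_delta by blast
    \<comment> \<open>Away from time 0 the curve \<open>z0 + c t\<close> may leave the domain. The
      reparametrization prevents this, and being the identity up to \<open>d / 3\<close> it still
      passes through the late points \<open>z j\<close>.\<close>
    obtain \<rho> where \<rho>: "smooth \<rho>" "\<And>t. \<bar>\<rho> t - 0\<bar> < d" "\<And>t. \<bar>t - 0\<bar> \<le> d / 3 \<Longrightarrow> \<rho> t = t"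
      using localizer[OF d(1), of 0] by metis
    define z1 where "z1 = (\<lambda>t. z0 + c (\<rho> t))"
    have z1: "smooth z1"
      unfolding z1_def by (intro smooth_add smooth_const smooth_comp[OF c(1)] \<rho>)
    have in\<Omega>: "z1 t \<in> UNIV \<times> \<Omega>" for t
    proof -
      have "z1 t \<in> ball z0 r"
        using d(2)[of "\<rho> t"] \<rho>(2)[of t] c(2) by (simp add: z1_def dist_norm)
      then show ?thesis
        using r(2) by blast
    qed
    have "smooth (\<lambda>t. f (z1 t))"
      unfolding f_def
    proof (intro jsmoothD[OF F] fcurve_line \<phi>)
      show "snd (z1 t) \<in> \<Omega>" for t
        using in\<Omega>[of t] by auto
    qed (intro smooth_linear[OF bounded_linear_fst] smooth_linear[OF bounded_linear_snd] z1)+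
    from smooth_isCont[OF this, of 0]
    obtain \<delta> where \<delta>: "\<delta> > 0" "\<And>t. dist t 0 < \<delta> \<Longrightarrow> dist (f (z1 t)) (f (z1 0)) < e"
      using z0(2) unfolding continuous_at_eps_delta by blast
    obtain j where j: "(1/2 :: real) ^ j < min \<delta> (d / 3)"
      using real_arch_pow_inv[of "min \<delta> (d / 3)" "1/2"] \<delta>(1) d(1) by auto
    have "z1 ((1/2) ^ j) = z j" "z1 0 = z0"
      using j \<rho>(3) cj[of j] c(2) d(1) by (simp_all add: z1_def)
    then show False
      using \<delta>(2)[of "(1/2) ^ j"] j z(3)[of j] by simp
  qed
  then show ?thesis
    by (simp add: f_def case_prod_beta')
qed

text \<open>\<open>x t + s e\<close> stays in \<open>\<Omega>\<close> only for \<open>t\<close> near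
  \<open>t0\<close> and small \<open>s\<close>, whereas \<open>smooth2\<close> concerns functions on
  the whole plane. Both parameters are cut off, with unchanged germs at \<open>t0\<close> and
  0.\<close>

lemma spatial_localizer:
  fixes x :: "real \<Rightarrow> 'a::euclidean_space"
  assumes "open \<Omega>" "smooth x" "x t0 \<in> \<Omega>"
  obtains \<rho> \<sigma> where "smooth \<rho>" "smooth \<sigma>" "\<And>t s. x (\<rho> t) + \<sigma> s *\<^sub>R e \<in> \<Omega>"
    "\<forall>\<^sub>F t in nhds t0. \<rho> t = t" "\<forall>\<^sub>F s in nhds 0. \<sigma> s = s"
proof -
  obtain r where r: "r > 0" "ball (x t0) r \<subseteq> \<Omega>"
    using assms openE by blast
  obtain d where d: "d > 0" "\<And>t. dist t t0 < d \<Longrightarrow> dist (x t) (x t0) < r / 2"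
    using smooth_isCont[OF assms(2), of t0] half_gt_zero[OF r(1)] unfolding continuous_at_eps_delta by blast
  obtain \<rho> where \<rho>: "smooth \<rho>" "\<And>t. \<bar>\<rho> t - t0\<bar> < d" "\<forall>\<^sub>F t in nhds t0. \<rho> t = t"
    using localizer[OF d(1), of t0] by metis
  \<comment> \<open>Keeps the displacement along \<open>e\<close> within \<open>r / 2\<close>, the
    other half being spent on the motion of \<open>x\<close>; the summand 1 covers
    \<open>e = 0\<close>.\<close>
  define k where "k = r / (2 * (norm e + 1))"
  have ne: "norm e + 1 > 0"
    using norm_ge_zero[of e] by linarith
  then have k: "k > 0"
    using r by (simp add: k_def)
  obtain \<sigma> where \<sigma>: "smooth \<sigma>" "\<And>t. \<bar>\<sigma> t - 0\<bar> < k" "\<forall>\<^sub>F t in nhds 0. \<sigma> t = t"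
    using localizer[OF k, of 0] by metis
  have "x (\<rho> t) + \<sigma> s *\<^sub>R e \<in> \<Omega>" for t s
  proof -
    have "\<bar>\<sigma> s\<bar> * norm e \<le> k * (norm e + 1)"
      using \<sigma>(2)[of s] by (intro mult_mono) auto
    also have "\<dots> = r / 2"
      using ne by (simp add: k_def field_simps)
    finally have "norm (\<sigma> s *\<^sub>R e) \<le> r / 2"
      by simp
    moreover have "norm (x (\<rho> t) - x t0) < r / 2"
      using d(2)[of "\<rho> t"] \<rho>(2)[of t] by (simp add: dist_norm)
    ultimately have "norm (x (\<rho> t) + \<sigma> s *\<^sub>R e - x t0) < r"
      using norm_triangle_ineq[of "x (\<rho> t) - x t0" "\<sigma> s *\<^sub>R e"] by (simp add: algebra_simps)
    then show ?thesis
      using r(2) by (auto simp: dist_norm norm_minus_commute)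
  qed
  with \<rho> \<sigma> show thesis
    using that by blast
qed

text \<open>As in \<open>jsmooth_Dir\<close>, but now the second parameter moves the point;
  smoothness being local in \<open>t\<close>, the localized function \<open>g\<close> is
  enough.\<close>

lemma jsmooth_directional:
  fixes F :: "'e \<Rightarrow> 'a::euclidean_space \<Rightarrow> 'b::banach"
  assumes F: "jsmooth \<Omega> F" and "open \<Omega>"
  shows "jsmooth \<Omega> (\<lambda>\<phi> x. vd (\<lambda>s. F \<phi> (x + s *\<^sub>R e)) 0)"
  unfolding jsmooth_def
proof (intro allI impI, elim conjE, rule smooth_local)
  fix c t0 and x :: "real \<Rightarrow> 'a" assume c: "fcurve c" and x: "smooth x" "range x \<subseteq> \<Omega>"
  then have "x t0 \<in> \<Omega>" by auto
  obtain \<rho> \<sigma> where \<rho>\<sigma>: "smooth \<rho>" "smooth \<sigma>" "\<And>t s. x (\<rho> t) + \<sigma> s *\<^sub>R e \<in> \<Omega>"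
    "\<forall>\<^sub>F t in nhds t0. \<rho> t = t" "\<forall>\<^sub>F s in nhds 0. \<sigma> s = s"
    by (rule spatial_localizer[OF \<open>open \<Omega>\<close> x(1) \<open>x t0 \<in> \<Omega>\<close>]) (rule that)
  define g where "g = (\<lambda>t s. F (c (\<rho> t)) (x (\<rho> t) + \<sigma> s *\<^sub>R e))"
  have "smooth2 g"
    unfolding smooth2_def g_def
    by (auto intro!: jsmoothD[OF F] fcurve_comp[OF c] smooth_comp[OF x(1)] smooth_comp[OF \<rho>\<sigma>(1)]
          smooth_add smooth_scaleR_left smooth_comp[OF \<rho>\<sigma>(2)] \<rho>\<sigma>(3))
  then have "smooth (\<lambda>t. vd (g t) 0)"
    by (rule smooth2_partial)
  moreover have "vd (g t) 0 = vd (\<lambda>s. F (c (\<rho> t)) (x (\<rho> t) + s *\<^sub>R e)) 0" for t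
    by (rule vd_cong_ev) (use \<rho>\<sigma>(5) in \<open>eventually_elim, simp add: g_def\<close>)
  moreover have "\<forall>\<^sub>F t in nhds t0. vd (\<lambda>s. F (c t) (x t + s *\<^sub>R e)) 0 =
      vd (\<lambda>s. F (c (\<rho> t)) (x (\<rho> t) + s *\<^sub>R e)) 0"
    using \<rho>\<sigma>(4) by eventually_elim simp
  ultimately show "\<exists>g. smooth g \<and> (\<forall>\<^sub>F t in nhds t0. vd (\<lambda>s. F (c t) (x t + s *\<^sub>R e)) 0 = g t)"
    by (intro exI[of _ "\<lambda>t. vd (g t) 0"]) simp
qed

text \<open>Directional derivatives in the point are again \<open>jsmooth\<close> and therefore
  continuous; continuous partial derivatives yield the Frechet derivative.\<close>

lemma jsmooth_has_derivative:
  fixes F :: "'e \<Rightarrow> 'a::euclidean_space \<Rightarrow> 'b::banach"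
  assumes F: "jsmooth \<Omega> F" and "open \<Omega>" and \<phi>: "\<phi> \<in> V" and x: "x \<in> \<Omega>"
  shows "(F \<phi> has_derivative (\<lambda>e. pd e F \<phi> x)) (at x)"
    and "pd e F \<phi> x = vd (\<lambda>s. F \<phi> (x + s *\<^sub>R e)) 0"
    and "pd e F \<phi> x = (\<Sum>i\<in>Basis. (e \<bullet> i) *\<^sub>R pd i F \<phi> x)"
proof -
  define f' where "f' = (\<lambda>e x. vd (\<lambda>s. F \<phi> (x + s *\<^sub>R e)) 0)"
  have D: "(F \<phi> has_derivative (\<lambda>h. \<Sum>i\<in>Basis. (h \<bullet> i) *\<^sub>R f' i x)) (at x)"
  proof (rule continuous_partials_imp_has_derivative[OF \<open>open \<Omega>\<close> x])
    fix i y assume y: "y \<in> \<Omega>"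
    obtain \<rho> \<sigma> where \<rho>\<sigma>: "smooth \<rho>" "smooth \<sigma>" "\<And>t s. y + \<sigma> s *\<^sub>R i \<in> \<Omega>"
      "\<forall>\<^sub>F t in nhds (0::real). \<rho> t = t" "\<forall>\<^sub>F s in nhds 0. \<sigma> s = s"
      by (rule spatial_localizer[OF \<open>open \<Omega>\<close> smooth_const y]) (rule that)
    define u where "u = (\<lambda>s. F \<phi> (y + \<sigma> s *\<^sub>R i))"
    have "smooth u"
      unfolding u_def by (intro jsmoothD[OF F] fcurve_const \<phi> smooth_add smooth_const smooth_scaleR_left \<rho>\<sigma>)
    moreover have ev: "\<forall>\<^sub>F s in nhds 0. u s = F \<phi> (y + s *\<^sub>R i)"
      using \<rho>\<sigma>(5) by eventually_elim (simp add: u_def)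
    ultimately show "((\<lambda>s. F \<phi> (y + s *\<^sub>R i)) has_vector_derivative f' i y) (at 0)"
      using smooth_vd(1)[of u 0] vd_cong_ev[OF ev]
      by (subst (asm) has_vector_derivative_cong_ev[where g = "\<lambda>s. F \<phi> (y + s *\<^sub>R i)" and S = UNIV])
         (auto simp: f'_def dest: eventually_nhds_x_imp_x)
  next
    fix i :: 'a
    \<comment> \<open>The direction 0 reduces joint continuity to continuity in the point
      alone.\<close>
    have "continuous_on (UNIV \<times> \<Omega>) (\<lambda>(s, x). vd (\<lambda>r. F (\<phi> + s *\<^sub>R 0) (x + r *\<^sub>R i)) 0)"
      by (rule jsmooth_continuous[OF jsmooth_directional[OF F \<open>open \<Omega>\<close>] \<open>open \<Omega>\<close> \<phi> zero_V])
    then have "continuous_on \<Omega> ((\<lambda>(s, x). vd (\<lambda>r. F (\<phi> + s *\<^sub>R 0) (x + r *\<^sub>R i)) 0) \<circ> (\<lambda>x. (0, x)))"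
      by (intro continuous_on_compose continuous_intros) (auto elim: continuous_on_subset)
    then show "continuous_on \<Omega> (f' i)"
      by (simp add: f'_def[abs_def] o_def)
  qed
  have pdD: "pd e F \<phi> x = (\<Sum>i\<in>Basis. (e \<bullet> i) *\<^sub>R f' i x)" for e
    unfolding pd_def by (rule fun_cong[OF frechet_derivative_at[OF D, symmetric]])
  show D': "(F \<phi> has_derivative (\<lambda>e. pd e F \<phi> x)) (at x)"
    using D by (simp add: pdD)
  have f'pd: "f' e x = pd e F \<phi> x" for e
  proof -
    have "((\<lambda>s. x + s *\<^sub>R e) has_derivative (\<lambda>s. s *\<^sub>R e)) (at 0)"
      by (auto intro!: derivative_eq_intros)
    from has_derivative_compose[OF this, of "F \<phi>"] D'
    have "((\<lambda>s. F \<phi> (x + s *\<^sub>R e)) has_derivative (\<lambda>s. pd (s *\<^sub>R e) F \<phi> x)) (at 0)"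
      by simp
    moreover have "pd (s *\<^sub>R e) F \<phi> x = s *\<^sub>R pd e F \<phi> x" for s
      using linear_scale[OF has_derivative_linear[OF D']] .
    ultimately show ?thesis
      by (auto simp: f'_def has_vector_derivative_def intro: vd_eq)
  qed
  show "pd e F \<phi> x = vd (\<lambda>s. F \<phi> (x + s *\<^sub>R e)) 0"
    using f'pd by (simp add: f'_def)
  show "pd e F \<phi> x = (\<Sum>i\<in>Basis. (e \<bullet> i) *\<^sub>R pd i F \<phi> x)"
    using pdD[of e] f'pd by simp
qed

lemma jsmooth_pd:
  fixes F :: "'e \<Rightarrow> 'a::euclidean_space \<Rightarrow> 'b::banach"
  assumes F: "jsmooth \<Omega> F" and "open \<Omega>"
  shows "jsmooth \<Omega> (pd e F)"
  by (rule iffD2[OF jsmooth_cong jsmooth_directional[OF assms]]) (rule jsmooth_has_derivative(2)[OF assms])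

text \<open>\<open>smooth2_partial_commute\<close> for the function of two parameters that moves the
  point along \<open>e\<close> and the kernel along \<open>v\<close>, the former parameter being
  localized.\<close>

lemma pd_Dir_commute:
  fixes F :: "'e \<Rightarrow> 'a::euclidean_space \<Rightarrow> 'b::banach"
  assumes F: "jsmooth \<Omega> F" and "open \<Omega>" and \<phi>: "\<phi> \<in> V" "v \<in> V" and x: "x \<in> \<Omega>"
  shows "pd e (Dir v F) \<phi> x = Dir v (pd e F) \<phi> x"
proof -
  obtain \<rho> \<sigma> where \<rho>\<sigma>: "smooth \<rho>" "smooth \<sigma>" "\<And>t s. x + \<sigma> s *\<^sub>R e \<in> \<Omega>"
    "\<forall>\<^sub>F t in nhds (0::real). \<rho> t = t" "\<forall>\<^sub>F s in nhds 0. \<sigma> s = s"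
    by (rule spatial_localizer[OF \<open>open \<Omega>\<close> smooth_const x]) (rule that)
  define g where "g = (\<lambda>t s. F (\<phi> + s *\<^sub>R v) (x + \<sigma> t *\<^sub>R e))"
  have "smooth2 g"
    unfolding smooth2_def g_def
    by (auto intro!: jsmoothD[OF F] fcurve_line \<phi> smooth_add smooth_const smooth_scaleR_left smooth_comp[OF \<rho>\<sigma>(2)] \<rho>\<sigma>(3))
  then have "vd (\<lambda>t. vd (g t) 0) 0 = vd (\<lambda>s. vd (\<lambda>t. g t s) 0) 0"
    by (rule smooth2_partial_commute)
  moreover have "vd (\<lambda>t. vd (g t) 0) 0 = vd (\<lambda>t. Dir v F \<phi> (x + t *\<^sub>R e)) 0"
    by (rule vd_cong_ev) (use \<rho>\<sigma>(5) in \<open>eventually_elim, simp add: g_def Dir_def\<close>)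
  moreover have "vd (\<lambda>t. g t s) 0 = vd (\<lambda>t. F (\<phi> + s *\<^sub>R v) (x + t *\<^sub>R e)) 0" for s
    by (rule vd_cong_ev) (use \<rho>\<sigma>(5) in \<open>eventually_elim, simp add: g_def\<close>)
  ultimately show ?thesis
    using jsmooth_has_derivative(2)[OF F \<open>open \<Omega>\<close> line_V[OF \<phi>] x]
      jsmooth_has_derivative(2)[OF jsmooth_Dir[OF F \<phi>(2)] \<open>open \<Omega>\<close> \<phi>(1) x]
    by (simp add: Dir_def)
qed

text \<open>The derivative in direction \<open>v\<close> is uniformly continuous on
  \<open>[-1, 1] \<times> K\<close>, so the mean value inequality bounds the error of the quotient
  independently of the point. This is the mode of convergence of \<open>Cinf\<close>.\<close>

lemma jsmooth_uniform_quotient: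
  fixes F :: "'e \<Rightarrow> 'a::euclidean_space \<Rightarrow> 'b::banach"
  assumes F: "jsmooth \<Omega> F" and "open \<Omega>" and \<phi>: "\<phi> \<in> V" "v \<in> V" and K: "compact K" "K \<subseteq> \<Omega>"
  shows "uniform_limit K (\<lambda>h x. inverse h *\<^sub>R (F (\<phi> + h *\<^sub>R v) x - F \<phi> x)) (Dir v F \<phi>) (at 0)"
proof (rule uniform_limitI)
  fix e :: real assume e: "e > 0"
  define f where "f = (\<lambda>(s, x). Dir v F (\<phi> + s *\<^sub>R v) x)"
  have "continuous_on (UNIV \<times> \<Omega>) f"
    unfolding f_def by (rule jsmooth_continuous[OF jsmooth_Dir[OF F \<phi>(2)] \<open>open \<Omega>\<close> \<phi>])
  then have "continuous_on ({-1..1} \<times> K) f"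
    by (rule continuous_on_subset) (use K in auto)
  then have "uniformly_continuous_on ({-1..1} \<times> K) f"
    by (intro compact_uniformly_continuous compact_Times K compact_Icc)
  then obtain d where d: "d > 0"
    "\<And>z z'. z \<in> {-1..1} \<times> K \<Longrightarrow> z' \<in> {-1..1} \<times> K \<Longrightarrow> dist z' z < d \<Longrightarrow> dist (f z') (f z) < e / 2"
    unfolding uniformly_continuous_on_def using half_gt_zero[OF e] by metis
  have "dist (inverse h *\<^sub>R (F (\<phi> + h *\<^sub>R v) x - F \<phi> x)) (Dir v F \<phi> x) < e"
    if h: "h \<noteq> 0" "\<bar>h\<bar> < min d 1" and x: "x \<in> K" for h x
  proof -
    have s: "norm (Dir v F (\<phi> + s *\<^sub>R v) x - Dir v F (\<phi> + 0 *\<^sub>R v) x) \<le> e / 2" if "s \<in> closed_segment 0 h" for s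
    proof -
      have "\<bar>s\<bar> \<le> \<bar>h\<bar>"
        using that by (auto simp: closed_segment_eq_real_ivl split: if_splits)
      then have "dist (f (s, x)) (f (0, x)) < e / 2"
        using h x by (intro d) (auto simp: dist_Pair_Pair)
      then show ?thesis by (simp add: f_def dist_norm)
    qed
    have "norm (F (\<phi> + h *\<^sub>R v) x - F (\<phi> + 0 *\<^sub>R v) x - (h - 0) *\<^sub>R Dir v F (\<phi> + 0 *\<^sub>R v) x) \<le> norm (h - 0) * (e / 2)"
      by (rule vector_differentiable_bound_linearization[where S = "closed_segment 0 h"
            and f = "\<lambda>s. F (\<phi> + s *\<^sub>R v) x" and f' = "\<lambda>s. Dir v F (\<phi> + s *\<^sub>R v) x"])
         (use s x K in \<open>auto intro!: has_vector_derivative_at_within Dir_has_vector_derivative[OF F \<phi>]\<close>)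
    moreover have "F (\<phi> + h *\<^sub>R v) x - F \<phi> x - h *\<^sub>R Dir v F \<phi> x =
        h *\<^sub>R (inverse h *\<^sub>R (F (\<phi> + h *\<^sub>R v) x - F \<phi> x) - Dir v F \<phi> x)"
      using h by (simp add: scaleR_diff_right)
    ultimately have "\<bar>h\<bar> * norm (inverse h *\<^sub>R (F (\<phi> + h *\<^sub>R v) x - F \<phi> x) - Dir v F \<phi> x) \<le> \<bar>h\<bar> * (e / 2)"
      by simp
    then have "norm (inverse h *\<^sub>R (F (\<phi> + h *\<^sub>R v) x - F \<phi> x) - Dir v F \<phi> x) \<le> e / 2"
      using h by (subst (asm) mult_le_cancel_left_pos) auto
    then show ?thesis
      using e by (simp add: dist_norm)
  qed
  then show "\<forall>\<^sub>F h in at 0. \<forall>x\<in>K. dist (inverse h *\<^sub>R (F (\<phi> + h *\<^sub>R v) x - F \<phi> x)) (Dir v F \<phi> x) < e"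
    unfolding eventually_at using d(1) by (intro exI[of _ "min d 1"]) auto
qed

end

section \<open>Chain rule for a moving function at a moving point\<close>

text \<open>The quotient splits into an increment of \<open>f\<close> at the moved point and an
  increment of the fixed function \<open>f t\<close>. The first part needs uniformity over a
  neighbourhood of \<open>x t\<close>, which compact sets supply. Both families over kernels and
  smooth curves in \<open>Cinf\<close> fit this form.\<close>

lemma eval_has_vector_derivative:
  fixes f :: "real \<Rightarrow> 'a::euclidean_space \<Rightarrow> 'b::real_normed_vector"
  assumes "open \<Omega>" "x t \<in> \<Omega>"
    and x: "(x has_vector_derivative x') (at t)"
    and D: "(f t has_derivative D) (at (x t))"
    and cont: "continuous_on \<Omega> f'"
    and ul: "\<And>K. compact K \<Longrightarrow> K \<subseteq> \<Omega> \<Longrightarrow>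
      uniform_limit K (\<lambda>h y. inverse h *\<^sub>R (f (t + h) y - f t y)) f' (at 0)"
  shows "((\<lambda>s. f s (x s)) has_vector_derivative f' (x t) + D x') (at t)"
proof -
  define A where "A = (\<lambda>h. inverse h *\<^sub>R (f (t + h) (x (t + h)) - f t (x (t + h))))"
  obtain r where r: "r > 0" "cball (x t) r \<subseteq> \<Omega>"
    using assms(1,2) open_contains_cball by blast
  have "isCont x t"
    using x by (rule has_vector_derivative_continuous)
  then have xt: "((\<lambda>h. x (t + h)) \<longlongrightarrow> x t) (at 0)"
    by (simp add: isCont_iff)
  have ev: "\<forall>\<^sub>F h in at 0. x (t + h) \<in> cball (x t) r"
    using tendstoD[OF xt r(1)] by eventually_elim (simp add: dist_commute less_imp_le)
  have "((\<lambda>h. A h - f' (x (t + h))) \<longlongrightarrow> 0) (at 0)"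
  proof (rule tendstoI)
    fix e :: real assume "e > 0"
    from uniform_limitD[OF ul[OF compact_cball r(2)] this] ev
    show "\<forall>\<^sub>F h in at 0. dist (A h - f' (x (t + h))) 0 < e"
      by eventually_elim (auto simp: A_def dist_norm)
  qed
  moreover have "((\<lambda>h. f' (x (t + h))) \<longlongrightarrow> f' (x t)) (at 0)"
    by (rule isCont_tendsto_compose[OF _ xt]) (use cont assms(1,2) in \<open>simp add: continuous_on_eq_continuous_at\<close>)
  ultimately have "((\<lambda>h. (A h - f' (x (t + h))) + f' (x (t + h))) \<longlongrightarrow> 0 + f' (x t)) (at 0)"
    by (rule tendsto_add)
  then have A: "(A \<longlongrightarrow> f' (x t)) (at 0)"
    by simp
  have "((\<lambda>s. f t (x s)) has_derivative (\<lambda>h. D (h *\<^sub>R x'))) (at t)"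
    using has_derivative_compose[OF x[unfolded has_vector_derivative_def] D] .
  moreover have "D (h *\<^sub>R x') = h *\<^sub>R D x'" for h
    using linear_scale[OF has_derivative_linear[OF D]] .
  ultimately have "((\<lambda>s. f t (x s)) has_vector_derivative D x') (at t)"
    by (simp add: has_vector_derivative_def)
  then have "((\<lambda>h. inverse h *\<^sub>R (f t (x (t + h)) - f t (x t))) \<longlongrightarrow> D x') (at 0)"
    by (simp add: has_vector_derivative_quotient)
  from tendsto_add[OF A this] show ?thesis
    unfolding has_vector_derivative_quotient A_def
    by (simp add: scaleR_add_right[symmetric])
qed

context direction_space
begin

definition Dirs :: "'e list \<Rightarrow> ('e \<Rightarrow> 'a \<Rightarrow> 'b::real_normed_vector) \<Rightarrow> 'e \<Rightarrow> 'a \<Rightarrow> 'b" where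
  "Dirs \<psi>s F = foldr Dir \<psi>s F"

definition pds :: "'a list \<Rightarrow> ('e \<Rightarrow> 'a \<Rightarrow> 'b) \<Rightarrow> 'e \<Rightarrow> 'a::euclidean_space \<Rightarrow> 'b::real_normed_vector" where
  "pds vs F = foldr pd vs F"

text \<open>The first entry of a list is the outermost derivative, as in \<open>ddiff\<close>; the
  last entry is the innermost, and the growth inductions proceed from that end.\<close>

lemma Dirs_simps [simp]:
  "Dirs [] F = F" "Dirs (v # \<psi>s) F = Dir v (Dirs \<psi>s F)" "Dirs (\<psi>s @ [v]) F = Dirs \<psi>s (Dir v F)"
  by (simp_all add: Dirs_def)

lemma pds_simps [simp]:
  "pds [] F = F" "pds (v # vs) F = pd v (pds vs F)" "pds (vs @ [v]) F = pds vs (pd v F)"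
  by (simp_all add: pds_def)

lemma jsmooth_Dirs:
  fixes F :: "'e \<Rightarrow> 'a::euclidean_space \<Rightarrow> 'b::banach"
  shows "jsmooth \<Omega> F \<Longrightarrow> set \<psi>s \<subseteq> V \<Longrightarrow> jsmooth \<Omega> (Dirs \<psi>s F)"
  by (induction \<psi>s) (auto intro: jsmooth_Dir)

lemma jsmooth_pds:
  fixes F :: "'e \<Rightarrow> 'a::euclidean_space \<Rightarrow> 'b::banach"
  shows "jsmooth \<Omega> F \<Longrightarrow> open \<Omega> \<Longrightarrow> jsmooth \<Omega> (pds vs F)"
  by (induction vs) (auto intro: jsmooth_pd)

lemma Dir_cong: "(\<And>\<phi>. \<phi> \<in> V \<Longrightarrow> F \<phi> x = G \<phi> x) \<Longrightarrow> \<phi> \<in> V \<Longrightarrow> v \<in> V \<Longrightarrow> Dir v F \<phi> x = Dir v G \<phi> x"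
  by (simp add: Dir_def line_V)

lemma Dirs_cong:
  "(\<And>\<phi>. \<phi> \<in> V \<Longrightarrow> F \<phi> x = G \<phi> x) \<Longrightarrow> set \<psi>s \<subseteq> V \<Longrightarrow> \<phi> \<in> V \<Longrightarrow> Dirs \<psi>s F \<phi> x = Dirs \<psi>s G \<phi> x"
  by (induction \<psi>s arbitrary: \<phi>) (auto intro: Dir_cong)

lemma pd_cong:
  assumes "open \<Omega>" "x \<in> \<Omega>" "\<And>y. y \<in> \<Omega> \<Longrightarrow> F \<phi> y = G \<phi> y"
  shows "pd e F \<phi> x = pd e G \<phi> x"
proof -
  have "(F \<phi> has_derivative f') (at x) \<longleftrightarrow> (G \<phi> has_derivative f') (at x)" for f'
    using assms has_derivative_transform_within_open[of "F \<phi>" f' x UNIV \<Omega> "G \<phi>"]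
      has_derivative_transform_within_open[of "G \<phi>" f' x UNIV \<Omega> "F \<phi>"] by auto
  then show ?thesis
    by (simp add: pd_def frechet_derivative_def)
qed

lemma pd_Dirs_commute:
  fixes F :: "'e \<Rightarrow> 'a::euclidean_space \<Rightarrow> 'b::banach"
  assumes F: "jsmooth \<Omega> F" and "open \<Omega>" and x: "x \<in> \<Omega>"
  shows "\<phi> \<in> V \<Longrightarrow> set \<psi>s \<subseteq> V \<Longrightarrow> pd e (Dirs \<psi>s F) \<phi> x = Dirs \<psi>s (pd e F) \<phi> x"
proof (induction \<psi>s arbitrary: \<phi>)
  case (Cons v \<psi>s)
  then have "pd e (Dirs (v # \<psi>s) F) \<phi> x = Dir v (pd e (Dirs \<psi>s F)) \<phi> x"
    using pd_Dir_commute[OF jsmooth_Dirs[OF F] \<open>open \<Omega>\<close> _ _ x] by simp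
  also have "\<dots> = Dir v (Dirs \<psi>s (pd e F)) \<phi> x"
    using Cons by (intro Dir_cong) auto
  finally show ?case by simp
qed simp

text \<open>Seminorms of a differential put space derivatives outside, the induction on point values
  produces them inside; the exchange makes the estimates for \<open>R\<close> available to its
  derived families.\<close>

lemma pds_Dirs_commute:
  fixes F :: "'e \<Rightarrow> 'a::euclidean_space \<Rightarrow> 'b::banach"
  assumes F: "jsmooth \<Omega> F" and "open \<Omega>" and \<phi>: "\<phi> \<in> V" "set \<psi>s \<subseteq> V"
  shows "x \<in> \<Omega> \<Longrightarrow> pds vs (Dirs \<psi>s F) \<phi> x = Dirs \<psi>s (pds vs F) \<phi> x"
proof (induction vs arbitrary: x)
  case (Cons e vs)
  have "pds (e # vs) (Dirs \<psi>s F) \<phi> x = pd e (Dirs \<psi>s (pds vs F)) \<phi> x"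
    using Cons pd_cong[OF \<open>open \<Omega>\<close> \<open>x \<in> \<Omega>\<close>, of "pds vs (Dirs \<psi>s F)" \<phi>] by simp
  also have "\<dots> = Dirs \<psi>s (pd e (pds vs F)) \<phi> x"
    using pd_Dirs_commute[OF jsmooth_pds[OF F \<open>open \<Omega>\<close>] \<open>open \<Omega>\<close> \<open>x \<in> \<Omega>\<close> \<phi>] .
  finally show ?case by simp
qed simp

section \<open>Functions of the direction variable alone\<close>

definition ssmooth :: "('e \<Rightarrow> 'b::real_normed_vector) \<Rightarrow> bool" where
  "ssmooth u \<longleftrightarrow> (\<forall>c. fcurve c \<longrightarrow> smooth (\<lambda>t. u (c t)))"

definition sDir :: "'e \<Rightarrow> ('e \<Rightarrow> 'b::real_normed_vector) \<Rightarrow> 'e \<Rightarrow> 'b" where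
  "sDir v u \<phi> = vd (\<lambda>s. u (\<phi> + s *\<^sub>R v)) 0"

definition sDirs :: "'e list \<Rightarrow> ('e \<Rightarrow> 'b::real_normed_vector) \<Rightarrow> 'e \<Rightarrow> 'b" where
  "sDirs \<psi>s u = foldr sDir \<psi>s u"

lemma sDirs_simps [simp]:
  "sDirs [] u = u" "sDirs (v # \<psi>s) u = sDir v (sDirs \<psi>s u)" "sDirs (\<psi>s @ [v]) u = sDirs \<psi>s (sDir v u)"
  by (simp_all add: sDirs_def)

lemma Dir_eq_sDir: "Dir v F \<phi> x = sDir v (\<lambda>\<phi>. F \<phi> x) \<phi>"
  by (simp add: Dir_def sDir_def)

lemma Dirs_eq_sDirs: "Dirs \<psi>s F \<phi> x = sDirs \<psi>s (\<lambda>\<phi>. F \<phi> x) \<phi>"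
  by (induction \<psi>s arbitrary: \<phi>) (auto simp: Dir_eq_sDir)

text \<open>A dummy point variable in the real line makes the results on \<open>jsmooth\<close>
  available.\<close>

lemma ssmooth_iff: "ssmooth u \<longleftrightarrow> jsmooth (UNIV :: real set) (\<lambda>\<phi> x. u \<phi>)"
  unfolding ssmooth_def jsmooth_def using smooth_id by blast

lemma ssmooth_sDir:
  fixes u :: "'e \<Rightarrow> 'b::banach"
  shows "ssmooth u \<Longrightarrow> v \<in> V \<Longrightarrow> ssmooth (sDir v u)"
proof -
  assume "ssmooth u" "v \<in> V"
  then have "jsmooth (UNIV :: real set) (Dir v (\<lambda>\<phi> x. u \<phi>))"
    unfolding ssmooth_iff by (rule jsmooth_Dir)
  moreover have "Dir v (\<lambda>\<phi> x. u \<phi>) = (\<lambda>\<phi> (x :: real). sDir v u \<phi>)"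
    by (simp add: fun_eq_iff Dir_eq_sDir)
  ultimately show "ssmooth (sDir v u)"
    unfolding ssmooth_iff by simp
qed

lemma ssmooth_line: "ssmooth u \<Longrightarrow> \<phi> \<in> V \<Longrightarrow> v \<in> V \<Longrightarrow> smooth (\<lambda>s. u (\<phi> + s *\<^sub>R v))"
  unfolding ssmooth_def using fcurve_line[OF _ _ smooth_id] by blast

lemma sDir_has_vector_derivative:
  "ssmooth u \<Longrightarrow> \<phi> \<in> V \<Longrightarrow> v \<in> V \<Longrightarrow> ((\<lambda>s. u (\<phi> + s *\<^sub>R v)) has_vector_derivative sDir v u \<phi>) (at 0)"
  unfolding sDir_def by (intro smooth_vd(1) ssmooth_line)

lemma sDir_eqI: "((\<lambda>s. u (\<phi> + s *\<^sub>R v)) has_vector_derivative l) (at 0) \<Longrightarrow> sDir v u \<phi> = l"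
  unfolding sDir_def by (rule vd_eq)

lemma sDir_cong: "(\<And>\<phi>. \<phi> \<in> V \<Longrightarrow> u \<phi> = w \<phi>) \<Longrightarrow> \<phi> \<in> V \<Longrightarrow> v \<in> V \<Longrightarrow> sDir v u \<phi> = sDir v w \<phi>"
  by (simp add: sDir_def line_V)

lemma sDirs_cong:
  "(\<And>\<phi>. \<phi> \<in> V \<Longrightarrow> u \<phi> = w \<phi>) \<Longrightarrow> set \<psi>s \<subseteq> V \<Longrightarrow> \<phi> \<in> V \<Longrightarrow> sDirs \<psi>s u \<phi> = sDirs \<psi>s w \<phi>"
  by (induction \<psi>s arbitrary: \<phi>) (auto intro: sDir_cong)

lemma sDir_add:
  "ssmooth u \<Longrightarrow> ssmooth w \<Longrightarrow> \<phi> \<in> V \<Longrightarrow> v \<in> V \<Longrightarrow> sDir v (\<lambda>\<phi>. u \<phi> + w \<phi>) \<phi> = sDir v u \<phi> + sDir v w \<phi>"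
  by (intro sDir_eqI has_vector_derivative_add sDir_has_vector_derivative)

lemma sDir_mult:
  fixes u w :: "'e \<Rightarrow> complex"
  assumes "ssmooth u" "ssmooth w" "\<phi> \<in> V" "v \<in> V"
  shows "sDir v (\<lambda>\<phi>. u \<phi> * w \<phi>) \<phi> = sDir v u \<phi> * w \<phi> + u \<phi> * sDir v w \<phi>"
  using bounded_bilinear.has_vector_derivative[OF bounded_bilinear_mult
      sDir_has_vector_derivative[OF assms(1,3,4)] sDir_has_vector_derivative[OF assms(2,3,4)]]
  by (intro sDir_eqI) (simp add: add.commute)

lemma sDir_linear:
  assumes "bounded_linear L" "ssmooth u" "\<phi> \<in> V" "v \<in> V"
  shows "sDir v (\<lambda>\<phi>. L (u \<phi>)) \<phi> = L (sDir v u \<phi>)"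
  by (intro sDir_eqI bounded_linear.has_vector_derivative[OF assms(1)] sDir_has_vector_derivative assms)

lemma ssmooth_linear: "bounded_linear L \<Longrightarrow> ssmooth u \<Longrightarrow> ssmooth (\<lambda>\<phi>. L (u \<phi>))"
  unfolding ssmooth_def using smooth_linear by blast

lemma sDirs_linear:
  fixes u :: "'e \<Rightarrow> 'b::banach"
  assumes L: "bounded_linear L"
  shows "ssmooth u \<Longrightarrow> \<phi> \<in> V \<Longrightarrow> set \<psi>s \<subseteq> V \<Longrightarrow> sDirs \<psi>s (\<lambda>\<phi>. L (u \<phi>)) \<phi> = L (sDirs \<psi>s u \<phi>)"
proof (induction \<psi>s arbitrary: u rule: rev_induct)
  case (snoc v \<psi>s)
  have "sDirs (\<psi>s @ [v]) (\<lambda>\<phi>. L (u \<phi>)) \<phi> = sDirs \<psi>s (\<lambda>\<phi>. L (sDir v u \<phi>)) \<phi>"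
    unfolding sDirs_simps using snoc.prems by (intro sDirs_cong sDir_linear L) auto
  also have "\<dots> = L (sDirs \<psi>s (sDir v u) \<phi>)"
    using snoc.prems by (intro snoc.IH ssmooth_sDir) auto
  finally show ?case by simp
qed simp

lemma ssmooth_add: "ssmooth u \<Longrightarrow> ssmooth w \<Longrightarrow> ssmooth (\<lambda>\<phi>. u \<phi> + w \<phi>)"
  by (simp add: ssmooth_def smooth_add)

lemma ssmooth_mult:
  fixes u w :: "'e \<Rightarrow> complex"
  shows "ssmooth u \<Longrightarrow> ssmooth w \<Longrightarrow> ssmooth (\<lambda>\<phi>. u \<phi> * w \<phi>)"
  by (simp add: ssmooth_def smooth_mult)

lemma ssmooth_eval:
  assumes "jsmooth \<Omega> F" "ssmooth X" "\<And>\<phi>. \<phi> \<in> V \<Longrightarrow> X \<phi> \<in> \<Omega>"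
  shows "ssmooth (\<lambda>\<phi>. F \<phi> (X \<phi>))"
  unfolding ssmooth_def
proof (intro allI impI)
  fix c assume c: "fcurve c"
  then show "smooth (\<lambda>t. F (c t) (X (c t)))"
    using assms(2,3) fcurve_in[OF c] by (intro jsmoothD[OF assms(1) c]) (auto simp: ssmooth_def)
qed

text \<open>Along the line \<open>\<phi> + s v\<close> the function and the point move
  simultaneously, as in \<open>eval_has_vector_derivative\<close>; the required uniform quotients
  are those of \<open>jsmooth_uniform_quotient\<close>.\<close>

lemma sDir_eval:
  fixes F :: "'e \<Rightarrow> 'a::euclidean_space \<Rightarrow> 'b::banach"
  assumes F: "jsmooth \<Omega> F" and "open \<Omega>" and X: "ssmooth X" "\<And>\<phi>. \<phi> \<in> V \<Longrightarrow> X \<phi> \<in> \<Omega>"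
    and \<phi>: "\<phi> \<in> V" "v \<in> V"
  shows "sDir v (\<lambda>\<phi>. F \<phi> (X \<phi>)) \<phi> = Dir v F \<phi> (X \<phi>) + pd (sDir v X \<phi>) F \<phi> (X \<phi>)"
proof (rule sDir_eqI)
  note X' = X(2)[OF line_V[OF \<phi>]]
  have "((\<lambda>s. (\<lambda>s. F (\<phi> + s *\<^sub>R v)) s (X (\<phi> + s *\<^sub>R v))) has_vector_derivative
      Dir v F \<phi> (X (\<phi> + 0 *\<^sub>R v)) + pd (sDir v X \<phi>) F \<phi> (X (\<phi> + 0 *\<^sub>R v))) (at 0)"
  proof (rule eval_has_vector_derivative[OF \<open>open \<Omega>\<close> X' sDir_has_vector_derivative[OF X(1) \<phi>]])
    show "(F (\<phi> + 0 *\<^sub>R v) has_derivative (\<lambda>e. pd e F \<phi> (X (\<phi> + 0 *\<^sub>R v)))) (at (X (\<phi> + 0 *\<^sub>R v)))"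
      using jsmooth_has_derivative(1)[OF F \<open>open \<Omega>\<close> \<phi>(1) X'[of 0]] by simp
    show "continuous_on \<Omega> (Dir v F \<phi>)"
      using jsmooth_has_derivative(1)[OF jsmooth_Dir[OF F \<phi>(2)] \<open>open \<Omega>\<close> \<phi>(1)]
      by (meson continuous_at_imp_continuous_on has_derivative_continuous)
  qed (use jsmooth_uniform_quotient[OF F \<open>open \<Omega>\<close> \<phi>] in simp)
  then show "((\<lambda>s. F (\<phi> + s *\<^sub>R v) (X (\<phi> + s *\<^sub>R v))) has_vector_derivative
      Dir v F \<phi> (X \<phi>) + pd (sDir v X \<phi>) F \<phi> (X \<phi>)) (at 0)"
    by simp
qed

end

section \<open>Growth of nets\<close>

definition moderate_net :: "(real \<Rightarrow> 'b::real_normed_vector) \<Rightarrow> bool" where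
  "moderate_net z \<longleftrightarrow> (\<exists>N::nat. (\<lambda>\<epsilon>. norm (z \<epsilon>)) \<in> O[at_right 0](\<lambda>\<epsilon>. inverse (\<epsilon> ^ N)))"

definition negligible_net :: "(real \<Rightarrow> 'b::real_normed_vector) \<Rightarrow> bool" where
  "negligible_net z \<longleftrightarrow> (\<forall>m::nat. (\<lambda>\<epsilon>. norm (z \<epsilon>)) \<in> O[at_right 0](\<lambda>\<epsilon>. \<epsilon> ^ m))"

text \<open>The closure properties shared by moderate and negligible nets. In products one factor
  lies in the class and the other is moderate; eventual domination also permits changes of a net off
  \<open>eps_I\<close>.\<close>

definition net_class :: "((real \<Rightarrow> complex) \<Rightarrow> bool) \<Rightarrow> bool" where
  "net_class P \<longleftrightarrow> P (\<lambda>\<epsilon>. 0) \<and>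
     (\<forall>z z'. P z \<longrightarrow> (\<forall>\<^sub>F \<epsilon> in at_right 0. norm (z' \<epsilon>) \<le> norm (z \<epsilon>)) \<longrightarrow> P z') \<and>
     (\<forall>z z'. P z \<longrightarrow> P z' \<longrightarrow> P (\<lambda>\<epsilon>. z \<epsilon> + z' \<epsilon>)) \<and>
     (\<forall>z z'. P z \<longrightarrow> moderate_net z' \<longrightarrow> P (\<lambda>\<epsilon>. z \<epsilon> * z' \<epsilon>))"

lemma net_classD:
  assumes "net_class P"
  shows "P (\<lambda>\<epsilon>. 0)" "P z \<Longrightarrow> \<forall>\<^sub>F \<epsilon> in at_right 0. norm (z' \<epsilon>) \<le> norm (z \<epsilon>) \<Longrightarrow> P z'"
    "P z \<Longrightarrow> P z' \<Longrightarrow> P (\<lambda>\<epsilon>. z \<epsilon> + z' \<epsilon>)" "P z \<Longrightarrow> moderate_net z' \<Longrightarrow> P (\<lambda>\<epsilon>. z \<epsilon> * z' \<epsilon>)"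
  using assms unfolding net_class_def by blast+

lemma eps_inverse_powers_mono: "m \<le> n \<Longrightarrow> (\<lambda>\<epsilon>::real. inverse (\<epsilon> ^ m)) \<in> O[at_right 0](\<lambda>\<epsilon>. inverse (\<epsilon> ^ n))"
proof (rule bigoI[of _ 1])
  assume "m \<le> n"
  have "\<forall>\<^sub>F \<epsilon>::real in at_right 0. \<epsilon> \<in> {0<..<1}"
    by (rule eventually_at_right_real) simp
  then show "\<forall>\<^sub>F \<epsilon>::real in at_right 0. norm (inverse (\<epsilon> ^ m)) \<le> 1 * norm (inverse (\<epsilon> ^ n))"
    by eventually_elim (use \<open>m \<le> n\<close> in \<open>auto intro!: le_imp_inverse_le power_decreasing\<close>)
qed

lemma moderate_net_mono:
  assumes "moderate_net z" "\<forall>\<^sub>F \<epsilon> in at_right 0. norm (z' \<epsilon>) \<le> norm (z \<epsilon>)"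
  shows "moderate_net z'"
proof -
  have "(\<lambda>\<epsilon>. norm (z' \<epsilon>)) \<in> O[at_right 0](\<lambda>\<epsilon>. norm (z \<epsilon>))"
    by (rule bigoI[of _ 1]) (use assms(2) in simp)
  then show ?thesis
    using assms(1) unfolding moderate_net_def by (blast intro: landau_o.big_trans)
qed

lemma negligible_net_mono:
  assumes "negligible_net z" "\<forall>\<^sub>F \<epsilon> in at_right 0. norm (z' \<epsilon>) \<le> norm (z \<epsilon>)"
  shows "negligible_net z'"
proof -
  have "(\<lambda>\<epsilon>. norm (z' \<epsilon>)) \<in> O[at_right 0](\<lambda>\<epsilon>. norm (z \<epsilon>))"
    by (rule bigoI[of _ 1]) (use assms(2) in simp)
  then show ?thesis
    using assms(1) unfolding negligible_net_def by (blast intro: landau_o.big_trans)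
qed

lemma net_norm_add: "(\<lambda>\<epsilon>. norm (z \<epsilon> + z' \<epsilon>)) \<in> O[F](\<lambda>\<epsilon>. norm (z \<epsilon>) + norm (z' \<epsilon>))"
  by (rule bigoI[of _ 1]) (simp add: norm_triangle_ineq)

lemma net_class_moderate: "net_class moderate_net"
  unfolding net_class_def
proof (intro conjI allI impI)
  show "moderate_net (\<lambda>\<epsilon>. 0)"
    by (simp add: moderate_net_def)
next
  fix z z' :: "real \<Rightarrow> complex" assume "moderate_net z" "moderate_net z'"
  then obtain m n :: nat where mn: "(\<lambda>\<epsilon>. norm (z \<epsilon>)) \<in> O[at_right 0](\<lambda>\<epsilon>. inverse (\<epsilon> ^ m))"
    "(\<lambda>\<epsilon>. norm (z' \<epsilon>)) \<in> O[at_right 0](\<lambda>\<epsilon>. inverse (\<epsilon> ^ n))"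
    unfolding moderate_net_def by blast
  have "(\<lambda>\<epsilon>. norm (z \<epsilon>)) \<in> O[at_right 0](\<lambda>\<epsilon>. inverse (\<epsilon> ^ (max m n)))"
    "(\<lambda>\<epsilon>. norm (z' \<epsilon>)) \<in> O[at_right 0](\<lambda>\<epsilon>. inverse (\<epsilon> ^ (max m n)))"
    by (rule landau_o.big_trans[OF mn(1) eps_inverse_powers_mono]
          landau_o.big_trans[OF mn(2) eps_inverse_powers_mono]; simp)+
  then have "(\<lambda>\<epsilon>. norm (z \<epsilon>) + norm (z' \<epsilon>)) \<in> O[at_right 0](\<lambda>\<epsilon>. inverse (\<epsilon> ^ (max m n)))"
    by (rule sum_in_bigo)
  then show "moderate_net (\<lambda>\<epsilon>. z \<epsilon> + z' \<epsilon>)"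
    unfolding moderate_net_def using landau_o.big_trans[OF net_norm_add] by blast
  have "(\<lambda>\<epsilon>. norm (z \<epsilon> * z' \<epsilon>)) \<in> O[at_right 0](\<lambda>\<epsilon>. inverse (\<epsilon> ^ (m + n)))"
    unfolding norm_mult power_add inverse_mult_distrib using mn by (rule landau_o.big.mult)
  then show "moderate_net (\<lambda>\<epsilon>. z \<epsilon> * z' \<epsilon>)"
    unfolding moderate_net_def by blast
qed (rule moderate_net_mono)

lemma net_class_negligible: "net_class negligible_net"
  unfolding net_class_def
proof (intro conjI allI impI)
  show "negligible_net (\<lambda>\<epsilon>. 0)"
    by (simp add: negligible_net_def)
next
  fix z z' :: "real \<Rightarrow> complex" assume z: "negligible_net z" and z': "negligible_net z'"
  have "(\<lambda>\<epsilon>. norm (z \<epsilon>) + norm (z' \<epsilon>)) \<in> O[at_right 0](\<lambda>\<epsilon>. \<epsilon> ^ m)" for m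
    using z[unfolded negligible_net_def, rule_format, of m] z'[unfolded negligible_net_def, rule_format, of m]
    by (rule sum_in_bigo(1))
  then show "negligible_net (\<lambda>\<epsilon>. z \<epsilon> + z' \<epsilon>)"
    unfolding negligible_net_def using landau_o.big_trans[OF net_norm_add] by blast
next
  fix z z' :: "real \<Rightarrow> complex" assume z: "negligible_net z" and z': "moderate_net z'"
  then obtain n :: nat where n: "(\<lambda>\<epsilon>. norm (z' \<epsilon>)) \<in> O[at_right 0](\<lambda>\<epsilon>. inverse (\<epsilon> ^ n))"
    unfolding moderate_net_def by blast
  have "(\<lambda>\<epsilon>. norm (z \<epsilon> * z' \<epsilon>)) \<in> O[at_right 0](\<lambda>\<epsilon>. \<epsilon> ^ m)" for m
  proof -
    \<comment> \<open>Order \<open>m + n\<close> is requested so that the factor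
      \<open>inverse (\<epsilon> ^ n)\<close> of the moderate net can be absorbed.\<close>
    have "(\<lambda>\<epsilon>. norm (z \<epsilon>)) \<in> O[at_right 0](\<lambda>\<epsilon>. \<epsilon> ^ (m + n))"
      using z unfolding negligible_net_def by blast
    from landau_o.big.mult[OF this n]
    have "(\<lambda>\<epsilon>. norm (z \<epsilon> * z' \<epsilon>)) \<in> O[at_right 0](\<lambda>\<epsilon>. \<epsilon> ^ (m + n) * inverse (\<epsilon> ^ n))"
      by (simp add: norm_mult)
    also have "(\<lambda>\<epsilon>::real. \<epsilon> ^ (m + n) * inverse (\<epsilon> ^ n)) \<in> O[at_right 0](\<lambda>\<epsilon>. \<epsilon> ^ m)"
      by (rule bigoI[of _ 1]) (auto simp: eventually_at_filter power_add intro!: always_eventually)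
    finally show ?thesis .
  qed
  then show "negligible_net (\<lambda>\<epsilon>. z \<epsilon> * z' \<epsilon>)"
    unfolding negligible_net_def by blast
qed (rule negligible_net_mono)

lemma negligible_net_tendsto: "negligible_net z \<Longrightarrow> (z \<longlongrightarrow> 0) (at_right 0)"
proof -
  assume "negligible_net z"
  then have "(\<lambda>\<epsilon>. norm (z \<epsilon>)) \<in> O[at_right 0](\<lambda>\<epsilon>. \<epsilon> ^ 1)"
    unfolding negligible_net_def by blast
  then obtain c where c: "\<forall>\<^sub>F \<epsilon> in at_right 0. norm (z \<epsilon>) \<le> c * \<bar>\<epsilon>\<bar>"
    by (auto elim!: landau_o.bigE)
  have "((\<lambda>\<epsilon>::real. c * \<bar>\<epsilon>\<bar>) \<longlongrightarrow> 0) (at_right 0)"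
    by (rule tendsto_eq_intros refl | simp)+
  with c show ?thesis
    by (rule Lim_null_comparison)
qed

lemma eventually_eps_I: "\<forall>\<^sub>F \<epsilon> in at_right 0. \<epsilon> \<in> eps_I"
  using eventually_at_right_real[of 0 1] by (auto simp: eps_I_def elim!: eventually_mono)

section \<open>Growth of families along test objects\<close>

text \<open>\<open>V\<close>, \<open>S\<close> and \<open>S0\<close> stand for the nets of kernels,
  the test objects and the 0-test objects.\<close>

locale test_space = direction_space V for V :: "'e::real_vector set" +
  fixes S S0 :: "'e set"
  assumes S_sub: "S \<subseteq> V" and S0_sub: "S0 \<subseteq> V"
begin

text \<open>With lists limited to length \<open>n\<close>, differentiating the function once costs
  exactly one order, so induction on \<open>n\<close> is possible.\<close>

definition growth :: "((real \<Rightarrow> complex) \<Rightarrow> bool) \<Rightarrow> nat \<Rightarrow> ('e \<Rightarrow> real \<Rightarrow> complex) \<Rightarrow> bool" where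
  "growth P n u \<longleftrightarrow> (\<forall>\<phi>\<in>S. \<forall>\<psi>s. set \<psi>s \<subseteq> S0 \<and> length \<psi>s \<le> n \<longrightarrow> P (\<lambda>\<epsilon>. sDirs \<psi>s (\<lambda>\<phi>. u \<phi> \<epsilon>) \<phi>))"

definition fam_smooth :: "('e \<Rightarrow> real \<Rightarrow> 'b::real_normed_vector) \<Rightarrow> bool" where
  "fam_smooth u \<longleftrightarrow> (\<forall>\<epsilon>\<in>eps_I. ssmooth (\<lambda>\<phi>. u \<phi> \<epsilon>))"

lemma net_class_cong:
  "net_class P \<Longrightarrow> P z \<Longrightarrow> (\<And>\<epsilon>. \<epsilon> \<in> eps_I \<Longrightarrow> z' \<epsilon> = z \<epsilon>) \<Longrightarrow> P z'"
  by (erule net_classD(2), assumption) (use eventually_eps_I in \<open>auto elim!: eventually_mono\<close>)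

lemma growth_cong:
  assumes "net_class P" "growth P n u" "\<And>\<phi> \<epsilon>. \<phi> \<in> V \<Longrightarrow> \<epsilon> \<in> eps_I \<Longrightarrow> w \<phi> \<epsilon> = u \<phi> \<epsilon>"
  shows "growth P n w"
  unfolding growth_def
proof (intro ballI allI impI)
  fix \<phi> \<psi>s assume *: "\<phi> \<in> S" "set \<psi>s \<subseteq> S0 \<and> length \<psi>s \<le> n"
  then have V: "set \<psi>s \<subseteq> V" "\<phi> \<in> V"
    using S_sub S0_sub by auto
  have "P (\<lambda>\<epsilon>. sDirs \<psi>s (\<lambda>\<phi>. u \<phi> \<epsilon>) \<phi>)"
    using assms(2) * unfolding growth_def by blast
  then show "P (\<lambda>\<epsilon>. sDirs \<psi>s (\<lambda>\<phi>. w \<phi> \<epsilon>) \<phi>)"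
    by (rule net_class_cong[OF assms(1)]) (intro sDirs_cong assms(3) V)
qed

lemma growth_0: "growth P 0 u \<longleftrightarrow> (\<forall>\<phi>\<in>S. P (u \<phi>))"
  by (auto simp: growth_def)

lemma growth_mono: "growth P n u \<Longrightarrow> m \<le> n \<Longrightarrow> growth P m u"
  unfolding growth_def by auto

text \<open>Peels off the innermost direction. Sums, products and point values then require only
  their first-order derivative rule, the resulting functions being new instances for the induction
  hypothesis.\<close>

lemma growth_Suc:
  "growth P (Suc n) u \<longleftrightarrow> growth P 0 u \<and> (\<forall>\<psi>\<in>S0. growth P n (\<lambda>\<phi> \<epsilon>. sDir \<psi> (\<lambda>\<phi>. u \<phi> \<epsilon>) \<phi>))"
proof (intro iffI conjI ballI)
  assume u: "growth P (Suc n) u"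
  then show "growth P 0 u"
    by (rule growth_mono) simp
  fix \<psi> assume \<psi>: "\<psi> \<in> S0"
  show "growth P n (\<lambda>\<phi> \<epsilon>. sDir \<psi> (\<lambda>\<phi>. u \<phi> \<epsilon>) \<phi>)"
    unfolding growth_def
  proof (intro ballI allI impI)
    fix \<phi> \<psi>s assume "\<phi> \<in> S" "set \<psi>s \<subseteq> S0 \<and> length \<psi>s \<le> n"
    with \<psi> have "P (\<lambda>\<epsilon>. sDirs (\<psi>s @ [\<psi>]) (\<lambda>\<phi>. u \<phi> \<epsilon>) \<phi>)"
      using u unfolding growth_def by (metis Suc_le_mono Un_subset_iff empty_subsetI insert_subset length_append_singleton list.set(1,2) set_append)
    then show "P (\<lambda>\<epsilon>. sDirs \<psi>s (\<lambda>\<phi>. sDir \<psi> (\<lambda>\<phi>. u \<phi> \<epsilon>) \<phi>) \<phi>)"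
      by simp
  qed
next
  assume u: "growth P 0 u \<and> (\<forall>\<psi>\<in>S0. growth P n (\<lambda>\<phi> \<epsilon>. sDir \<psi> (\<lambda>\<phi>. u \<phi> \<epsilon>) \<phi>))"
  show "growth P (Suc n) u"
    unfolding growth_def
  proof (intro ballI allI impI)
    fix \<phi> \<psi>s assume *: "\<phi> \<in> S" "set \<psi>s \<subseteq> S0 \<and> length \<psi>s \<le> Suc n"
    show "P (\<lambda>\<epsilon>. sDirs \<psi>s (\<lambda>\<phi>. u \<phi> \<epsilon>) \<phi>)"
    proof (cases \<psi>s rule: rev_cases)
      case Nil
      then show ?thesis
        using u * unfolding growth_def by auto
    next
      case (snoc \<psi>s' \<psi>)
      then have "growth P n (\<lambda>\<phi> \<epsilon>. sDir \<psi> (\<lambda>\<phi>. u \<phi> \<epsilon>) \<phi>)" "set \<psi>s' \<subseteq> S0" "length \<psi>s' \<le> n"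
        using u * by auto
      then show ?thesis
        using * unfolding growth_def snoc by simp
    qed
  qed
qed

lemma fam_smooth_sDir:
  fixes u :: "'e \<Rightarrow> real \<Rightarrow> 'b::banach"
  shows "fam_smooth u \<Longrightarrow> v \<in> V \<Longrightarrow> fam_smooth (\<lambda>\<phi> \<epsilon>. sDir v (\<lambda>\<phi>. u \<phi> \<epsilon>) \<phi>)"
  unfolding fam_smooth_def by (auto intro: ssmooth_sDir)

lemma fam_smooth_add: "fam_smooth u \<Longrightarrow> fam_smooth w \<Longrightarrow> fam_smooth (\<lambda>\<phi> \<epsilon>. u \<phi> \<epsilon> + w \<phi> \<epsilon>)"
  unfolding fam_smooth_def by (auto intro: ssmooth_add)

lemma fam_smooth_mult:
  fixes u w :: "'e \<Rightarrow> real \<Rightarrow> complex"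
  shows "fam_smooth u \<Longrightarrow> fam_smooth w \<Longrightarrow> fam_smooth (\<lambda>\<phi> \<epsilon>. u \<phi> \<epsilon> * w \<phi> \<epsilon>)"
  unfolding fam_smooth_def by (auto intro: ssmooth_mult)

lemma growth_add:
  assumes P: "net_class P"
  shows "fam_smooth u \<Longrightarrow> fam_smooth w \<Longrightarrow> growth P n u \<Longrightarrow> growth P n w \<Longrightarrow> growth P n (\<lambda>\<phi> \<epsilon>. u \<phi> \<epsilon> + w \<phi> \<epsilon>)"
proof (induction n arbitrary: u w)
  case 0
  then show ?case
    using net_classD(3)[OF P] by (simp add: growth_0)
next
  case (Suc n)
  have "growth P n (\<lambda>\<phi> \<epsilon>. sDir \<psi> (\<lambda>\<phi>. u \<phi> \<epsilon> + w \<phi> \<epsilon>) \<phi>)" if "\<psi> \<in> S0" for \<psi>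
  proof (rule growth_cong[OF P])
    show "growth P n (\<lambda>\<phi> \<epsilon>. sDir \<psi> (\<lambda>\<phi>. u \<phi> \<epsilon>) \<phi> + sDir \<psi> (\<lambda>\<phi>. w \<phi> \<epsilon>) \<phi>)"
      using Suc.prems that S0_sub by (intro Suc.IH fam_smooth_sDir) (auto simp: growth_Suc)
    show "sDir \<psi> (\<lambda>\<phi>. u \<phi> \<epsilon> + w \<phi> \<epsilon>) \<phi> = sDir \<psi> (\<lambda>\<phi>. u \<phi> \<epsilon>) \<phi> + sDir \<psi> (\<lambda>\<phi>. w \<phi> \<epsilon>) \<phi>"
      if "\<phi> \<in> V" "\<epsilon> \<in> eps_I" for \<phi> \<epsilon>
      using Suc.prems that \<open>\<psi> \<in> S0\<close> S0_sub by (intro sDir_add) (auto simp: fam_smooth_def)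
  qed
  moreover have "growth P 0 (\<lambda>\<phi> \<epsilon>. u \<phi> \<epsilon> + w \<phi> \<epsilon>)"
    using growth_mono[OF Suc.prems(3), of 0] growth_mono[OF Suc.prems(4), of 0] net_classD(3)[OF P] by (simp add: growth_0)
  ultimately show ?case
    by (simp add: growth_Suc)
qed

text \<open>By the Leibniz rule; in every summand the class \<open>P\<close> is carried by a
  derivative of \<open>u\<close> and moderateness by a derivative of \<open>w\<close>.\<close>

lemma growth_mult:
  assumes P: "net_class P"
  shows "fam_smooth u \<Longrightarrow> fam_smooth w \<Longrightarrow> growth P n u \<Longrightarrow> growth moderate_net n w \<Longrightarrow> growth P n (\<lambda>\<phi> \<epsilon>. u \<phi> \<epsilon> * w \<phi> \<epsilon>)"
proof (induction n arbitrary: u w)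
  case 0
  then show ?case
    using net_classD(4)[OF P] by (simp add: growth_0)
next
  case (Suc n)
  have "growth P n (\<lambda>\<phi> \<epsilon>. sDir \<psi> (\<lambda>\<phi>. u \<phi> \<epsilon> * w \<phi> \<epsilon>) \<phi>)" if \<psi>: "\<psi> \<in> S0" for \<psi>
  proof (rule growth_cong[OF P])
    have \<psi>V: "\<psi> \<in> V" using \<psi> S0_sub by auto
    note fs = fam_smooth_sDir[OF Suc.prems(1) \<psi>V] fam_smooth_sDir[OF Suc.prems(2) \<psi>V]
    have l: "growth P n (\<lambda>\<phi> \<epsilon>. sDir \<psi> (\<lambda>\<phi>. u \<phi> \<epsilon>) \<phi>)" "growth moderate_net n (\<lambda>\<phi> \<epsilon>. sDir \<psi> (\<lambda>\<phi>. w \<phi> \<epsilon>) \<phi>)"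
      using Suc.prems \<psi> by (auto simp: growth_Suc)
    show "growth P n (\<lambda>\<phi> \<epsilon>. sDir \<psi> (\<lambda>\<phi>. u \<phi> \<epsilon>) \<phi> * w \<phi> \<epsilon> + u \<phi> \<epsilon> * sDir \<psi> (\<lambda>\<phi>. w \<phi> \<epsilon>) \<phi>)"
      by (intro growth_add[OF P] Suc.IH fam_smooth_mult fs l Suc.prems growth_mono[OF Suc.prems(3)] growth_mono[OF Suc.prems(4)]) auto
    show "sDir \<psi> (\<lambda>\<phi>. u \<phi> \<epsilon> * w \<phi> \<epsilon>) \<phi> = sDir \<psi> (\<lambda>\<phi>. u \<phi> \<epsilon>) \<phi> * w \<phi> \<epsilon> + u \<phi> \<epsilon> * sDir \<psi> (\<lambda>\<phi>. w \<phi> \<epsilon>) \<phi>"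
      if "\<phi> \<in> V" "\<epsilon> \<in> eps_I" for \<phi> \<epsilon>
      using Suc.prems that \<psi>V by (intro sDir_mult) (auto simp: fam_smooth_def)
  qed
  moreover have "growth P 0 (\<lambda>\<phi> \<epsilon>. u \<phi> \<epsilon> * w \<phi> \<epsilon>)"
    using growth_mono[OF Suc.prems(3), of 0] growth_mono[OF Suc.prems(4), of 0] net_classD(4)[OF P] by (simp add: growth_0)
  ultimately show ?case
    by (simp add: growth_Suc)
qed

lemma ssmooth_zero: "ssmooth (\<lambda>\<phi>. 0)"
  by (auto simp: ssmooth_def intro: smooth_const)

lemma fam_smooth_sum:
  "finite A \<Longrightarrow> (\<And>i. i \<in> A \<Longrightarrow> fam_smooth (u i)) \<Longrightarrow> fam_smooth (\<lambda>\<phi> \<epsilon>. \<Sum>i\<in>A. u i \<phi> \<epsilon>)"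
  by (induction A rule: finite_induct) (auto intro: fam_smooth_add simp: fam_smooth_def[of "\<lambda>\<phi> \<epsilon>. 0"] ssmooth_zero)

lemma growth_zero: "net_class P \<Longrightarrow> growth P n (\<lambda>\<phi> \<epsilon>. 0)"
proof (induction n)
  case 0
  then show ?case by (simp add: growth_0 net_classD(1))
next
  case (Suc n)
  have "sDir \<psi> (\<lambda>\<phi>. 0) = (\<lambda>\<phi>. 0 :: complex)" for \<psi>
    by (intro ext sDir_eqI) auto
  then show ?case
    using Suc by (simp add: growth_Suc) (simp add: growth_0 net_classD(1))
qed

lemma growth_sum:
  assumes P: "net_class P"
  shows "finite A \<Longrightarrow> (\<And>i. i \<in> A \<Longrightarrow> fam_smooth (u i)) \<Longrightarrow> (\<And>i. i \<in> A \<Longrightarrow> growth P n (u i)) \<Longrightarrow>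
    growth P n (\<lambda>\<phi> \<epsilon>. \<Sum>i\<in>A. u i \<phi> \<epsilon>)"
proof (induction A rule: finite_induct)
  case empty
  then show ?case by (simp add: growth_zero[OF P])
next
  case (insert j A)
  then show ?case
    by (simp add: growth_add[OF P] fam_smooth_sum)
qed

section \<open>Point values of families of smooth functions\<close>

definition fam_jsmooth :: "'a::euclidean_space set \<Rightarrow> ('e \<Rightarrow> real \<Rightarrow> 'a \<Rightarrow> complex) \<Rightarrow> bool" where
  "fam_jsmooth \<Omega> F \<longleftrightarrow> (\<forall>\<epsilon>\<in>eps_I. jsmooth \<Omega> (\<lambda>\<phi>. F \<phi> \<epsilon>))"

text \<open>Uniform growth on compact sets, expressed by evaluation along arbitrary selections of points.\<close>

definition fam_growth :: "((real \<Rightarrow> complex) \<Rightarrow> bool) \<Rightarrow> 'a::euclidean_space set \<Rightarrow>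
    ('e \<Rightarrow> real \<Rightarrow> 'a \<Rightarrow> complex) \<Rightarrow> bool" where
  "fam_growth P \<Omega> F \<longleftrightarrow> (\<forall>\<phi>\<in>S. \<forall>\<psi>s vs K y. set \<psi>s \<subseteq> S0 \<and> set vs \<subseteq> Basis \<and> compact K \<and> K \<subseteq> \<Omega> \<and>
     (\<forall>\<^sub>F \<epsilon> in at_right 0. y \<epsilon> \<in> K) \<longrightarrow> P (\<lambda>\<epsilon>. Dirs \<psi>s (pds vs (\<lambda>\<phi>. F \<phi> \<epsilon>)) \<phi> (y \<epsilon>)))"

lemma fam_growthD:
  assumes "fam_growth P \<Omega> F" "\<phi> \<in> S" "set \<psi>s \<subseteq> S0" "set vs \<subseteq> Basis" "compact K" "K \<subseteq> \<Omega>"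
    "\<forall>\<^sub>F \<epsilon> in at_right 0. y \<epsilon> \<in> K"
  shows "P (\<lambda>\<epsilon>. Dirs \<psi>s (pds vs (\<lambda>\<phi>. F \<phi> \<epsilon>)) \<phi> (y \<epsilon>))"
  using assms unfolding fam_growth_def by blast

lemma fam_jsmooth_pd:
  "fam_jsmooth \<Omega> F \<Longrightarrow> open \<Omega> \<Longrightarrow> fam_jsmooth \<Omega> (\<lambda>\<phi> \<epsilon>. pd i (\<lambda>\<phi>. F \<phi> \<epsilon>) \<phi>)"
  unfolding fam_jsmooth_def by (auto intro: jsmooth_pd)

lemma fam_jsmooth_Dir:
  "fam_jsmooth \<Omega> F \<Longrightarrow> v \<in> V \<Longrightarrow> fam_jsmooth \<Omega> (\<lambda>\<phi> \<epsilon>. Dir v (\<lambda>\<phi>. F \<phi> \<epsilon>) \<phi>)"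
  unfolding fam_jsmooth_def by (auto intro: jsmooth_Dir)

lemma fam_growth_pd:
  fixes F :: "'e \<Rightarrow> real \<Rightarrow> 'a::euclidean_space \<Rightarrow> complex"
  assumes F: "fam_growth P \<Omega> F" and i: "i \<in> Basis"
  shows "fam_growth P \<Omega> (\<lambda>\<phi> \<epsilon>. pd i (\<lambda>\<phi>. F \<phi> \<epsilon>) \<phi>)"
  unfolding fam_growth_def
proof (intro ballI allI impI, elim conjE)
  fix \<phi> \<psi>s and vs :: "'a list" and K and y :: "real \<Rightarrow> 'a"
  assume *: "\<phi> \<in> S" "set \<psi>s \<subseteq> S0" "set vs \<subseteq> Basis" "compact K" "K \<subseteq> \<Omega>" "\<forall>\<^sub>F \<epsilon> in at_right 0. y \<epsilon> \<in> K"
  then show "P (\<lambda>\<epsilon>. Dirs \<psi>s (pds vs (\<lambda>\<phi>. pd i (\<lambda>\<phi>. F \<phi> \<epsilon>) \<phi>)) \<phi> (y \<epsilon>))"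
    using fam_growthD[OF F *(1,2) _ *(4-6), of "vs @ [i]"] i by simp
qed

text \<open>The new kernel derivative sits inside the space derivatives. Exchanging them places it
  beside the other kernel directions, and the hypothesis applies with a list longer by one.\<close>

lemma fam_growth_Dir:
  fixes F :: "'e \<Rightarrow> real \<Rightarrow> 'a::euclidean_space \<Rightarrow> complex"
  assumes P: "net_class P" and F: "fam_growth P \<Omega> F" "fam_jsmooth \<Omega> F" and "open \<Omega>" and v: "v \<in> S0"
  shows "fam_growth P \<Omega> (\<lambda>\<phi> \<epsilon>. Dir v (\<lambda>\<phi>. F \<phi> \<epsilon>) \<phi>)"
  unfolding fam_growth_def
proof (intro ballI allI impI, elim conjE)
  fix \<phi> \<psi>s and vs :: "'a list" and K and y :: "real \<Rightarrow> 'a"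
  assume *: "\<phi> \<in> S" "set \<psi>s \<subseteq> S0" "set vs \<subseteq> Basis" "compact K" "K \<subseteq> \<Omega>" "\<forall>\<^sub>F \<epsilon> in at_right 0. y \<epsilon> \<in> K"
  have vV: "v \<in> V" "\<phi> \<in> V" "set \<psi>s \<subseteq> V"
    using v * S_sub S0_sub by auto
  have "P (\<lambda>\<epsilon>. Dirs (\<psi>s @ [v]) (pds vs (\<lambda>\<phi>. F \<phi> \<epsilon>)) \<phi> (y \<epsilon>))"
    using fam_growthD[OF F(1) *(1) _ *(3-6), of "\<psi>s @ [v]"] * v by simp
  moreover have "\<forall>\<^sub>F \<epsilon> in at_right 0. norm (Dirs \<psi>s (pds vs (\<lambda>\<phi>. Dir v (\<lambda>\<phi>. F \<phi> \<epsilon>) \<phi>)) \<phi> (y \<epsilon>)) \<le>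
      norm (Dirs (\<psi>s @ [v]) (pds vs (\<lambda>\<phi>. F \<phi> \<epsilon>)) \<phi> (y \<epsilon>))"
    using *(6) eventually_eps_I
  proof eventually_elim
    case (elim \<epsilon>)
    then have y: "y \<epsilon> \<in> \<Omega>" and J: "jsmooth \<Omega> (\<lambda>\<phi>. F \<phi> \<epsilon>)"
      using * F by (auto simp: fam_jsmooth_def)
    have "Dirs \<psi>s (pds vs (Dir v (\<lambda>\<phi>. F \<phi> \<epsilon>))) \<phi> (y \<epsilon>) = Dirs \<psi>s (Dir v (pds vs (\<lambda>\<phi>. F \<phi> \<epsilon>))) \<phi> (y \<epsilon>)"
      using pds_Dirs_commute[OF J \<open>open \<Omega>\<close> _ _ y, of _ "[v]" vs] vV by (intro Dirs_cong) auto
    then show ?case by simp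
  qed
  ultimately show "P (\<lambda>\<epsilon>. Dirs \<psi>s (pds vs (\<lambda>\<phi>. Dir v (\<lambda>\<phi>. F \<phi> \<epsilon>) \<phi>)) \<phi> (y \<epsilon>))"
    by (rule net_classD(2)[OF P])
qed

definition evalp :: "('e \<Rightarrow> real \<Rightarrow> 'a \<Rightarrow> complex) \<Rightarrow> ('e \<Rightarrow> real \<Rightarrow> 'a) \<Rightarrow> 'e \<Rightarrow> real \<Rightarrow> complex" where
  "evalp F X = (\<lambda>\<phi> \<epsilon>. F \<phi> \<epsilon> (X \<phi> \<epsilon>))"

text \<open>Complex valued, because \<open>net_class\<close> and the product rule are set up for
  complex nets.\<close>

definition coord :: "('e \<Rightarrow> real \<Rightarrow> 'a::euclidean_space) \<Rightarrow> 'a \<Rightarrow> 'e \<Rightarrow> real \<Rightarrow> complex" where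
  "coord X i = (\<lambda>\<phi> \<epsilon>. complex_of_real (X \<phi> \<epsilon> \<bullet> i))"

definition point_fam :: "'a::euclidean_space set \<Rightarrow> ('e \<Rightarrow> real \<Rightarrow> 'a) \<Rightarrow> bool" where
  "point_fam \<Omega> X \<longleftrightarrow> fam_smooth X \<and> (\<forall>\<phi>\<in>V. \<forall>\<epsilon>\<in>eps_I. X \<phi> \<epsilon> \<in> \<Omega>)"

lemma bounded_linear_coord: "bounded_linear (\<lambda>x::'a::euclidean_space. complex_of_real (x \<bullet> i))"
  by (rule bounded_linear_compose[OF bounded_linear_of_real bounded_linear_inner_left])

lemma fam_smooth_coord: "fam_smooth X \<Longrightarrow> fam_smooth (coord X i)"
  unfolding fam_smooth_def coord_def by (auto intro: ssmooth_linear[OF bounded_linear_coord])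

lemma fam_smooth_evalp:
  "fam_jsmooth \<Omega> F \<Longrightarrow> point_fam \<Omega> X \<Longrightarrow> fam_smooth (evalp F X)"
  unfolding fam_jsmooth_def point_fam_def fam_smooth_def evalp_def
proof (intro ballI, elim conjE)
  fix \<epsilon> assume "\<forall>\<epsilon>\<in>eps_I. jsmooth \<Omega> (\<lambda>\<phi>. F \<phi> \<epsilon>)" "\<forall>\<epsilon>\<in>eps_I. ssmooth (\<lambda>\<phi>. X \<phi> \<epsilon>)"
    "\<forall>\<phi>\<in>V. \<forall>\<epsilon>\<in>eps_I. X \<phi> \<epsilon> \<in> \<Omega>" and \<epsilon>: "\<epsilon> \<in> eps_I"
  then show "ssmooth (\<lambda>\<phi>. F \<phi> \<epsilon> (X \<phi> \<epsilon>))"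
    by (intro ssmooth_eval[of \<Omega> "\<lambda>\<phi>. F \<phi> \<epsilon>" "\<lambda>\<phi>. X \<phi> \<epsilon>"]) simp_all
qed

lemma sDir_evalp:
  assumes F: "fam_jsmooth \<Omega> F" and X: "point_fam \<Omega> X" and "open \<Omega>" and "\<phi> \<in> V" "v \<in> V" "\<epsilon> \<in> eps_I"
  shows "sDir v (\<lambda>\<phi>. evalp F X \<phi> \<epsilon>) \<phi> = evalp (\<lambda>\<phi> \<epsilon>. Dir v (\<lambda>\<phi>. F \<phi> \<epsilon>) \<phi>) X \<phi> \<epsilon> +
    (\<Sum>i\<in>Basis. evalp (\<lambda>\<phi> \<epsilon>. pd i (\<lambda>\<phi>. F \<phi> \<epsilon>) \<phi>) X \<phi> \<epsilon> * sDir v (\<lambda>\<phi>. coord X i \<phi> \<epsilon>) \<phi>)"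
proof -
  have J: "jsmooth \<Omega> (\<lambda>\<phi>. F \<phi> \<epsilon>)" and Xs: "ssmooth (\<lambda>\<phi>. X \<phi> \<epsilon>)" and X\<Omega>: "\<And>\<phi>. \<phi> \<in> V \<Longrightarrow> X \<phi> \<epsilon> \<in> \<Omega>"
    using assms by (auto simp: fam_jsmooth_def point_fam_def fam_smooth_def)
  have c: "sDir v (\<lambda>\<phi>. coord X i \<phi> \<epsilon>) \<phi> = complex_of_real (sDir v (\<lambda>\<phi>. X \<phi> \<epsilon>) \<phi> \<bullet> i)" for i
    unfolding coord_def by (rule sDir_linear[OF bounded_linear_coord Xs assms(4,5)])
  have "sDir v (\<lambda>\<phi>. F \<phi> \<epsilon> (X \<phi> \<epsilon>)) \<phi> = Dir v (\<lambda>\<phi>. F \<phi> \<epsilon>) \<phi> (X \<phi> \<epsilon>) +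
      pd (sDir v (\<lambda>\<phi>. X \<phi> \<epsilon>) \<phi>) (\<lambda>\<phi>. F \<phi> \<epsilon>) \<phi> (X \<phi> \<epsilon>)"
    by (rule sDir_eval[OF J \<open>open \<Omega>\<close> Xs X\<Omega> assms(4,5)])
  also have "pd (sDir v (\<lambda>\<phi>. X \<phi> \<epsilon>) \<phi>) (\<lambda>\<phi>. F \<phi> \<epsilon>) \<phi> (X \<phi> \<epsilon>) =
      (\<Sum>i\<in>Basis. (sDir v (\<lambda>\<phi>. X \<phi> \<epsilon>) \<phi> \<bullet> i) *\<^sub>R pd i (\<lambda>\<phi>. F \<phi> \<epsilon>) \<phi> (X \<phi> \<epsilon>))"
    by (rule jsmooth_has_derivative(3)[OF J \<open>open \<Omega>\<close> assms(4) X\<Omega>[OF assms(4)]])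
  finally show ?thesis
    by (simp add: evalp_def c scaleR_conv_of_real mult.commute)
qed

lemma growth_0_evalp:
  fixes F :: "'e \<Rightarrow> real \<Rightarrow> 'a::euclidean_space \<Rightarrow> complex"
  assumes K: "\<And>\<phi>. \<phi> \<in> S \<Longrightarrow> \<exists>K. compact K \<and> K \<subseteq> \<Omega> \<and> (\<forall>\<^sub>F \<epsilon> in at_right 0. X \<phi> \<epsilon> \<in> K)"
    and F: "fam_growth P \<Omega> F"
  shows "growth P 0 (evalp F X)"
  unfolding growth_0
proof
  fix \<phi> assume \<phi>: "\<phi> \<in> S"
  then obtain K where K: "compact K" "K \<subseteq> \<Omega>" "\<forall>\<^sub>F \<epsilon> in at_right 0. X \<phi> \<epsilon> \<in> K"
    using K by blast
  show "P (evalp F X \<phi>)"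
    using fam_growthD[OF F \<phi>, of "[]" "[]", OF _ _ K] by (simp add: evalp_def)
qed

text \<open>The induction runs over all \<open>F\<close> at once: a derivative replaces
  \<open>F\<close> by \<open>Dir v F\<close> and \<open>pd i F\<close>, and the conditions on
  \<open>F\<close> are stable under both. The coordinates of \<open>X\<close> enter with every
  order, since each step spends one on \<open>sDir v\<close>.\<close>

lemma growth_evalp:
  fixes F :: "'e \<Rightarrow> real \<Rightarrow> 'a::euclidean_space \<Rightarrow> complex"
  assumes P: "net_class P" and "open \<Omega>" and X: "point_fam \<Omega> X"
    and Xm: "\<And>n i. i \<in> Basis \<Longrightarrow> growth moderate_net n (coord X i)"
    and K: "\<And>\<phi>. \<phi> \<in> S \<Longrightarrow> \<exists>K. compact K \<and> K \<subseteq> \<Omega> \<and> (\<forall>\<^sub>F \<epsilon> in at_right 0. X \<phi> \<epsilon> \<in> K)"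
  shows "fam_jsmooth \<Omega> F \<Longrightarrow> fam_growth P \<Omega> F \<Longrightarrow> growth P n (evalp F X)"
proof (induction n arbitrary: F)
  case 0
  then show ?case
    using K by (intro growth_0_evalp)
next
  case (Suc n)
  have "growth P 0 (evalp F X)"
    using K Suc.prems(2) by (rule growth_0_evalp)
  moreover have "growth P n (\<lambda>\<phi> \<epsilon>. sDir v (\<lambda>\<phi>. evalp F X \<phi> \<epsilon>) \<phi>)" if v: "v \<in> S0" for v
  proof (rule growth_cong[OF P _ sDir_evalp[OF Suc.prems(1) X \<open>open \<Omega>\<close>]])
    have vV: "v \<in> V" using v S0_sub by auto
    have sm: "fam_smooth X" using X by (simp add: point_fam_def)
    note [simp] = fam_jsmooth_pd[OF Suc.prems(1) \<open>open \<Omega>\<close>] fam_jsmooth_Dir[OF Suc.prems(1) vV]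
      fam_smooth_sDir[OF fam_smooth_coord[OF sm] vV]
    have lc: "growth moderate_net n (\<lambda>\<phi> \<epsilon>. sDir v (\<lambda>\<phi>. coord X i \<phi> \<epsilon>) \<phi>)" if "i \<in> Basis" for i
      using Xm[OF that, of "Suc n"] v by (simp add: growth_Suc)
    show "growth P n (\<lambda>\<phi> \<epsilon>. evalp (\<lambda>\<phi> \<epsilon>. Dir v (\<lambda>\<phi>. F \<phi> \<epsilon>) \<phi>) X \<phi> \<epsilon> +
      (\<Sum>i\<in>Basis. evalp (\<lambda>\<phi> \<epsilon>. pd i (\<lambda>\<phi>. F \<phi> \<epsilon>) \<phi>) X \<phi> \<epsilon> * sDir v (\<lambda>\<phi>. coord X i \<phi> \<epsilon>) \<phi>))"
      by (intro growth_add[OF P] growth_sum[OF P] fam_smooth_sum fam_smooth_mult growth_mult[OF P] Suc.IH lc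
           fam_smooth_evalp[OF _ X] fam_growth_Dir[OF P Suc.prems(2,1) \<open>open \<Omega>\<close> v] fam_growth_pd[OF Suc.prems(2)])
         simp_all
  qed (use v S0_sub in auto)
  ultimately show ?case
    by (simp add: growth_Suc)
qed

lemma sDir_diff:
  "ssmooth u \<Longrightarrow> ssmooth w \<Longrightarrow> \<phi> \<in> V \<Longrightarrow> v \<in> V \<Longrightarrow> sDir v (\<lambda>\<phi>. u \<phi> - w \<phi>) \<phi> = sDir v u \<phi> - sDir v w \<phi>"
  by (intro sDir_eqI has_vector_derivative_diff sDir_has_vector_derivative)

lemma fam_smooth_diff: "fam_smooth u \<Longrightarrow> fam_smooth w \<Longrightarrow> fam_smooth (\<lambda>\<phi> \<epsilon>. u \<phi> \<epsilon> - w \<phi> \<epsilon>)"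
  unfolding fam_smooth_def ssmooth_def by (simp add: smooth_diff)

lemma net_class_sum:
  assumes P: "net_class P"
  shows "finite A \<Longrightarrow> (\<And>i. i \<in> A \<Longrightarrow> P (z i)) \<Longrightarrow> P (\<lambda>\<epsilon>. \<Sum>i\<in>A. z i \<epsilon>)"
  by (induction A rule: finite_induct) (simp_all add: net_classD(1,3)[OF P])

text \<open>For complex values the mean value theorem gives an intermediate point only through an
  inequality. Such a single point, rather than a supremum over the segment, is what
  \<open>fam_growth\<close> can evaluate.\<close>

lemma jsmooth_mvt:
  fixes F :: "'e \<Rightarrow> 'a::euclidean_space \<Rightarrow> complex"
  assumes F: "jsmooth \<Omega> F" and "open \<Omega>" and \<phi>: "\<phi> \<in> V" and ab: "closed_segment a b \<subseteq> \<Omega>"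
  shows "\<exists>\<xi>\<in>closed_segment a b. norm (F \<phi> b - F \<phi> a) \<le> norm (\<Sum>i\<in>Basis. ((b - a) \<bullet> i) *\<^sub>R pd i F \<phi> \<xi>)"
proof -
  define p where "p = (\<lambda>t::real. a + t *\<^sub>R (b - a))"
  have p: "p t \<in> closed_segment a b" if "t \<in> {0..1}" for t
    using that by (auto simp: p_def closed_segment_def algebra_simps intro!: exI[of _ t])
  have D: "((\<lambda>t. F \<phi> (p t)) has_derivative (\<lambda>h. pd (h *\<^sub>R (b - a)) F \<phi> (p t))) (at t)" if "t \<in> {0..1}" for t
  proof -
    have "(p has_derivative (\<lambda>h. h *\<^sub>R (b - a))) (at t)"
      unfolding p_def by (auto intro!: derivative_eq_intros)
    moreover have "p t \<in> \<Omega>"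
      using p[OF that] ab by blast
    ultimately show ?thesis
      by (rule has_derivative_compose[OF _ jsmooth_has_derivative(1)[OF F \<open>open \<Omega>\<close> \<phi>]])
  qed
  have "\<exists>t\<in>{0<..<1}. norm (F \<phi> (p 1) - F \<phi> (p 0)) \<le> norm (pd ((1 - 0) *\<^sub>R (b - a)) F \<phi> (p t))"
  proof (rule mvt_general)
    show "continuous_on {0..1} (\<lambda>t. F \<phi> (p t))"
      using D by (meson continuous_at_imp_continuous_on has_derivative_continuous)
  qed (use D in auto)
  then obtain t where t: "t \<in> {0<..<1}" "norm (F \<phi> (p 1) - F \<phi> (p 0)) \<le> norm (pd ((1 - 0) *\<^sub>R (b - a)) F \<phi> (p t))"
    by blast
  have "p t \<in> closed_segment a b"
    using t(1) by (intro p) auto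
  moreover from this have "pd (b - a) F \<phi> (p t) = (\<Sum>i\<in>Basis. ((b - a) \<bullet> i) *\<^sub>R pd i F \<phi> (p t))"
    using ab by (intro jsmooth_has_derivative(3)[OF F \<open>open \<Omega>\<close> \<phi>]) blast
  moreover have "p 1 = b" "p 0 = a"
    by (simp_all add: p_def)
  ultimately show ?thesis
    using t(2) by auto
qed

text \<open>A closed neighbourhood of \<open>K\<close> of fixed small radius is still compact in
  \<open>\<Omega>\<close>, and the distance of the two points tends to 0. This serves the mean value
  estimate as well as the transfer of compactness to equivalent points.\<close>

lemma segment_eventually_compact:
  fixes x y :: "real \<Rightarrow> 'a::euclidean_space"
  assumes "open \<Omega>" and K: "compact K" "K \<subseteq> \<Omega>" "\<forall>\<^sub>F \<epsilon> in at_right 0. x \<epsilon> \<in> K"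
    and neg: "\<And>i. i \<in> Basis \<Longrightarrow> negligible_net (\<lambda>\<epsilon>. complex_of_real (x \<epsilon> \<bullet> i) - complex_of_real (y \<epsilon> \<bullet> i))"
  shows "\<exists>K'. compact K' \<and> K' \<subseteq> \<Omega> \<and> (\<forall>\<^sub>F \<epsilon> in at_right 0. closed_segment (y \<epsilon>) (x \<epsilon>) \<subseteq> K')"
proof -
  obtain e where e: "e > 0" "(\<Union>x\<in>K. cball x e) \<subseteq> \<Omega>"
    using compact_subset_open_imp_cball_epsilon_subset[OF K(1) \<open>open \<Omega>\<close> K(2)] by blast
  define K' where "K' = {a + b | a b. a \<in> K \<and> b \<in> cball 0 e}"
  have "compact K'"
    unfolding K'_def by (rule compact_sums[OF K(1) compact_cball])
  moreover have "K' \<subseteq> \<Omega>"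
    using e(2) by (fastforce simp: K'_def dist_norm)
  moreover have "\<forall>\<^sub>F \<epsilon> in at_right 0. closed_segment (y \<epsilon>) (x \<epsilon>) \<subseteq> K'"
  proof -
    have "((\<lambda>\<epsilon>. \<Sum>i\<in>Basis. norm (complex_of_real (x \<epsilon> \<bullet> i) - complex_of_real (y \<epsilon> \<bullet> i))) \<longlongrightarrow> 0) (at_right 0)"
      by (intro tendsto_null_sum tendsto_norm_zero negligible_net_tendsto neg)
    from tendstoD[OF this e(1)] K(3) show ?thesis
    proof eventually_elim
      case (elim \<epsilon>)
      have "norm (x \<epsilon> - y \<epsilon>) \<le> (\<Sum>i\<in>Basis. \<bar>(x \<epsilon> - y \<epsilon>) \<bullet> i\<bar>)"
        by (rule norm_le_l1)
      also have "\<dots> = (\<Sum>i\<in>Basis. norm (complex_of_real (x \<epsilon> \<bullet> i) - complex_of_real (y \<epsilon> \<bullet> i)))"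
        by (simp add: inner_diff_left flip: of_real_diff)
      also have "\<dots> < e"
        using elim(1) by (simp add: dist_real_def)
      finally have "closed_segment (y \<epsilon>) (x \<epsilon>) \<subseteq> cball (x \<epsilon>) e"
        using e(1) by (intro closed_segment_subset convex_cball) (auto simp: dist_norm)
      moreover have "cball (x \<epsilon>) e \<subseteq> K'"
      proof
        fix w assume "w \<in> cball (x \<epsilon>) e"
        then have "w = x \<epsilon> + (w - x \<epsilon>)" "w - x \<epsilon> \<in> cball 0 e"
          by (auto simp: dist_norm norm_minus_commute)
        then show "w \<in> K'"
          using elim(2) unfolding K'_def by blast
      qed
      ultimately show ?case by blast
    qed
  qed
  ultimately show ?thesis by blast
qed

text \<open>As \<open>F\<close> is only moderate, all smallness comes from \<open>X\<close> and
  \<open>Y\<close>: at order zero from their difference, at higher order from the induction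
  hypothesis for the derived families or from the differences of the coordinate derivatives.\<close>

lemma growth_evalp_diff:
  fixes F :: "'e \<Rightarrow> real \<Rightarrow> 'a::euclidean_space \<Rightarrow> complex"
  assumes "open \<Omega>" and X: "point_fam \<Omega> X" and Y: "point_fam \<Omega> Y"
    and Xm: "\<And>n i. i \<in> Basis \<Longrightarrow> growth moderate_net n (coord X i)"
    and Ym: "\<And>n i. i \<in> Basis \<Longrightarrow> growth moderate_net n (coord Y i)"
    and D: "\<And>n i. i \<in> Basis \<Longrightarrow> growth negligible_net n (\<lambda>\<phi> \<epsilon>. coord X i \<phi> \<epsilon> - coord Y i \<phi> \<epsilon>)"
    and KX: "\<And>\<phi>. \<phi> \<in> S \<Longrightarrow> \<exists>K. compact K \<and> K \<subseteq> \<Omega> \<and> (\<forall>\<^sub>F \<epsilon> in at_right 0. X \<phi> \<epsilon> \<in> K)"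
    and KY: "\<And>\<phi>. \<phi> \<in> S \<Longrightarrow> \<exists>K. compact K \<and> K \<subseteq> \<Omega> \<and> (\<forall>\<^sub>F \<epsilon> in at_right 0. Y \<phi> \<epsilon> \<in> K)"
  shows "fam_jsmooth \<Omega> F \<Longrightarrow> fam_growth moderate_net \<Omega> F \<Longrightarrow>
    growth negligible_net n (\<lambda>\<phi> \<epsilon>. evalp F X \<phi> \<epsilon> - evalp F Y \<phi> \<epsilon>)"
proof -
  note nn = net_class_negligible
  have base: "growth negligible_net 0 (\<lambda>\<phi> \<epsilon>. evalp F X \<phi> \<epsilon> - evalp F Y \<phi> \<epsilon>)"
    if F: "fam_jsmooth \<Omega> F" "fam_growth moderate_net \<Omega> F" for F :: "'e \<Rightarrow> real \<Rightarrow> 'a \<Rightarrow> complex"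
    unfolding growth_0
  proof
    fix \<phi> assume \<phi>: "\<phi> \<in> S"
    then have \<phi>V: "\<phi> \<in> V" using S_sub by auto
    obtain K where K: "compact K" "K \<subseteq> \<Omega>" "\<forall>\<^sub>F \<epsilon> in at_right 0. X \<phi> \<epsilon> \<in> K"
      using KX[OF \<phi>] by blast
    have neg: "negligible_net (\<lambda>\<epsilon>. complex_of_real (X \<phi> \<epsilon> \<bullet> i) - complex_of_real (Y \<phi> \<epsilon> \<bullet> i))" if "i \<in> Basis" for i
      using D[OF that, of 0] \<phi> by (simp add: growth_0 coord_def)
    obtain K' where K': "compact K'" "K' \<subseteq> \<Omega>" "\<forall>\<^sub>F \<epsilon> in at_right 0. closed_segment (Y \<phi> \<epsilon>) (X \<phi> \<epsilon>) \<subseteq> K'"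
      using segment_eventually_compact[OF \<open>open \<Omega>\<close> K neg] by blast
    define G where "G = (\<lambda>\<epsilon> \<xi>. \<Sum>i\<in>Basis. ((X \<phi> \<epsilon> - Y \<phi> \<epsilon>) \<bullet> i) *\<^sub>R pd i (\<lambda>\<phi>. F \<phi> \<epsilon>) \<phi> \<xi>)"
    \<comment> \<open>One intermediate point for each \<open>\<epsilon>\<close>, selected inside
      \<open>K'\<close> so that \<open>fam_growth\<close> applies to the selection.\<close>
    define \<xi> where "\<xi> = (\<lambda>\<epsilon>. SOME \<xi>. \<xi> \<in> K' \<and> norm (F \<phi> \<epsilon> (X \<phi> \<epsilon>) - F \<phi> \<epsilon> (Y \<phi> \<epsilon>)) \<le> norm (G \<epsilon> \<xi>))"
    have ev: "\<forall>\<^sub>F \<epsilon> in at_right 0. \<xi> \<epsilon> \<in> K' \<and> norm (F \<phi> \<epsilon> (X \<phi> \<epsilon>) - F \<phi> \<epsilon> (Y \<phi> \<epsilon>)) \<le> norm (G \<epsilon> (\<xi> \<epsilon>))"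
      using K'(3) eventually_eps_I
    proof eventually_elim
      case (elim \<epsilon>)
      have "jsmooth \<Omega> (\<lambda>\<phi>. F \<phi> \<epsilon>)"
        using F(1) elim by (simp add: fam_jsmooth_def)
      from jsmooth_mvt[OF this \<open>open \<Omega>\<close> \<phi>V] elim K'(2)
      have "\<exists>\<xi>. \<xi> \<in> K' \<and> norm (F \<phi> \<epsilon> (X \<phi> \<epsilon>) - F \<phi> \<epsilon> (Y \<phi> \<epsilon>)) \<le> norm (G \<epsilon> \<xi>)"
        unfolding G_def by (meson order_trans subsetD)
      then show ?case
        unfolding \<xi>_def by (rule someI_ex)
    qed
    have "moderate_net (\<lambda>\<epsilon>. pd i (\<lambda>\<phi>. F \<phi> \<epsilon>) \<phi> (\<xi> \<epsilon>))" if "i \<in> Basis" for i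
      using fam_growthD[OF F(2) \<phi>, of "[]" "[i]" K' \<xi>] that K'(1,2) eventually_mono[OF ev] by simp
    then have "negligible_net (\<lambda>\<epsilon>. \<Sum>i\<in>Basis. (complex_of_real (X \<phi> \<epsilon> \<bullet> i) - complex_of_real (Y \<phi> \<epsilon> \<bullet> i)) *
        pd i (\<lambda>\<phi>. F \<phi> \<epsilon>) \<phi> (\<xi> \<epsilon>))"
      by (intro net_class_sum[OF nn] net_classD(4)[OF nn] neg) auto
    then have "negligible_net (\<lambda>\<epsilon>. G \<epsilon> (\<xi> \<epsilon>))"
      by (simp add: G_def scaleR_conv_of_real inner_diff_left)
    then show "negligible_net (\<lambda>\<epsilon>. evalp F X \<phi> \<epsilon> - evalp F Y \<phi> \<epsilon>)"
      by (rule net_classD(2)[OF nn]) (use ev in \<open>eventually_elim, simp add: evalp_def\<close>)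
  qed
  show "fam_jsmooth \<Omega> F \<Longrightarrow> fam_growth moderate_net \<Omega> F \<Longrightarrow>
    growth negligible_net n (\<lambda>\<phi> \<epsilon>. evalp F X \<phi> \<epsilon> - evalp F Y \<phi> \<epsilon>)"
  proof (induction n arbitrary: F)
    case 0
    then show ?case by (rule base)
  next
    case (Suc n)
    have "growth negligible_net n (\<lambda>\<phi> \<epsilon>. sDir v (\<lambda>\<phi>. evalp F X \<phi> \<epsilon> - evalp F Y \<phi> \<epsilon>) \<phi>)" if v: "v \<in> S0" for v
    proof (rule growth_cong[OF nn])
      have vV: "v \<in> V" using v S0_sub by auto
      have sX: "fam_smooth X" and sY: "fam_smooth Y" using X Y by (auto simp: point_fam_def)
      define F0 where "F0 = (\<lambda>\<phi> \<epsilon>. Dir v (\<lambda>\<phi>. F \<phi> \<epsilon>) \<phi>)"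
      define F1 where "F1 = (\<lambda>i \<phi> \<epsilon>. pd i (\<lambda>\<phi>. F \<phi> \<epsilon>) \<phi>)"
      define dX where "dX = (\<lambda>i \<phi> \<epsilon>. sDir v (\<lambda>\<phi>. coord X i \<phi> \<epsilon>) \<phi>)"
      define dY where "dY = (\<lambda>i \<phi> \<epsilon>. sDir v (\<lambda>\<phi>. coord Y i \<phi> \<epsilon>) \<phi>)"
      have F0: "fam_jsmooth \<Omega> F0" "fam_growth moderate_net \<Omega> F0"
        unfolding F0_def
        by (rule fam_jsmooth_Dir[OF Suc.prems(1) vV]
              fam_growth_Dir[OF net_class_moderate Suc.prems(2,1) \<open>open \<Omega>\<close> v])+
      have F1: "fam_jsmooth \<Omega> (F1 i)" "i \<in> Basis \<Longrightarrow> fam_growth moderate_net \<Omega> (F1 i)" for i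
        unfolding F1_def
        by (rule fam_jsmooth_pd[OF Suc.prems(1) \<open>open \<Omega>\<close>] fam_growth_pd[OF Suc.prems(2)]; assumption?)+
      have sd: "fam_smooth (dX i)" "fam_smooth (dY i)" for i
        unfolding dX_def dY_def by (intro fam_smooth_sDir fam_smooth_coord sX sY vV)+
      have lX: "growth moderate_net n (dX i)" if "i \<in> Basis" for i
        using Xm[OF that, of "Suc n"] v by (simp add: growth_Suc dX_def)
      have lD: "growth negligible_net n (\<lambda>\<phi> \<epsilon>. dX i \<phi> \<epsilon> - dY i \<phi> \<epsilon>)" if i: "i \<in> Basis" for i
      proof (rule growth_cong[OF nn])
        show "growth negligible_net n (\<lambda>\<phi> \<epsilon>. sDir v (\<lambda>\<phi>. coord X i \<phi> \<epsilon> - coord Y i \<phi> \<epsilon>) \<phi>)"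
          using D[OF i, of "Suc n"] v by (simp add: growth_Suc)
        show "dX i \<phi> \<epsilon> - dY i \<phi> \<epsilon> = sDir v (\<lambda>\<phi>. coord X i \<phi> \<epsilon> - coord Y i \<phi> \<epsilon>) \<phi>"
          if "\<phi> \<in> V" "\<epsilon> \<in> eps_I" for \<phi> \<epsilon>
          unfolding dX_def dY_def
          using fam_smooth_coord[OF sX, of i] fam_smooth_coord[OF sY, of i] that vV
          by (intro sDir_diff[symmetric]) (auto simp: fam_smooth_def)
      qed
      have lY: "growth moderate_net n (evalp (F1 i) Y)" if "i \<in> Basis" for i
        by (rule growth_evalp[OF net_class_moderate \<open>open \<Omega>\<close> Y Ym KY F1(1) F1(2)[OF that]])
      have se: "fam_smooth (evalp G X)" "fam_smooth (evalp G Y)" if "fam_jsmooth \<Omega> G" for G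
        using that X Y by (auto intro: fam_smooth_evalp)
      note sm = fam_smooth_add fam_smooth_sum fam_smooth_mult fam_smooth_diff se F0(1) F1(1) sd
      \<comment> \<open>Regrouping \<open>A B - C D\<close> as \<open>(A - C) B + (B - D) C\<close>
        leaves in each product one negligible and one moderate factor.\<close>
      show "growth negligible_net n (\<lambda>\<phi> \<epsilon>. (evalp F0 X \<phi> \<epsilon> - evalp F0 Y \<phi> \<epsilon>) +
          (\<Sum>i\<in>Basis. (evalp (F1 i) X \<phi> \<epsilon> - evalp (F1 i) Y \<phi> \<epsilon>) * dX i \<phi> \<epsilon> +
            (dX i \<phi> \<epsilon> - dY i \<phi> \<epsilon>) * evalp (F1 i) Y \<phi> \<epsilon>))"
        by (intro growth_add[OF nn] growth_sum[OF nn] growth_mult[OF nn] Suc.IH sm F0 F1 lX lD lY finite_Basis)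
      fix \<phi> \<epsilon> assume \<phi>: "\<phi> \<in> V" and \<epsilon>: "\<epsilon> \<in> eps_I"
      have "sDir v (\<lambda>\<phi>. evalp F X \<phi> \<epsilon> - evalp F Y \<phi> \<epsilon>) \<phi> =
          sDir v (\<lambda>\<phi>. evalp F X \<phi> \<epsilon>) \<phi> - sDir v (\<lambda>\<phi>. evalp F Y \<phi> \<epsilon>) \<phi>"
        using se[OF Suc.prems(1)] \<phi> vV \<epsilon> by (intro sDir_diff) (auto simp: fam_smooth_def)
      also have "\<dots> = (evalp F0 X \<phi> \<epsilon> + (\<Sum>i\<in>Basis. evalp (F1 i) X \<phi> \<epsilon> * dX i \<phi> \<epsilon>)) -
          (evalp F0 Y \<phi> \<epsilon> + (\<Sum>i\<in>Basis. evalp (F1 i) Y \<phi> \<epsilon> * dY i \<phi> \<epsilon>))"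
        unfolding F0_def F1_def dX_def dY_def
        using sDir_evalp[OF Suc.prems(1) X \<open>open \<Omega>\<close> \<phi> vV \<epsilon>] sDir_evalp[OF Suc.prems(1) Y \<open>open \<Omega>\<close> \<phi> vV \<epsilon>]
        by simp
      also have "\<dots> = (evalp F0 X \<phi> \<epsilon> - evalp F0 Y \<phi> \<epsilon>) +
          (\<Sum>i\<in>Basis. (evalp (F1 i) X \<phi> \<epsilon> - evalp (F1 i) Y \<phi> \<epsilon>) * dX i \<phi> \<epsilon> +
            (dX i \<phi> \<epsilon> - dY i \<phi> \<epsilon>) * evalp (F1 i) Y \<phi> \<epsilon>)"
        by (simp add: sum.distrib sum_subtractf algebra_simps)
      finally show "sDir v (\<lambda>\<phi>. evalp F X \<phi> \<epsilon> - evalp F Y \<phi> \<epsilon>) \<phi> = \<dots>" .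
    qed
    with base[OF Suc.prems] show ?case
      by (simp add: growth_Suc)
  qed
qed

end

section \<open>Locally convex spaces given by seminorms\<close>

definition lin_subspace :: "'a::real_vector set \<Rightarrow> bool" where
  "lin_subspace V \<longleftrightarrow> 0 \<in> V \<and> (\<forall>x\<in>V. \<forall>y\<in>V. x + y \<in> V) \<and> (\<forall>r. \<forall>x\<in>V. r *\<^sub>R x \<in> V)"

lemma lin_subspaceD:
  assumes "lin_subspace V"
  shows "0 \<in> V" "x \<in> V \<Longrightarrow> y \<in> V \<Longrightarrow> x + y \<in> V" "x \<in> V \<Longrightarrow> r *\<^sub>R x \<in> V"
    "x \<in> V \<Longrightarrow> y \<in> V \<Longrightarrow> x - y \<in> V"
proof -
  show *: "0 \<in> V" "x \<in> V \<Longrightarrow> y \<in> V \<Longrightarrow> x + y \<in> V" "x \<in> V \<Longrightarrow> r *\<^sub>R x \<in> V" for x y r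
    using assms unfolding lin_subspace_def by auto
  show "x \<in> V \<Longrightarrow> y \<in> V \<Longrightarrow> x - y \<in> V"
    using *(2)[of x "(-1) *\<^sub>R y"] *(3)[of y "-1"] by simp
qed

definition lcs_wf :: "'a::real_vector lcs \<Rightarrow> bool" where
  "lcs_wf E \<longleftrightarrow> lin_subspace (carrier E) \<and> (\<forall>p\<in>gens E. seminorm_on (carrier E) p)"

text \<open>The Hausdorff property: limits are unique, so \<open>lcs_deriv\<close>, a definite
  description, equals any limit that has been found.\<close>

definition lcs_sep :: "'a::real_vector lcs \<Rightarrow> bool" where
  "lcs_sep E \<longleftrightarrow> (\<forall>x\<in>carrier E. (\<forall>p\<in>gens E. p x = 0) \<longrightarrow> x = 0)"

lemma lcs_wfD:
  assumes "lcs_wf E"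
  shows "lin_subspace (carrier E)" "p \<in> gens E \<Longrightarrow> seminorm_on (carrier E) p"
  using assms by (auto simp: lcs_wf_def)

lemma seminorm_onD:
  assumes p: "seminorm_on V p" and V: "lin_subspace V"
  shows "x \<in> V \<Longrightarrow> 0 \<le> p x" "x \<in> V \<Longrightarrow> y \<in> V \<Longrightarrow> p (x + y) \<le> p x + p y"
    "x \<in> V \<Longrightarrow> p (r *\<^sub>R x) = \<bar>r\<bar> * p x" "p 0 = 0"
    "x \<in> V \<Longrightarrow> y \<in> V \<Longrightarrow> z \<in> V \<Longrightarrow> p (x - z) \<le> p (x - y) + p (y - z)"
    "x \<in> V \<Longrightarrow> y \<in> V \<Longrightarrow> p (x - y) = p (y - x)"
proof -
  show *: "x \<in> V \<Longrightarrow> 0 \<le> p x" "x \<in> V \<Longrightarrow> y \<in> V \<Longrightarrow> p (x + y) \<le> p x + p y"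
    "x \<in> V \<Longrightarrow> p (r *\<^sub>R x) = \<bar>r\<bar> * p x" for x y r
    using p unfolding seminorm_on_def by auto
  show "p 0 = 0"
    using *(3)[of 0 0] lin_subspaceD(1)[OF V] by simp
  show "x \<in> V \<Longrightarrow> y \<in> V \<Longrightarrow> z \<in> V \<Longrightarrow> p (x - z) \<le> p (x - y) + p (y - z)"
    using *(2)[of "x - y" "y - z"] lin_subspaceD(4)[OF V] by simp
  show "x \<in> V \<Longrightarrow> y \<in> V \<Longrightarrow> p (x - y) = p (y - x)"
    using *(3)[of "y - x" "-1"] lin_subspaceD(4)[OF V] by simp
qed

text \<open>A subbasic ball need not be centred at \<open>l\<close>, but by the triangle inequality
  it leaves the room \<open>r - p (l - x)\<close> around \<open>l\<close>; intersections and unions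
  follow by induction over the generated topology.\<close>

lemma limitin_lcsI:
  assumes E: "lcs_wf E" and l: "l \<in> carrier E" and f: "\<forall>\<^sub>F h in F. f h \<in> carrier E"
    and lim: "\<And>p. p \<in> gens E \<Longrightarrow> ((\<lambda>h. p (f h - l)) \<longlongrightarrow> 0) F"
  shows "limitin (lcs_top E) f l F"
  unfolding limitin_def
proof (intro conjI allI impI, simp add: l, elim conjE)
  note V = lcs_wfD(1)[OF E]
  fix U assume "openin (lcs_top E) U" and lU: "l \<in> U"
  then have "generate_topology_on (insert (carrier E)
       {{y \<in> carrier E. p (y - x) < r} | p x r. p \<in> gens E \<and> x \<in> carrier E \<and> 0 < r}) U"
    by (simp add: lcs_top_def openin_topology_generated_by_iff)
  then show "\<forall>\<^sub>F h in F. f h \<in> U"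
    using lU
  proof (induction rule: generate_topology_on.induct)
    case (Int a b)
    then show ?case by (simp add: eventually_conj_iff)
  next
    case (UN K)
    then obtain k where "k \<in> K" "l \<in> k" by blast
    with UN have "\<forall>\<^sub>F h in F. f h \<in> k" by blast
    then show ?case
      by eventually_elim (use \<open>k \<in> K\<close> in blast)
  next
    case (Basis s)
    show ?case
    proof (cases "s = carrier E")
      case True
      then show ?thesis using f by simp
    next
      case False
      with Basis obtain p x r where s: "s = {y \<in> carrier E. p (y - x) < r}" "p \<in> gens E" "x \<in> carrier E"
        by blast
      note p = seminorm_onD[OF lcs_wfD(2)[OF E s(2)] V]
      have "p (l - x) < r"
        using Basis s by simp
      then have "\<forall>\<^sub>F h in F. p (f h - l) < r - p (l - x)"
        by (intro order_tendstoD(2)[OF lim[OF s(2)]]) simp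
      with f show ?thesis
      proof eventually_elim
        case (elim h)
        then show ?case
          using p(5)[of "f h" l x] l s by auto
      qed
    qed
  qed simp
qed

lemma openin_seminorm_ball:
  assumes "p \<in> gens E" "x \<in> carrier E" "0 < r"
  shows "openin (lcs_top E) {y \<in> carrier E. p (y - x) < r}"
  unfolding lcs_top_def by (rule topology_generated_by_Basis) (use assms in blast)

lemma limitin_lcsD:
  assumes E: "lcs_wf E" and lim: "limitin (lcs_top E) f l F"
  shows "l \<in> carrier E" "\<forall>\<^sub>F h in F. f h \<in> carrier E"
    "p \<in> gens E \<Longrightarrow> ((\<lambda>h. p (f h - l)) \<longlongrightarrow> 0) F"
proof -
  show l: "l \<in> carrier E"
    using lim by (auto simp: limitin_def)
  show f: "\<forall>\<^sub>F h in F. f h \<in> carrier E"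
    using lim openin_topspace[of "lcs_top E"] l unfolding limitin_def by auto
  assume p: "p \<in> gens E"
  note sp = seminorm_onD[OF lcs_wfD(2)[OF E p] lcs_wfD(1)[OF E]]
  show "((\<lambda>h. p (f h - l)) \<longlongrightarrow> 0) F"
  proof (rule tendstoI)
    fix e :: real assume "e > 0"
    then have "openin (lcs_top E) {y \<in> carrier E. p (y - l) < e}" "l \<in> {y \<in> carrier E. p (y - l) < e}"
      using openin_seminorm_ball[OF p l] sp(4) l by auto
    then have "\<forall>\<^sub>F h in F. f h \<in> {y \<in> carrier E. p (y - l) < e}"
      using lim unfolding limitin_def by blast
    then show "\<forall>\<^sub>F h in F. dist (p (f h - l)) 0 < e"
      by eventually_elim (use sp(1) lin_subspaceD(4)[OF lcs_wfD(1)[OF E]] l in auto)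
  qed
qed

text \<open>Powers and growth conditions quantify over all continuous seminorms; this gives access
  to the explicit generating ones.\<close>

lemma gens_subset_csn:
  assumes E: "lcs_wf E"
  shows "gens E \<subseteq> csn E"
proof
  fix p assume p: "p \<in> gens E"
  note sp = seminorm_onD[OF lcs_wfD(2)[OF E p] lcs_wfD(1)[OF E]]
  have "continuous_map (lcs_top E) euclideanreal p"
    unfolding continuous_map_def
  proof (intro conjI allI impI)
    fix U assume "openin euclideanreal U"
    then have U: "open U" by simp
    show "openin (lcs_top E) {x \<in> topspace (lcs_top E). p x \<in> U}"
    proof (subst openin_subopen, intro ballI)
      fix x assume x: "x \<in> {x \<in> topspace (lcs_top E). p x \<in> U}"
      then obtain e where e: "e > 0" "ball (p x) e \<subseteq> U"
        using U openE by blast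
      have "p y \<in> U" if y: "y \<in> carrier E" "p (y - x) < e" for y
      proof -
        have "p y \<le> p (y - x) + p x" "p x \<le> p (x - y) + p y"
          using sp(5)[of y x 0] sp(5)[of x y 0] x y lin_subspaceD(1)[OF lcs_wfD(1)[OF E]] by auto
        then have "dist (p x) (p y) < e"
          using y sp(6)[of x y] x by (auto simp: dist_real_def)
        then show ?thesis using e by auto
      qed
      then show "\<exists>T. openin (lcs_top E) T \<and> x \<in> T \<and> T \<subseteq> {x \<in> topspace (lcs_top E). p x \<in> U}"
        using x e(1) sp(4) by (intro exI[of _ "{y \<in> carrier E. p (y - x) < e}"]) (auto intro: openin_seminorm_ball[OF p])
    qed
  qed simp
  then show "p \<in> csn E"
    using lcs_wfD(2)[OF E p] by (simp add: csn_def)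
qed

text \<open>The generators of \<open>lcs_power F\<close> arise from all of \<open>csn F\<close>, so
  convergence known for the generators of \<open>F\<close> has to be passed on to every continuous
  seminorm.\<close>

lemma limitin_lcs_csn:
  assumes E: "lcs_wf E" and lim: "limitin (lcs_top E) f l F" and q: "q \<in> csn E"
  shows "((\<lambda>h. q (f h - l)) \<longlongrightarrow> 0) F"
proof -
  note V = lcs_wfD(1)[OF E]
  have "limitin (lcs_top E) (\<lambda>h. f h - l) 0 F"
  proof (rule limitin_lcsI[OF E])
    show "\<forall>\<^sub>F h in F. f h - l \<in> carrier E"
      using limitin_lcsD(2)[OF E lim] by eventually_elim (intro lin_subspaceD(4)[OF V] limitin_lcsD(1)[OF E lim])
  qed (use limitin_lcsD[OF E lim] lin_subspaceD(1)[OF V] in auto)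
  moreover have "continuous_map (lcs_top E) euclideanreal q" "q 0 = 0"
    using q V seminorm_onD(4) by (auto simp: csn_def)
  ultimately show ?thesis
    using continuous_map_limit[of "lcs_top E" euclideanreal q "\<lambda>h. f h - l" 0 F] by (simp add: o_def)
qed

lemma limitin_lcs_unique:
  assumes E: "lcs_wf E" "lcs_sep E" and lim: "limitin (lcs_top E) f l F" "limitin (lcs_top E) f l' F"
    and F: "F \<noteq> bot"
  shows "l = l'"
proof -
  note V = lcs_wfD(1)[OF E(1)]
  have ll: "l \<in> carrier E" "l' \<in> carrier E"
    using limitin_lcsD(1)[OF E(1)] lim by auto
  have "p (l - l') = 0" if p: "p \<in> gens E" for p
  proof -
    note sp = seminorm_onD[OF lcs_wfD(2)[OF E(1) p] V]
    have "((\<lambda>h. p (f h - l) + p (f h - l')) \<longlongrightarrow> 0 + 0) F"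
      by (intro tendsto_add limitin_lcsD(3)[OF E(1) _ p] lim)
    moreover have "\<forall>\<^sub>F h in F. p (l - l') \<le> p (f h - l) + p (f h - l')"
      using limitin_lcsD(2)[OF E(1) lim(1)]
      by eventually_elim (use sp(5)[of l _ l'] sp(6)[of l] ll in fastforce)
    ultimately have "p (l - l') \<le> 0 + 0"
      by (rule tendsto_lowerbound[OF _ _ F])
    then show ?thesis
      using sp(1)[of "l - l'"] lin_subspaceD(4)[OF V] ll by force
  qed
  then show ?thesis
    using E(2) lin_subspaceD(4)[OF V ll] by (auto simp: lcs_sep_def)
qed

section \<open>Derivatives and smooth curves in locally convex spaces\<close>

lemma lcs_deriv_eq:
  assumes "lcs_wf E" "lcs_sep E" "lcs_has_deriv E c l t"
  shows "lcs_deriv E c t = l"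
  unfolding lcs_deriv_def
  by (rule the_equality[of "\<lambda>l. lcs_has_deriv E c l t", OF assms(3)])
     (use limitin_lcs_unique[OF assms(1,2) _ _ at_neq_bot] assms(3) in \<open>unfold lcs_has_deriv_def, blast\<close>)

lemma lcs_has_deriv_add:
  assumes E: "lcs_wf E" and c: "lcs_has_deriv E c l t" and d: "lcs_has_deriv E d m t"
  shows "lcs_has_deriv E (\<lambda>t. c t + d t) (l + m) t"
  unfolding lcs_has_deriv_def
proof (rule limitin_lcsI[OF E])
  note V = lcs_wfD(1)[OF E]
  note C = limitin_lcsD[OF E c[unfolded lcs_has_deriv_def]]
  note D = limitin_lcsD[OF E d[unfolded lcs_has_deriv_def]]
  show "l + m \<in> carrier E"
    by (intro lin_subspaceD(2)[OF V] C D)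
  have eq: "inverse h *\<^sub>R (c (t + h) + d (t + h) - (c t + d t)) =
      inverse h *\<^sub>R (c (t + h) - c t) + inverse h *\<^sub>R (d (t + h) - d t)" for h
    by (simp add: scaleR_add_right[symmetric])
  show "\<forall>\<^sub>F h in at 0. inverse h *\<^sub>R (c (t + h) + d (t + h) - (c t + d t)) \<in> carrier E"
    unfolding eq using C(2) D(2) by eventually_elim (rule lin_subspaceD(2)[OF V])
  fix p assume p: "p \<in> gens E"
  note sp = seminorm_onD[OF lcs_wfD(2)[OF E p] V]
  have L: "((\<lambda>h. p (inverse h *\<^sub>R (c (t + h) - c t) - l) + p (inverse h *\<^sub>R (d (t + h) - d t) - m)) \<longlongrightarrow> 0 + 0) (at 0)"
    by (intro tendsto_add C D p)
  have N: "\<forall>\<^sub>F h in at 0. norm (p (inverse h *\<^sub>R (c (t + h) + d (t + h) - (c t + d t)) - (l + m))) \<le>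
      p (inverse h *\<^sub>R (c (t + h) - c t) - l) + p (inverse h *\<^sub>R (d (t + h) - d t) - m)"
    using C(2) D(2)
  proof eventually_elim
    case (elim h)
    let ?A = "inverse h *\<^sub>R (c (t + h) - c t) - l" and ?B = "inverse h *\<^sub>R (d (t + h) - d t) - m"
    have "?A \<in> carrier E" "?B \<in> carrier E"
      using elim C(1) D(1) by (auto intro: lin_subspaceD(4)[OF V])
    then have "p (?A + ?B) \<le> p ?A + p ?B" "0 \<le> p (?A + ?B)"
      using sp(1,2) lin_subspaceD(2)[OF V] by auto
    moreover have e: "inverse h *\<^sub>R (c (t + h) + d (t + h) - (c t + d t)) - (l + m) = ?A + ?B"
      unfolding eq by (rule add_diff_add)
    ultimately show ?case
      unfolding e by simp
  qed
  show "((\<lambda>h. p (inverse h *\<^sub>R (c (t + h) + d (t + h) - (c t + d t)) - (l + m))) \<longlongrightarrow> 0) (at 0)"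
    by (rule Lim_null_comparison[OF N]) (use L in simp)
qed

lemma lcs_has_deriv_scaleR:
  assumes E: "lcs_wf E" and c: "lcs_has_deriv E c l t"
  shows "lcs_has_deriv E (\<lambda>t. r *\<^sub>R c t) (r *\<^sub>R l) t"
  unfolding lcs_has_deriv_def
proof (rule limitin_lcsI[OF E])
  note V = lcs_wfD(1)[OF E]
  note C = limitin_lcsD[OF E c[unfolded lcs_has_deriv_def]]
  show "r *\<^sub>R l \<in> carrier E"
    by (intro lin_subspaceD(3)[OF V] C)
  have eq: "inverse h *\<^sub>R (r *\<^sub>R c (t + h) - r *\<^sub>R c t) = r *\<^sub>R (inverse h *\<^sub>R (c (t + h) - c t))" for h
    by (simp add: scaleR_diff_right mult.commute)
  show "\<forall>\<^sub>F h in at 0. inverse h *\<^sub>R (r *\<^sub>R c (t + h) - r *\<^sub>R c t) \<in> carrier E"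
    unfolding eq using C(2) by eventually_elim (rule lin_subspaceD(3)[OF V])
  fix p assume p: "p \<in> gens E"
  note sp = seminorm_onD[OF lcs_wfD(2)[OF E p] V]
  have "((\<lambda>h. \<bar>r\<bar> * p (inverse h *\<^sub>R (c (t + h) - c t) - l)) \<longlongrightarrow> \<bar>r\<bar> * 0) (at 0)"
    by (intro tendsto_mult tendsto_const C p)
  moreover have "\<forall>\<^sub>F h in at 0. \<bar>r\<bar> * p (inverse h *\<^sub>R (c (t + h) - c t) - l) =
      p (inverse h *\<^sub>R (r *\<^sub>R c (t + h) - r *\<^sub>R c t) - r *\<^sub>R l)"
    unfolding eq using C(2)
  proof eventually_elim
    case (elim h)
    show ?case
      using sp(3)[OF lin_subspaceD(4)[OF V elim C(1)], of r] by (simp only: scaleR_diff_right)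
  qed
  ultimately show "((\<lambda>h. p (inverse h *\<^sub>R (r *\<^sub>R c (t + h) - r *\<^sub>R c t) - r *\<^sub>R l)) \<longlongrightarrow> 0) (at 0)"
    using Lim_transform_eventually by fastforce
qed

lemma lcs_has_deriv_scaleR_left:
  assumes E: "lcs_wf E" and v: "v \<in> carrier E" and b: "(b has_vector_derivative b') (at t)"
  shows "lcs_has_deriv E (\<lambda>t. b t *\<^sub>R v) (b' *\<^sub>R v) t"
  unfolding lcs_has_deriv_def
proof (rule limitin_lcsI[OF E])
  note V = lcs_wfD(1)[OF E]
  show "b' *\<^sub>R v \<in> carrier E"
    by (intro lin_subspaceD(3)[OF V] v)
  show "\<forall>\<^sub>F h in at 0. inverse h *\<^sub>R (b (t + h) *\<^sub>R v - b t *\<^sub>R v) \<in> carrier E"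
    by (intro always_eventually allI lin_subspaceD(3,4)[OF V] v)
  fix p assume p: "p \<in> gens E"
  note sp = seminorm_onD[OF lcs_wfD(2)[OF E p] V]
  have "((\<lambda>h. inverse h *\<^sub>R (b (t + h) - b t) - b') \<longlongrightarrow> 0) (at 0)"
    using b unfolding has_vector_derivative_quotient by (rule LIM_zero)
  then have "((\<lambda>h. \<bar>inverse h *\<^sub>R (b (t + h) - b t) - b'\<bar> * p v) \<longlongrightarrow> 0 * p v) (at 0)"
    by (intro tendsto_mult tendsto_const tendsto_rabs_zero)
  moreover have "p (inverse h *\<^sub>R (b (t + h) *\<^sub>R v - b t *\<^sub>R v) - b' *\<^sub>R v) = \<bar>inverse h *\<^sub>R (b (t + h) - b t) - b'\<bar> * p v" for h
    using sp(3)[OF v, of "inverse h *\<^sub>R (b (t + h) - b t) - b'"] by (simp add: algebra_simps)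
  ultimately show "((\<lambda>h. p (inverse h *\<^sub>R (b (t + h) *\<^sub>R v - b t *\<^sub>R v) - b' *\<^sub>R v)) \<longlongrightarrow> 0) (at 0)"
    by simp
qed

lemma smooth_curveE:
  assumes "smooth_curve E c"
  obtains C where "C 0 = c" "\<And>k t. C k t \<in> carrier E" "\<And>k t. lcs_has_deriv E (C k) (C (Suc k) t) t"
  using assms unfolding smooth_curve_def by blast

lemma smooth_curveI:
  "C 0 = c \<Longrightarrow> (\<And>k t. C k t \<in> carrier E) \<Longrightarrow> (\<And>k t. lcs_has_deriv E (C k) (C (Suc k) t) t) \<Longrightarrow> smooth_curve E c"
  unfolding smooth_curve_def by blast

lemma smooth_curve_add:
  assumes E: "lcs_wf E" and "smooth_curve E c" "smooth_curve E d"
  shows "smooth_curve E (\<lambda>t. c t + d t)"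
proof -
  obtain C where C: "C 0 = c" "\<And>k t. C k t \<in> carrier E" "\<And>k t. lcs_has_deriv E (C k) (C (Suc k) t) t"
    using smooth_curveE[OF assms(2)] by metis
  obtain D where D: "D 0 = d" "\<And>k t. D k t \<in> carrier E" "\<And>k t. lcs_has_deriv E (D k) (D (Suc k) t) t"
    using smooth_curveE[OF assms(3)] by metis
  show ?thesis
    by (rule smooth_curveI[of "\<lambda>k t. C k t + D k t"])
       (auto simp: C D intro: lcs_has_deriv_add[OF E] lin_subspaceD(2)[OF lcs_wfD(1)[OF E]])
qed

lemma smooth_curve_scaleR:
  assumes E: "lcs_wf E" and "smooth_curve E c"
  shows "smooth_curve E (\<lambda>t. r *\<^sub>R c t)"
proof -
  obtain C where C: "C 0 = c" "\<And>k t. C k t \<in> carrier E" "\<And>k t. lcs_has_deriv E (C k) (C (Suc k) t) t"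
    using smooth_curveE[OF assms(2)] by metis
  show ?thesis
    by (rule smooth_curveI[of "\<lambda>k t. r *\<^sub>R C k t"])
       (auto simp: C intro: lcs_has_deriv_scaleR[OF E] lin_subspaceD(3)[OF lcs_wfD(1)[OF E]])
qed

lemma smooth_curve_scaleR_left:
  assumes E: "lcs_wf E" and "v \<in> carrier E" "smooth b"
  shows "smooth_curve E (\<lambda>t. b t *\<^sub>R v)"
  by (rule smooth_curveI[of "\<lambda>k t. (vd ^^ k) b t *\<^sub>R v"])
     (auto intro!: lcs_has_deriv_scaleR_left[OF E] smooth_vd(1) smooth_funpow lin_subspaceD(3)[OF lcs_wfD(1)[OF E]] assms)

lemma smooth_curve_zero: "lcs_wf E \<Longrightarrow> smooth_curve E (\<lambda>t. 0)"
  using smooth_curve_scaleR_left[of E 0 "\<lambda>t. 0"] smooth_const lin_subspaceD(1)[OF lcs_wfD(1)] by auto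

lemma smooth_space_subspace:
  assumes F: "lcs_wf F"
  shows "lin_subspace (carrier (smooth_space E U F))"
  unfolding lin_subspace_def smooth_space_def smooth_map_def
  using smooth_curve_zero[OF F] smooth_curve_add[OF F] smooth_curve_scaleR[OF F]
  by (auto simp: o_def scaleR_fun_def)

lemma normed_lcs_wf: "lcs_wf normed_lcs"
  unfolding lcs_wf_def by (auto simp: normed_lcs_def lin_subspace_def seminorm_on_def norm_triangle_ineq)

lemma normed_lcs_sep: "lcs_sep normed_lcs"
  unfolding lcs_sep_def by (simp add: normed_lcs_def)

lemma lcs_has_deriv_normed: "lcs_has_deriv normed_lcs c l t \<longleftrightarrow> (c has_vector_derivative l) (at t)"
proof -
  have "limitin (lcs_top normed_lcs) f l F \<longleftrightarrow> ((\<lambda>h. norm (f h - l)) \<longlongrightarrow> 0) F" for f and l :: 'a and F :: "real filter"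
    using limitin_lcsI[OF normed_lcs_wf, of l f F] limitin_lcsD(3)[OF normed_lcs_wf, of f l F norm]
    by (auto simp: normed_lcs_def)
  then show ?thesis
    unfolding lcs_has_deriv_def has_vector_derivative_quotient by (simp add: tendsto_norm_zero_iff LIM_zero_iff)
qed

lemma smooth_curve_normed: "smooth_curve normed_lcs c \<longleftrightarrow> smooth c"
proof
  assume "smooth_curve normed_lcs c"
  then obtain C where C: "C 0 = c" "\<And>k t. (C k has_vector_derivative C (Suc k) t) (at t)"
    unfolding smooth_curve_def lcs_has_deriv_normed by blast
  have "times_diff n (C k)" for n k
    by (induction n arbitrary: k) (use C(2) in auto)
  then show "smooth c"
    using C(1) unfolding smooth_def by blast
next
  assume "smooth c"
  then show "smooth_curve normed_lcs c"
    by (intro smooth_curveI[of "\<lambda>k. (vd ^^ k) c"])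
       (auto simp: lcs_has_deriv_normed intro: smooth_vd(1) smooth_funpow, simp add: normed_lcs_def)
qed

section \<open>Powers\<close>

lemma carrier_power:
  "f \<in> carrier (lcs_power F) \<longleftrightarrow> (\<forall>\<epsilon>\<in>eps_I. f \<epsilon> \<in> carrier F) \<and> (\<forall>\<epsilon>. \<epsilon> \<notin> eps_I \<longrightarrow> f \<epsilon> = 0)"
  by (simp add: lcs_power_def)

text \<open>The seminorm property of the generators is built into \<open>csn F\<close>, so a linear
  carrier of \<open>F\<close> is the whole input; in this form the lemma applies directly to
  \<open>SK\<close>.\<close>

lemma power_wf:
  assumes "lin_subspace (carrier F)"
  shows "lcs_wf (lcs_power F)"
proof -
  have "lin_subspace (carrier (lcs_power F))"
    unfolding lin_subspace_def
    using lin_subspaceD[OF assms] by (auto simp: scaleR_fun_def carrier_power)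
  moreover have "seminorm_on (carrier (lcs_power F)) (\<lambda>f. p (f \<epsilon>))" if "p \<in> csn F" "\<epsilon> \<in> eps_I" for p \<epsilon>
    using that unfolding seminorm_on_def csn_def by (auto simp: scaleR_fun_def carrier_power)
  ultimately show ?thesis
    unfolding lcs_wf_def by (auto simp: lcs_power_def)
qed

lemma power_sep:
  assumes "lcs_wf F" "lcs_sep F"
  shows "lcs_sep (lcs_power F)"
  unfolding lcs_sep_def
proof (intro ballI impI ext)
  fix f \<epsilon> assume f: "f \<in> carrier (lcs_power F)" "\<forall>p\<in>gens (lcs_power F). p f = 0"
  show "f \<epsilon> = 0 \<epsilon>"
  proof (cases "\<epsilon> \<in> eps_I")
    case True
    have "p (f \<epsilon>) = 0" if "p \<in> gens F" for p
    proof -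
      have "(\<lambda>f. p (f \<epsilon>)) \<in> gens (lcs_power F)"
        using gens_subset_csn[OF assms(1)] that True by (auto simp: lcs_power_def)
      with f(2) show ?thesis by auto
    qed
    then show ?thesis
      using assms(2) f(1) True by (auto simp: lcs_sep_def carrier_power)
  qed (use f(1) in \<open>simp add: carrier_power\<close>)
qed

lemma lcs_has_deriv_powerI:
  assumes F: "lcs_wf F" and c: "\<And>t. c t \<in> carrier (lcs_power F)" and l: "\<And>\<epsilon>. \<epsilon> \<notin> eps_I \<Longrightarrow> l \<epsilon> = 0"
    and d: "\<And>\<epsilon>. \<epsilon> \<in> eps_I \<Longrightarrow> lcs_has_deriv F (\<lambda>t. c t \<epsilon>) (l \<epsilon>) t"
  shows "lcs_has_deriv (lcs_power F) c l t"
  unfolding lcs_has_deriv_def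
proof (rule limitin_lcsI[OF power_wf[OF lcs_wfD(1)[OF F]]])
  note VP = lcs_wfD(1)[OF power_wf[OF lcs_wfD(1)[OF F]]]
  show "l \<in> carrier (lcs_power F)"
    using l limitin_lcsD(1)[OF F d[unfolded lcs_has_deriv_def]] by (auto simp: carrier_power)
  show "\<forall>\<^sub>F h in at 0. inverse h *\<^sub>R (c (t + h) - c t) \<in> carrier (lcs_power F)"
    by (intro always_eventually allI lin_subspaceD(3,4)[OF VP] c)
  fix q assume "q \<in> gens (lcs_power F)"
  then obtain p \<epsilon> where q: "q = (\<lambda>f. p (f \<epsilon>))" "p \<in> csn F" "\<epsilon> \<in> eps_I"
    by (auto simp: lcs_power_def)
  show "((\<lambda>h. q (inverse h *\<^sub>R (c (t + h) - c t) - l)) \<longlongrightarrow> 0) (at 0)"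
    using limitin_lcs_csn[OF F d[OF q(3), unfolded lcs_has_deriv_def] q(2)]
    by (simp add: q(1) scaleR_fun_def)
qed

lemma lcs_has_deriv_powerD:
  assumes F: "lcs_wf F" and d: "lcs_has_deriv (lcs_power F) c l t" and c: "\<And>t. c t \<in> carrier (lcs_power F)"
    and \<epsilon>: "\<epsilon> \<in> eps_I"
  shows "lcs_has_deriv F (\<lambda>t. c t \<epsilon>) (l \<epsilon>) t"
  unfolding lcs_has_deriv_def
proof (rule limitin_lcsI[OF F])
  note PW = power_wf[OF lcs_wfD(1)[OF F]]
  note D = limitin_lcsD[OF PW d[unfolded lcs_has_deriv_def]]
  show "l \<epsilon> \<in> carrier F"
    using D(1) \<epsilon> by (simp add: carrier_power)
  have "c t \<epsilon> \<in> carrier F" for t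
    using c \<epsilon> by (simp add: carrier_power)
  then show "\<forall>\<^sub>F h in at 0. inverse h *\<^sub>R (c (t + h) \<epsilon> - c t \<epsilon>) \<in> carrier F"
    by (intro always_eventually allI lin_subspaceD(3,4)[OF lcs_wfD(1)[OF F]])
  fix p assume "p \<in> gens F"
  then have "(\<lambda>f. p (f \<epsilon>)) \<in> gens (lcs_power F)"
    using gens_subset_csn[OF F] \<epsilon> by (auto simp: lcs_power_def)
  from D(3)[OF this] show "((\<lambda>h. p (inverse h *\<^sub>R (c (t + h) \<epsilon> - c t \<epsilon>) - l \<epsilon>)) \<longlongrightarrow> 0) (at 0)"
    by (simp add: scaleR_fun_def)
qed

lemma smooth_curve_power:
  assumes F: "lcs_wf F"
  shows "smooth_curve (lcs_power F) c \<longleftrightarrow>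
    (\<forall>\<epsilon>\<in>eps_I. smooth_curve F (\<lambda>t. c t \<epsilon>)) \<and> (\<forall>t \<epsilon>. \<epsilon> \<notin> eps_I \<longrightarrow> c t \<epsilon> = 0)"
proof (intro iffI conjI ballI allI impI)
  assume "smooth_curve (lcs_power F) c"
  then obtain C where C: "C 0 = c" "\<And>k t. C k t \<in> carrier (lcs_power F)"
    "\<And>k t. lcs_has_deriv (lcs_power F) (C k) (C (Suc k) t) t"
    using smooth_curveE[of "lcs_power F" c] by metis
  show "smooth_curve F (\<lambda>t. c t \<epsilon>)" if \<epsilon>: "\<epsilon> \<in> eps_I" for \<epsilon>
    by (rule smooth_curveI[of "\<lambda>k t. C k t \<epsilon>"])
       (use C \<epsilon> in \<open>auto simp: carrier_power intro: lcs_has_deriv_powerD[OF F]\<close>)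
  show "c t \<epsilon> = 0" if "\<epsilon> \<notin> eps_I" for t \<epsilon>
    using C(1) C(2)[of 0 t] that by (simp add: carrier_power)
next
  assume c: "(\<forall>\<epsilon>\<in>eps_I. smooth_curve F (\<lambda>t. c t \<epsilon>)) \<and> (\<forall>t \<epsilon>. \<epsilon> \<notin> eps_I \<longrightarrow> c t \<epsilon> = 0)"
  then have "\<forall>\<epsilon>\<in>eps_I. \<exists>C. C 0 = (\<lambda>t. c t \<epsilon>) \<and> (\<forall>k t. C k t \<in> carrier F \<and> lcs_has_deriv F (C k) (C (Suc k) t) t)"
    unfolding smooth_curve_def by blast
  from bchoice[OF this] obtain C where C: "\<And>\<epsilon>. \<epsilon> \<in> eps_I \<Longrightarrow> C \<epsilon> 0 = (\<lambda>t. c t \<epsilon>)"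
    "\<And>\<epsilon> k t. \<epsilon> \<in> eps_I \<Longrightarrow> C \<epsilon> k t \<in> carrier F"
    "\<And>\<epsilon> k t. \<epsilon> \<in> eps_I \<Longrightarrow> lcs_has_deriv F (C \<epsilon> k) (C \<epsilon> (Suc k) t) t"
    by blast
  \<comment> \<open>The derivative sequences chosen for the components, extended by 0 off
    \<open>eps_I\<close> to stay in the carrier of the power.\<close>
  define D where "D = (\<lambda>k t \<epsilon>. if \<epsilon> \<in> eps_I then C \<epsilon> k t else 0)"
  have Dc: "D k t \<in> carrier (lcs_power F)" for k t
    using C(2) by (simp add: carrier_power D_def)
  show "smooth_curve (lcs_power F) c"
  proof (rule smooth_curveI[of D])
    show "D 0 = c"
      using C(1) c by (auto simp: D_def fun_eq_iff)
    show "lcs_has_deriv (lcs_power F) (D k) (D (Suc k) t) t" for k t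
      by (rule lcs_has_deriv_powerI[OF F Dc]) (use C(3) in \<open>simp_all add: D_def\<close>)
  qed (rule Dc)
qed

section \<open>The space of smooth functions\<close>

definition Csmooth :: "'a::euclidean_space set \<Rightarrow> ('a \<Rightarrow> 'b::real_normed_vector) \<Rightarrow> bool" where
  "Csmooth \<Omega> f \<longleftrightarrow> (\<forall>k. times_differentiable_on k \<Omega> f)"

lemma frechet_derivative_cong_open:
  assumes "open \<Omega>" "x \<in> \<Omega>" "\<And>y. y \<in> \<Omega> \<Longrightarrow> f y = g y"
  shows "frechet_derivative f (at x) = frechet_derivative g (at x)"
    and "f differentiable (at x) \<longleftrightarrow> g differentiable (at x)"
proof -
  have "(f has_derivative f') (at x) \<longleftrightarrow> (g has_derivative f') (at x)" for f'
    using assms has_derivative_transform_within_open[of f f' x UNIV \<Omega> g]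
      has_derivative_transform_within_open[of g f' x UNIV \<Omega> f] by auto
  then show "frechet_derivative f (at x) = frechet_derivative g (at x)"
    "f differentiable (at x) \<longleftrightarrow> g differentiable (at x)"
    by (simp_all add: frechet_derivative_def differentiable_def)
qed

lemma times_differentiable_on_cong:
  assumes "open \<Omega>"
  shows "(\<And>y. y \<in> \<Omega> \<Longrightarrow> f y = g y) \<Longrightarrow> times_differentiable_on k \<Omega> f \<Longrightarrow> times_differentiable_on k \<Omega> g"
proof (induction k arbitrary: f g)
  case 0
  then show ?case
    using continuous_on_cong[of \<Omega> \<Omega> f g] by simp
next
  case (Suc k)
  have "times_differentiable_on k \<Omega> (\<lambda>x. frechet_derivative g (at x) v)" for v
  proof (rule Suc.IH)
    show "times_differentiable_on k \<Omega> (\<lambda>x. frechet_derivative f (at x) v)"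
      using Suc.prems(2) by simp
    show "frechet_derivative f (at y) v = frechet_derivative g (at y) v" if "y \<in> \<Omega>" for y
      using frechet_derivative_cong_open(1)[OF assms that Suc.prems(1)] by simp
  qed
  then show ?case
    using Suc.prems(2) frechet_derivative_cong_open(2)[OF assms _ Suc.prems(1)] by auto
qed

lemma times_differentiable_on_add:
  assumes "open \<Omega>"
  shows "times_differentiable_on k \<Omega> f \<Longrightarrow> times_differentiable_on k \<Omega> g \<Longrightarrow> times_differentiable_on k \<Omega> (\<lambda>x. f x + g x)"
proof (induction k arbitrary: f g)
  case (Suc k)
  have D: "((\<lambda>x. f x + g x) has_derivative (\<lambda>v. frechet_derivative f (at x) v + frechet_derivative g (at x) v)) (at x)"
    if "x \<in> \<Omega>" for x
    using Suc.prems that by (intro has_derivative_add) (auto simp: frechet_derivative_works)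
  have "times_differentiable_on k \<Omega> (\<lambda>x. frechet_derivative (\<lambda>x. f x + g x) (at x) v)" for v
  proof (rule times_differentiable_on_cong[OF assms])
    show "times_differentiable_on k \<Omega> (\<lambda>x. frechet_derivative f (at x) v + frechet_derivative g (at x) v)"
      using Suc by auto
    show "frechet_derivative f (at x) v + frechet_derivative g (at x) v = frechet_derivative (\<lambda>x. f x + g x) (at x) v"
      if "x \<in> \<Omega>" for x
      by (rule fun_cong[OF frechet_derivative_at[OF D[OF that]]])
  qed
  then show ?case
    using D by (auto simp: differentiable_def)
qed (simp add: continuous_on_add)

lemma times_differentiable_on_scaleR:
  assumes "open \<Omega>"
  shows "times_differentiable_on k \<Omega> f \<Longrightarrow> times_differentiable_on k \<Omega> (\<lambda>x. r *\<^sub>R f x)"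
proof (induction k arbitrary: f)
  case (Suc k)
  have D: "((\<lambda>x. r *\<^sub>R f x) has_derivative (\<lambda>v. r *\<^sub>R frechet_derivative f (at x) v)) (at x)"
    if "x \<in> \<Omega>" for x
    using Suc.prems that by (intro has_derivative_scaleR_right) (auto simp: frechet_derivative_works)
  have "times_differentiable_on k \<Omega> (\<lambda>x. frechet_derivative (\<lambda>x. r *\<^sub>R f x) (at x) v)" for v
  proof (rule times_differentiable_on_cong[OF assms])
    show "times_differentiable_on k \<Omega> (\<lambda>x. r *\<^sub>R frechet_derivative f (at x) v)"
      using Suc by auto
    show "r *\<^sub>R frechet_derivative f (at x) v = frechet_derivative (\<lambda>x. r *\<^sub>R f x) (at x) v"
      if "x \<in> \<Omega>" for x
      by (rule fun_cong[OF frechet_derivative_at[OF D[OF that]]])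
  qed
  then show ?case
    using D by (auto simp: differentiable_def)
qed (simp add: continuous_on_scaleR)

lemma times_differentiable_on_zero: "times_differentiable_on k \<Omega> (\<lambda>x. 0)"
  by (induction k) auto

lemma Csmooth_has_derivative:
  assumes "Csmooth \<Omega> f" "x \<in> \<Omega>"
  shows "(f has_derivative frechet_derivative f (at x)) (at x)"
  using assms unfolding Csmooth_def frechet_derivative_works[symmetric]
  by (metis times_differentiable_on.simps(2))

lemma Csmooth_frechet: "Csmooth \<Omega> f \<Longrightarrow> Csmooth \<Omega> (\<lambda>x. frechet_derivative f (at x) v)"
  unfolding Csmooth_def by (metis times_differentiable_on.simps(2))

lemma Csmooth_continuous: "Csmooth \<Omega> f \<Longrightarrow> continuous_on \<Omega> f"
  unfolding Csmooth_def by (metis times_differentiable_on.simps(1))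

lemma Csmooth_partial_deriv: "Csmooth \<Omega> f \<Longrightarrow> Csmooth \<Omega> (partial_deriv vs f)"
  by (induction vs) (auto intro: Csmooth_frechet)

lemma Csmooth_ops:
  assumes "open \<Omega>"
  shows "Csmooth \<Omega> f \<Longrightarrow> Csmooth \<Omega> g \<Longrightarrow> Csmooth \<Omega> (\<lambda>x. f x + g x)"
    "Csmooth \<Omega> f \<Longrightarrow> Csmooth \<Omega> (\<lambda>x. r *\<^sub>R f x)"
  unfolding Csmooth_def
  using times_differentiable_on_add[OF assms] times_differentiable_on_scaleR[OF assms] by blast+

lemma partial_deriv_add:
  assumes "open \<Omega>" "Csmooth \<Omega> f" "Csmooth \<Omega> g"
  shows "x \<in> \<Omega> \<Longrightarrow> partial_deriv vs (\<lambda>x. f x + g x) x = partial_deriv vs f x + partial_deriv vs g x"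
proof (induction vs arbitrary: x)
  case (Cons v vs)
  have "((\<lambda>x. partial_deriv vs f x + partial_deriv vs g x) has_derivative
      (\<lambda>v. frechet_derivative (partial_deriv vs f) (at x) v + frechet_derivative (partial_deriv vs g) (at x) v)) (at x)"
    by (intro has_derivative_add Csmooth_has_derivative[OF Csmooth_partial_deriv Cons.prems] assms)
  from frechet_derivative_at[OF this] show ?case
    using frechet_derivative_cong_open(1)[OF assms(1) Cons.prems Cons.IH] by (simp add: fun_eq_iff)
qed simp

lemma partial_deriv_scaleR:
  assumes "open \<Omega>" "Csmooth \<Omega> f"
  shows "x \<in> \<Omega> \<Longrightarrow> partial_deriv vs (\<lambda>x. r *\<^sub>R f x) x = r *\<^sub>R partial_deriv vs f x"
proof (induction vs arbitrary: x)
  case (Cons v vs)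
  have "((\<lambda>x. r *\<^sub>R partial_deriv vs f x) has_derivative
      (\<lambda>v. r *\<^sub>R frechet_derivative (partial_deriv vs f) (at x) v)) (at x)"
    by (intro has_derivative_scaleR_right Csmooth_has_derivative[OF Csmooth_partial_deriv Cons.prems] assms)
  from frechet_derivative_at[OF this] show ?case
    using frechet_derivative_cong_open(1)[OF assms(1) Cons.prems Cons.IH] by (simp add: fun_eq_iff)
qed simp

section \<open>The locally convex structure of \<open>Cinf\<close>\<close>

lemma carrier_Cinf: "f \<in> carrier (Cinf \<Omega>) \<longleftrightarrow> Csmooth \<Omega> f \<and> (\<forall>x. x \<notin> \<Omega> \<longrightarrow> f x = 0)"
  by (simp add: Cinf_def Csmooth_def)

lemma Cinf_subspace:
  assumes "open \<Omega>"
  shows "lin_subspace (carrier (Cinf \<Omega>))"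
  unfolding lin_subspace_def
  using Csmooth_ops[OF assms] times_differentiable_on_zero
  by (auto simp: carrier_Cinf scaleR_fun_def plus_fun_def zero_fun_def Csmooth_def[of _ "\<lambda>x. 0"])

text \<open>The generators of \<open>Cinf\<close> are real suprema, whose upper bound property
  depends on this boundedness.\<close>

lemma Cinf_seminorm_bdd:
  assumes "Csmooth \<Omega> f" "compact K" "K \<subseteq> \<Omega>"
  shows "bdd_above ((\<lambda>x. norm (partial_deriv vs f x)) ` K)"
proof -
  have "continuous_on K (\<lambda>x. norm (partial_deriv vs f x))"
    using Csmooth_continuous[OF Csmooth_partial_deriv[OF assms(1)]] assms(3)
    by (intro continuous_on_norm) (rule continuous_on_subset)
  then show ?thesis
    using assms(2) by (intro bounded_imp_bdd_above compact_imp_bounded compact_continuous_image)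
qed

lemma Cinf_wf:
  assumes "open \<Omega>"
  shows "lcs_wf (Cinf \<Omega>)"
  unfolding lcs_wf_def
proof (intro conjI ballI Cinf_subspace assms)
  fix p assume "p \<in> gens (Cinf \<Omega>)"
  then obtain K vs where p: "p = (\<lambda>f. SUP x\<in>K. norm (partial_deriv vs f x))" and K: "compact K" "K \<subseteq> \<Omega>" "K \<noteq> {}"
    by (auto simp: Cinf_def)
  have upper: "norm (partial_deriv vs f x) \<le> p f" if "Csmooth \<Omega> f" "x \<in> K" for f x
    unfolding p by (rule cSUP_upper[OF that(2) Cinf_seminorm_bdd[OF that(1) K(1,2)]])
  have least: "p f \<le> M" if "\<And>x. x \<in> K \<Longrightarrow> norm (partial_deriv vs f x) \<le> M" for f M
    unfolding p using that by (rule cSUP_least[OF K(3)])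
  obtain x0 where x0: "x0 \<in> K" using K by auto
  have pos: "0 \<le> p f" if "Csmooth \<Omega> f" for f
    using upper[OF that x0] norm_ge_zero order_trans by blast
  have scale_le: "p (r *\<^sub>R f) \<le> \<bar>r\<bar> * p f" if f: "Csmooth \<Omega> f" for r f
  proof (rule least)
    fix x assume x: "x \<in> K"
    then have "partial_deriv vs (r *\<^sub>R f) x = r *\<^sub>R partial_deriv vs f x"
      using partial_deriv_scaleR[OF assms f, of x vs r] K(2) by (auto simp: scaleR_fun_def)
    then show "norm (partial_deriv vs (r *\<^sub>R f) x) \<le> \<bar>r\<bar> * p f"
      using upper[OF f x] by (simp add: mult_left_mono)
  qed
  show "seminorm_on (carrier (Cinf \<Omega>)) p"
    unfolding seminorm_on_def
  proof (intro conjI ballI allI)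
    fix f g assume "f \<in> carrier (Cinf \<Omega>)" "g \<in> carrier (Cinf \<Omega>)"
    then have fg: "Csmooth \<Omega> f" "Csmooth \<Omega> g" by (auto simp: carrier_Cinf)
    show "p (f + g) \<le> p f + p g"
    proof (rule least)
      fix x assume x: "x \<in> K"
      then have "partial_deriv vs (f + g) x = partial_deriv vs f x + partial_deriv vs g x"
        using partial_deriv_add[OF assms fg, of x vs] K(2) by (auto simp: plus_fun_def)
      then show "norm (partial_deriv vs (f + g) x) \<le> p f + p g"
        using norm_triangle_mono[OF upper[OF fg(1) x] upper[OF fg(2) x]] by simp
    qed
  next
    fix r f assume "f \<in> carrier (Cinf \<Omega>)"
    then have f: "Csmooth \<Omega> f" by (auto simp: carrier_Cinf)
    show "0 \<le> p f" by (rule pos[OF f])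
    show "p (r *\<^sub>R f) = \<bar>r\<bar> * p f"
    proof (cases "r = 0")
      case True
      then show ?thesis
        using scale_le[OF f, of 0] pos[OF Csmooth_ops(2)[OF assms f, of 0]] by (simp add: scaleR_fun_def)
    next
      case False
      \<comment> \<open>The reverse inequality is the one just shown, applied to
        \<open>r *\<^sub>R f\<close> with the factor \<open>inverse r\<close>.\<close>
      have rf: "Csmooth \<Omega> (r *\<^sub>R f)"
        using Csmooth_ops(2)[OF assms f, of r] by (simp add: scaleR_fun_def)
      have "p f \<le> \<bar>inverse r\<bar> * p (r *\<^sub>R f)"
        using scale_le[OF rf, of "inverse r"] False by simp
      then have "\<bar>r\<bar> * p f \<le> \<bar>r\<bar> * (\<bar>inverse r\<bar> * p (r *\<^sub>R f))"
        by (rule mult_left_mono) simp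
      also have "\<dots> = p (r *\<^sub>R f)"
        unfolding mult.assoc[symmetric] abs_mult[symmetric] using False by simp
      finally have "\<bar>r\<bar> * p f \<le> p (r *\<^sub>R f)" .
      with scale_le[OF f, of r] show ?thesis by simp
    qed
  qed
qed

lemma Cinf_sep: "lcs_sep (Cinf \<Omega>)"
  unfolding lcs_sep_def
proof (intro ballI impI ext)
  fix f x assume f: "f \<in> carrier (Cinf \<Omega>)" "\<forall>p\<in>gens (Cinf \<Omega>). p f = 0"
  show "f x = 0 x"
  proof (cases "x \<in> \<Omega>")
    case True
    have "(\<lambda>f. SUP y\<in>{x}. norm (partial_deriv [] f y)) \<in> gens (Cinf \<Omega>)"
      unfolding Cinf_def lcs.simps mem_Collect_eq
      by (rule exI[of _ "{x}"], rule exI[of _ "[]"]) (use True in simp)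
    from bspec[OF f(2) this] show ?thesis by simp
  qed (use f(1) in \<open>simp add: carrier_Cinf\<close>)
qed

text \<open>Brings the topology of \<open>Cinf\<close> into the form that
  \<open>jsmooth_uniform_quotient\<close> provides and \<open>eval_has_vector_derivative\<close>
  consumes.\<close>

lemma lcs_has_deriv_Cinf:
  assumes "open \<Omega>" and c: "\<And>t. c t \<in> carrier (Cinf \<Omega>)" and l: "l \<in> carrier (Cinf \<Omega>)"
  shows "lcs_has_deriv (Cinf \<Omega>) c l t \<longleftrightarrow>
    (\<forall>K vs. compact K \<and> K \<subseteq> \<Omega> \<and> set vs \<subseteq> Basis \<longrightarrow>
      uniform_limit K (\<lambda>h x. inverse h *\<^sub>R (partial_deriv vs (c (t + h)) x - partial_deriv vs (c t) x))
        (partial_deriv vs l) (at 0))"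
proof -
  note W = Cinf_wf[OF assms(1)]
  note V = lcs_wfD(1)[OF W]
  define q where "q = (\<lambda>h. inverse h *\<^sub>R (c (t + h) - c t) - l)"
  have q: "q h \<in> carrier (Cinf \<Omega>)" for h
    unfolding q_def by (intro lin_subspaceD(3,4)[OF V] c l)
  have pq: "partial_deriv vs (q h) x = inverse h *\<^sub>R (partial_deriv vs (c (t + h)) x - partial_deriv vs (c t) x) - partial_deriv vs l x"
    if "x \<in> \<Omega>" for vs h x
  proof -
    have cs: "Csmooth \<Omega> (c s)" "Csmooth \<Omega> l" for s
      using c l by (auto simp: carrier_Cinf)
    have q': "q h = (\<lambda>x. (inverse h *\<^sub>R (c (t + h) x + (-1) *\<^sub>R c t x)) + (-1) *\<^sub>R l x)"
      by (simp add: q_def fun_eq_iff scaleR_fun_def)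
    show ?thesis
      unfolding q'
      by (simp only: partial_deriv_add[OF assms(1)] partial_deriv_scaleR[OF assms(1)] Csmooth_ops[OF assms(1)] cs that) simp
  qed
  show ?thesis
  proof
    assume "lcs_has_deriv (Cinf \<Omega>) c l t"
    note D = limitin_lcsD(3)[OF W this[unfolded lcs_has_deriv_def], folded q_def]
    show "\<forall>K vs. compact K \<and> K \<subseteq> \<Omega> \<and> set vs \<subseteq> Basis \<longrightarrow>
      uniform_limit K (\<lambda>h x. inverse h *\<^sub>R (partial_deriv vs (c (t + h)) x - partial_deriv vs (c t) x))
        (partial_deriv vs l) (at 0)"
    proof (intro allI impI, elim conjE)
      fix K and vs :: "'a list" assume K: "compact K" "K \<subseteq> \<Omega>" and vs: "set vs \<subseteq> Basis"
      show "uniform_limit K (\<lambda>h x. inverse h *\<^sub>R (partial_deriv vs (c (t + h)) x - partial_deriv vs (c t) x))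
        (partial_deriv vs l) (at 0)"
      proof (cases "K = {}")
        case False
        have "(\<lambda>f. SUP x\<in>K. norm (partial_deriv vs f x)) \<in> gens (Cinf \<Omega>)"
          unfolding Cinf_def using K vs False by auto
        from D[OF this] have L: "((\<lambda>h. SUP x\<in>K. norm (partial_deriv vs (q h) x)) \<longlongrightarrow> 0) (at 0)"
          by (simp add: q_def)
        show ?thesis
        proof (rule uniform_limitI)
          fix e :: real assume "e > 0"
          from order_tendstoD(2)[OF L this]
          show "\<forall>\<^sub>F h in at 0. \<forall>x\<in>K. dist (inverse h *\<^sub>R (partial_deriv vs (c (t + h)) x - partial_deriv vs (c t) x))
              (partial_deriv vs l x) < e"
          proof eventually_elim
            case (elim h)
            have "norm (partial_deriv vs (q h) x) < e" if "x \<in> K" for x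
              using cSUP_upper[OF that Cinf_seminorm_bdd[OF _ K], of "q h" vs] q[of h] elim
              by (auto simp: carrier_Cinf)
            then show ?case
              using pq K(2) by (auto simp: dist_norm subset_iff)
          qed
        qed
      qed simp
    qed
  next
    assume U: "\<forall>K vs. compact K \<and> K \<subseteq> \<Omega> \<and> set vs \<subseteq> Basis \<longrightarrow>
      uniform_limit K (\<lambda>h x. inverse h *\<^sub>R (partial_deriv vs (c (t + h)) x - partial_deriv vs (c t) x))
        (partial_deriv vs l) (at 0)"
    show "lcs_has_deriv (Cinf \<Omega>) c l t"
      unfolding lcs_has_deriv_def
    proof (rule limitin_lcsI[OF W l])
      show "\<forall>\<^sub>F h in at 0. inverse h *\<^sub>R (c (t + h) - c t) \<in> carrier (Cinf \<Omega>)"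
        by (intro always_eventually allI lin_subspaceD(3,4)[OF V] c)
      fix p assume p: "p \<in> gens (Cinf \<Omega>)"
      then obtain K vs where p': "p = (\<lambda>f. SUP x\<in>K. norm (partial_deriv vs f x))"
        and K: "compact K" "K \<subseteq> \<Omega>" "K \<noteq> {}" "set vs \<subseteq> Basis"
        by (auto simp: Cinf_def)
      have pos: "0 \<le> p (q h)" for h
        using seminorm_onD(1)[OF lcs_wfD(2)[OF W p] V q] .
      have "((\<lambda>h. p (q h)) \<longlongrightarrow> 0) (at 0)"
      proof (rule tendstoI)
        fix e :: real assume e: "e > 0"
        have "uniform_limit K (\<lambda>h x. inverse h *\<^sub>R (partial_deriv vs (c (t + h)) x - partial_deriv vs (c t) x))
            (partial_deriv vs l) (at 0)"
          using U K by blast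
        \<comment> \<open>Half of \<open>e\<close>, because a supremum of values below a bound is
          only at most that bound.\<close>
        from uniform_limitD[OF this half_gt_zero[OF e]]
        show "\<forall>\<^sub>F h in at 0. dist (p (q h)) 0 < e"
        proof eventually_elim
          case (elim h)
          have "p (q h) \<le> e / 2"
            unfolding p' by (rule cSUP_least[OF K(3)]) (use elim K(2) pq in \<open>auto simp: dist_norm subset_iff less_imp_le\<close>)
          then show ?case
            using pos[of h] e by simp
        qed
      qed
      then show "((\<lambda>h. p (inverse h *\<^sub>R (c (t + h) - c t) - l)) \<longlongrightarrow> 0) (at 0)"
        by (simp add: q_def)
    qed
  qed
qed

lemma times_diff_sum:
  "finite A \<Longrightarrow> (\<And>i. i \<in> A \<Longrightarrow> times_diff n (f i)) \<Longrightarrow> times_diff n (\<lambda>t. \<Sum>i\<in>A. f i t)"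
proof (induction A rule: finite_induct)
  case empty
  then show ?case
    using smooth_const by (auto simp: smooth_def)
qed (simp add: times_diff_add)

text \<open>The functions \<open>partial_deriv vs (C k t) (x t)\<close>, for all \<open>vs\<close>
  and \<open>k\<close>, have derivatives in \<open>t\<close> that are sums of such functions with
  factors from \<open>vd x\<close>; hence the induction over the whole family. This turns maps into
  \<open>Cinf\<close> into jointly smooth functions.\<close>

lemma smooth_eval_Cinf:
  fixes f :: "real \<Rightarrow> 'a::euclidean_space \<Rightarrow> complex"
  assumes "open \<Omega>" and f: "smooth_curve (Cinf \<Omega>) f" and x: "smooth x" "\<And>t. x t \<in> \<Omega>"
  shows "smooth (\<lambda>t. f t (x t))"
proof -
  obtain C where C: "C 0 = f" "\<And>k t. C k t \<in> carrier (Cinf \<Omega>)"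
    "\<And>k t. lcs_has_deriv (Cinf \<Omega>) (C k) (C (Suc k) t) t"
    using smooth_curveE[OF f] by metis
  have cs: "Csmooth \<Omega> (partial_deriv vs (C k t))" for vs k t
    using C(2) by (auto simp: carrier_Cinf intro: Csmooth_partial_deriv)
  have D: "((\<lambda>t. partial_deriv vs (C k t) (x t)) has_vector_derivative
      partial_deriv vs (C (Suc k) t) (x t) + (\<Sum>i\<in>Basis. (vd x t \<bullet> i) *\<^sub>R partial_deriv (i # vs) (C k t) (x t))) (at t)"
    if vs: "set vs \<subseteq> Basis" for vs k t
  proof -
    note H = Csmooth_has_derivative[OF cs x(2), of vs k t t]
    have "frechet_derivative (partial_deriv vs (C k t)) (at (x t)) (vd x t) =
        frechet_derivative (partial_deriv vs (C k t)) (at (x t)) (\<Sum>i\<in>Basis. (vd x t \<bullet> i) *\<^sub>R i)"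
      by (simp add: euclidean_representation)
    also have "\<dots> = (\<Sum>i\<in>Basis. (vd x t \<bullet> i) *\<^sub>R partial_deriv (i # vs) (C k t) (x t))"
      by (simp add: linear_sum[OF has_derivative_linear[OF H]] linear_scale[OF has_derivative_linear[OF H]])
    finally show ?thesis
      using eval_has_vector_derivative[OF assms(1) x(2) smooth_vd(1)[OF x(1), of t],
          where f = "\<lambda>t. partial_deriv vs (C k t)", OF H, of "partial_deriv vs (C (Suc k) t)"]
        C(3)[of k t, unfolded lcs_has_deriv_Cinf[OF assms(1) C(2) C(2)]] vs Csmooth_continuous[OF cs, of vs "Suc k" t]
      by simp
  qed
  have "times_diff n (\<lambda>t. partial_deriv vs (C k t) (x t))" if "set vs \<subseteq> Basis" for n vs k
    using that
  proof (induction n arbitrary: vs k)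
    case (Suc n)
    have "times_diff n (\<lambda>t. partial_deriv vs (C (Suc k) t) (x t) + (\<Sum>i\<in>Basis. (vd x t \<bullet> i) *\<^sub>R partial_deriv (i # vs) (C k t) (x t)))"
    proof (intro times_diff_add times_diff_sum finite_Basis times_diff_bilinear[OF bounded_bilinear_scaleR])
      show "times_diff n (\<lambda>t. partial_deriv vs (C (Suc k) t) (x t))"
        using Suc by blast
      fix i :: 'a assume "i \<in> Basis"
      then show "times_diff n (\<lambda>t. partial_deriv (i # vs) (C k t) (x t))"
        using Suc.prems by (intro Suc.IH) simp
      have "smooth (\<lambda>t. vd x t \<bullet> i)"
        by (rule smooth_linear[OF bounded_linear_inner_left smooth_vd(2)[OF x(1)]])
      then show "times_diff n (\<lambda>t. vd x t \<bullet> i)"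
        by (simp add: smooth_def)
    qed
    with D[OF Suc.prems] show ?case
      unfolding times_diff.simps by (intro exI conjI allI)
  qed simp
  from this[of "[]" _ 0] show ?thesis
    by (simp add: smooth_def C(1))
qed

section \<open>The spaces of test functions and kernels\<close>

lemma test_functions_subspace:
  assumes "open \<Omega>"
  shows "lin_subspace (test_functions \<Omega>)"
proof -
  note V = lin_subspaceD[OF Cinf_subspace[OF assms]]
  have closed: "compact S" if "compact T" "closed S" "S \<subseteq> T" for S T :: "'a set"
    using that compact_Int_closed[of T S] by (simp add: Int_absorb1)
  have add: "supp (\<phi> + \<psi>) \<subseteq> supp \<phi> \<union> supp \<psi>" for \<phi> \<psi> :: "'a \<Rightarrow> complex"
    unfolding supp_def closure_Un[symmetric] by (rule closure_mono) auto
  have scale: "supp (r *\<^sub>R \<phi>) \<subseteq> supp \<phi>" for r and \<phi> :: "'a \<Rightarrow> complex"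
    unfolding supp_def by (rule closure_mono) (auto simp: scaleR_fun_def)
  have cl: "closed (supp \<phi>)" for \<phi> :: "'a \<Rightarrow> complex"
    by (simp add: supp_def)
  show ?thesis
    unfolding lin_subspace_def
  proof (intro conjI ballI allI)
    show "0 \<in> test_functions \<Omega>"
      using V(1) by (simp add: test_functions_def supp_def)
    show "\<phi> + \<psi> \<in> test_functions \<Omega>" if "\<phi> \<in> test_functions \<Omega>" "\<psi> \<in> test_functions \<Omega>" for \<phi> \<psi>
      using that V(2) add[of \<phi> \<psi>] closed[OF compact_Un cl add] unfolding test_functions_def by blast
    show "r *\<^sub>R \<phi> \<in> test_functions \<Omega>" if "\<phi> \<in> test_functions \<Omega>" for r \<phi>
      using that V(3) scale[of r \<phi>] closed[OF _ cl scale] unfolding test_functions_def by blast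
  qed
qed

lemma Dspace_wf: "open \<Omega> \<Longrightarrow> lcs_wf (Dspace \<Omega>)"
  unfolding lcs_wf_def by (simp add: Dspace_def test_functions_subspace)

lemma SKI_wf: "open \<Omega> \<Longrightarrow> lcs_wf (SKI \<Omega>)"
  unfolding SKI_def SK_def by (intro power_wf smooth_space_subspace Dspace_wf)

section \<open>Generalized functions and points\<close>

lemma SKI_direction_space: "open \<Omega> \<Longrightarrow> direction_space (carrier (SKI \<Omega>))"
  using lin_subspaceD[OF lcs_wfD(1)[OF SKI_wf]] by unfold_locales blast+

lemma test_objects_in_SKI: "test_objects \<Omega> \<subseteq> carrier (SKI \<Omega>)" "zero_test_objects \<Omega> \<subseteq> carrier (SKI \<Omega>)"
  by (auto simp: test_objects_def zero_test_objects_def test_objects_to_def)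

lemma SKI_test_space:
  "open \<Omega> \<Longrightarrow> test_space (carrier (SKI \<Omega>)) (test_objects \<Omega>) (zero_test_objects \<Omega>)"
  by (intro test_space.intro SKI_direction_space test_space_axioms.intro test_objects_in_SKI)

text \<open>Finite sums of terms \<open>b t *\<^sub>R v\<close> are smooth in any locally convex
  space, so a map smooth along all smooth curves is in particular smooth along every
  \<open>fcurve\<close>.\<close>

lemma (in direction_space) fcurve_imp_smooth_curve:
  assumes "lcs_wf E" "V = carrier E" "fcurve c"
  shows "smooth_curve E c"
  using assms(3)
proof (induction rule: fcurve.induct)
  case fcurve_zero
  then show ?case by (rule smooth_curve_zero[OF assms(1)])
next
  case (fcurve_add c b v)
  then show ?case
    using assms(1,2) by (intro smooth_curve_add smooth_curve_scaleR_left) auto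
qed

lemma net_maps_iff:
  fixes u :: "(real \<Rightarrow> 'a::euclidean_space kernel) \<Rightarrow> real \<Rightarrow> 'b::real_vector"
  assumes "lcs_wf F"
  shows "u \<in> net_maps \<Omega> F \<longleftrightarrow>
    (\<forall>c. smooth_curve (SKI \<Omega>) c \<longrightarrow> (\<forall>\<epsilon>\<in>eps_I. smooth_curve F (\<lambda>t. u (c t) \<epsilon>)) \<and> (\<forall>t \<epsilon>. \<epsilon> \<notin> eps_I \<longrightarrow> u (c t) \<epsilon> = 0)) \<and>
    (\<forall>\<phi>. \<phi> \<notin> carrier (SKI \<Omega>) \<longrightarrow> u \<phi> = 0)"
proof -
  have "range c \<subseteq> carrier (SKI \<Omega>)" if "smooth_curve (SKI \<Omega>) c" for c
    using smooth_curveE[OF that] by (metis image_subset_iff)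
  then show ?thesis
    unfolding net_maps_def smooth_space_def smooth_map_def
    by (auto simp: smooth_curve_power[OF assms] o_def)
qed

context
  fixes \<Omega> :: "'a::euclidean_space set"
  assumes \<Omega>: "open \<Omega>"
begin

interpretation test_space "carrier (SKI \<Omega>)" "test_objects \<Omega>" "zero_test_objects \<Omega>"
  by (rule SKI_test_space[OF \<Omega>])

lemma net_maps_value_zero:
  fixes u :: "(real \<Rightarrow> 'a kernel) \<Rightarrow> real \<Rightarrow> 'b::real_vector"
  assumes F: "lcs_wf F" and u: "u \<in> net_maps \<Omega> F" and \<epsilon>: "\<epsilon> \<notin> eps_I"
  shows "u \<phi> \<epsilon> = 0"
proof (cases "\<phi> \<in> carrier (SKI \<Omega>)")
  case True
  from fcurve_imp_smooth_curve[OF SKI_wf[OF \<Omega>] refl fcurve_const[OF this]] show ?thesis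
    using u \<epsilon> unfolding net_maps_iff[OF F] by blast
next
  case False
  then show ?thesis
    using u unfolding net_maps_iff[OF F] by simp
qed

lemma net_maps_normed_smooth:
  fixes u :: "(real \<Rightarrow> 'a kernel) \<Rightarrow> real \<Rightarrow> 'b::real_normed_vector"
  shows "u \<in> net_maps \<Omega> normed_lcs \<Longrightarrow> fam_smooth u"
  unfolding fam_smooth_def ssmooth_def net_maps_iff[OF normed_lcs_wf] smooth_curve_normed
  using fcurve_imp_smooth_curve[OF SKI_wf[OF \<Omega>] refl] by blast

lemma net_maps_Cinf_carrier:
  assumes R: "R \<in> net_maps \<Omega> (Cinf \<Omega>)" and "\<phi> \<in> carrier (SKI \<Omega>)" "\<epsilon> \<in> eps_I"
  shows "R \<phi> \<epsilon> \<in> carrier (Cinf \<Omega>)"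
proof -
  have "smooth_curve (Cinf \<Omega>) (\<lambda>t::real. R \<phi> \<epsilon>)"
    using R fcurve_imp_smooth_curve[OF SKI_wf[OF \<Omega>] refl fcurve_const[OF assms(2)]] assms(3)
    unfolding net_maps_iff[OF Cinf_wf[OF \<Omega>]] by blast
  then show ?thesis
    by (rule smooth_curveE) metis
qed

lemma net_maps_Cinf_jsmooth:
  assumes R: "R \<in> net_maps \<Omega> (Cinf \<Omega>)"
  shows "fam_jsmooth \<Omega> R"
  unfolding fam_jsmooth_def jsmooth_def
proof (intro ballI allI impI, elim conjE)
  fix \<epsilon> c and x :: "real \<Rightarrow> 'a"
  assume \<epsilon>: "\<epsilon> \<in> eps_I" and c: "fcurve c" and x: "smooth x" "range x \<subseteq> \<Omega>"
  have "smooth_curve (Cinf \<Omega>) (\<lambda>t. R (c t) \<epsilon>)"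
    using R fcurve_imp_smooth_curve[OF SKI_wf[OF \<Omega>] refl c] \<epsilon>
    unfolding net_maps_iff[OF Cinf_wf[OF \<Omega>]] by blast
  then show "smooth (\<lambda>t. R (c t) \<epsilon> (x t))"
    using x by (intro smooth_eval_Cinf[OF \<Omega>]) auto
qed

text \<open>Membership in \<open>net_maps\<close> involves all smooth curves of nets of kernels, not
  only those in finite-dimensional subspaces; therefore \<open>smooth_eval_Cinf\<close> is applied
  along an arbitrary curve instead of using \<open>jsmooth\<close>.\<close>

lemma insert_point_net_maps:
  assumes R: "R \<in> net_maps \<Omega> (Cinf \<Omega>)" and X: "X \<in> net_maps \<Omega> normed_lcs"
    "\<And>\<phi> \<epsilon>. \<phi> \<in> carrier (SKI \<Omega>) \<Longrightarrow> \<epsilon> \<in> eps_I \<Longrightarrow> X \<phi> \<epsilon> \<in> \<Omega>"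
  shows "insert_point R X \<in> net_maps \<Omega> normed_lcs"
  unfolding net_maps_iff[OF normed_lcs_wf] smooth_curve_normed
proof (intro conjI allI impI ballI)
  fix c assume c: "smooth_curve (SKI \<Omega>) c"
  then have cin: "c t \<in> carrier (SKI \<Omega>)" for t
    by (rule smooth_curveE) metis
  show "insert_point R X (c t) \<epsilon> = 0" if "\<epsilon> \<notin> eps_I" for t \<epsilon>
    using net_maps_value_zero[OF Cinf_wf[OF \<Omega>] R that] by (simp add: insert_point_def)
  fix \<epsilon> assume \<epsilon>: "\<epsilon> \<in> eps_I"
  have "smooth_curve (Cinf \<Omega>) (\<lambda>t. R (c t) \<epsilon>)"
    using R c \<epsilon> unfolding net_maps_iff[OF Cinf_wf[OF \<Omega>]] by blast
  moreover have "smooth (\<lambda>t. X (c t) \<epsilon>)"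
    using X(1) c \<epsilon> unfolding net_maps_iff[OF normed_lcs_wf] smooth_curve_normed by blast
  ultimately show "smooth (\<lambda>t. insert_point R X (c t) \<epsilon>)"
    unfolding insert_point_def using X(2)[OF cin \<epsilon>] by (rule smooth_eval_Cinf[OF \<Omega>])
next
  fix \<phi> assume "\<phi> \<notin> carrier (SKI \<Omega>)"
  then have "R \<phi> = 0"
    using R unfolding net_maps_iff[OF Cinf_wf[OF \<Omega>]] by blast
  then show "insert_point R X \<phi> = 0"
    by (simp add: insert_point_def fun_eq_iff)
qed

lemma net_maps_normed_diff:
  fixes u w :: "(real \<Rightarrow> 'a kernel) \<Rightarrow> real \<Rightarrow> 'b::real_normed_vector"
  assumes "u \<in> net_maps \<Omega> normed_lcs" "w \<in> net_maps \<Omega> normed_lcs"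
  shows "u - w \<in> net_maps \<Omega> normed_lcs"
  using assms unfolding net_maps_iff[OF normed_lcs_wf] smooth_curve_normed
  by (auto intro: smooth_diff)

section \<open>Differentials as iterated directional derivatives\<close>

lemma partial_deriv_eq_pds: "partial_deriv vs (F \<phi>) = pds vs F \<phi>"
  by (induction vs) (auto simp: pd_def)

lemma jsmooth_Csmooth:
  fixes F :: "(real \<Rightarrow> 'a kernel) \<Rightarrow> 'a \<Rightarrow> complex"
  assumes "jsmooth \<Omega> F" "\<phi> \<in> carrier (SKI \<Omega>)"
  shows "Csmooth \<Omega> (F \<phi>)"
proof -
  have "times_differentiable_on k \<Omega> (F \<phi>)" if "jsmooth \<Omega> F" for k and F :: "(real \<Rightarrow> 'a kernel) \<Rightarrow> 'a \<Rightarrow> complex"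
    using that
  proof (induction k arbitrary: F)
    case 0
    then show ?case
      using jsmooth_has_derivative(1)[OF 0 \<Omega> assms(2)]
      by (simp, meson continuous_at_imp_continuous_on has_derivative_continuous)
  next
    case (Suc k)
    have "times_differentiable_on k \<Omega> (\<lambda>x. frechet_derivative (F \<phi>) (at x) v)" for v
      using Suc.IH[OF jsmooth_pd[OF Suc.prems \<Omega>, of v]] by (simp add: pd_def[abs_def])
    then show ?case
      using jsmooth_has_derivative(1)[OF Suc.prems \<Omega> assms(2)] by (auto simp: differentiable_def)
  qed
  then show ?thesis
    using assms(1) by (simp add: Csmooth_def)
qed

text \<open>Upgrades a pointwise derivative to a limit in \<open>Cinf\<close>: each
  \<open>pds vs F\<close> has uniformly convergent quotients on compact sets, and
  \<open>Dir v\<close> commutes with \<open>pds vs\<close>. Vanishing off \<open>\<Omega>\<close>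
  places the functions in the carrier.\<close>

lemma lcs_has_deriv_Dir:
  fixes F :: "(real \<Rightarrow> 'a kernel) \<Rightarrow> 'a \<Rightarrow> complex"
  assumes F: "jsmooth \<Omega> F" and z: "\<And>\<phi> x. \<phi> \<in> carrier (SKI \<Omega>) \<Longrightarrow> x \<notin> \<Omega> \<Longrightarrow> F \<phi> x = 0"
    and \<phi>: "\<phi> \<in> carrier (SKI \<Omega>)" "v \<in> carrier (SKI \<Omega>)"
  shows "lcs_has_deriv (Cinf \<Omega>) (\<lambda>t. F (\<phi> + t *\<^sub>R v)) (Dir v F \<phi>) 0"
proof (subst lcs_has_deriv_Cinf[OF \<Omega>])
  show "F (\<phi> + t *\<^sub>R v) \<in> carrier (Cinf \<Omega>)" for t
    using jsmooth_Csmooth[OF F line_V[OF \<phi>]] z[OF line_V[OF \<phi>]] by (auto simp: carrier_Cinf)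
  have "Dir v F \<phi> x = 0" if "x \<notin> \<Omega>" for x
    unfolding Dir_def by (rule vd_eq) (simp add: z[OF line_V[OF \<phi>] that])
  then show "Dir v F \<phi> \<in> carrier (Cinf \<Omega>)"
    using jsmooth_Csmooth[OF jsmooth_Dir[OF F \<phi>(2)] \<phi>(1)] by (auto simp: carrier_Cinf)
  show "\<forall>K vs. compact K \<and> K \<subseteq> \<Omega> \<and> set vs \<subseteq> Basis \<longrightarrow>
      uniform_limit K (\<lambda>h x. inverse h *\<^sub>R (partial_deriv vs (F (\<phi> + (0 + h) *\<^sub>R v)) x - partial_deriv vs (F (\<phi> + 0 *\<^sub>R v)) x))
        (partial_deriv vs (Dir v F \<phi>)) (at 0)"
  proof (intro allI impI, elim conjE)
    fix K and vs :: "'a list" assume K: "compact K" "K \<subseteq> \<Omega>"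
    have "uniform_limit K (\<lambda>h x. inverse h *\<^sub>R (pds vs F (\<phi> + h *\<^sub>R v) x - pds vs F \<phi> x)) (Dir v (pds vs F) \<phi>) (at 0)"
      by (rule jsmooth_uniform_quotient[OF jsmooth_pds[OF F \<Omega>] \<Omega> \<phi> K])
    moreover have "Dir v (pds vs F) \<phi> x = pds vs (Dir v F) \<phi> x" if "x \<in> K" for x
      using pds_Dirs_commute[OF F \<Omega> \<phi>(1), of "[v]" x vs] \<phi>(2) K(2) that by auto
    ultimately show "uniform_limit K (\<lambda>h x. inverse h *\<^sub>R (partial_deriv vs (F (\<phi> + (0 + h) *\<^sub>R v)) x - partial_deriv vs (F (\<phi> + 0 *\<^sub>R v)) x))
        (partial_deriv vs (Dir v F \<phi>)) (at 0)"
      by (simp add: partial_deriv_eq_pds cong: uniform_limit_cong')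
  qed
qed

text \<open>At each stage the limit exists in the Hausdorff power, so the definite description in
  \<open>ddiff\<close> denotes it. From here on only componentwise directional derivatives have to
  be estimated.\<close>

lemma ddiff_Cinf:
  assumes R: "R \<in> net_maps \<Omega> (Cinf \<Omega>)"
  shows "\<phi> \<in> carrier (SKI \<Omega>) \<Longrightarrow> set \<psi>s \<subseteq> carrier (SKI \<Omega>) \<Longrightarrow>
    ddiff (lcs_power (Cinf \<Omega>)) R \<phi> \<psi>s = (\<lambda>\<epsilon>. if \<epsilon> \<in> eps_I then Dirs \<psi>s (\<lambda>\<phi>. R \<phi> \<epsilon>) \<phi> else 0)"
proof (induction \<psi>s arbitrary: \<phi>)
  case Nil
  then show ?case
    using net_maps_value_zero[OF Cinf_wf[OF \<Omega>] R] by (auto simp: fun_eq_iff)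
next
  case (Cons v \<psi>s)
  note W = Cinf_wf[OF \<Omega>]
  have vs: "v \<in> carrier (SKI \<Omega>)" "set \<psi>s \<subseteq> carrier (SKI \<Omega>)"
    using Cons.prems by auto
  define G where "G = (\<lambda>\<epsilon>. Dirs \<psi>s (\<lambda>\<phi>. R \<phi> \<epsilon>))"
  have G: "jsmooth \<Omega> (G \<epsilon>)" if "\<epsilon> \<in> eps_I" for \<epsilon>
    using net_maps_Cinf_jsmooth[OF R] that vs by (auto simp: G_def fam_jsmooth_def intro: jsmooth_Dirs)
  \<comment> \<open>Differentiation in kernel directions preserves the value 0 off
    \<open>\<Omega>\<close>, as membership in \<open>Cinf\<close> demands.\<close>
  have G0: "G \<epsilon> \<phi> x = 0" if "\<epsilon> \<in> eps_I" "\<phi> \<in> carrier (SKI \<Omega>)" "x \<notin> \<Omega>" for \<epsilon> \<phi> x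
  proof -
    have "sDirs \<psi>s (\<lambda>\<phi>. R \<phi> \<epsilon> x) \<phi> = sDirs \<psi>s (\<lambda>\<phi>. 0) \<phi>"
      using net_maps_Cinf_carrier[OF R _ that(1)] that vs(2) by (intro sDirs_cong) (auto simp: carrier_Cinf)
    also have "sDirs \<psi>s (\<lambda>\<phi>. 0 :: complex) = (\<lambda>\<phi>. 0)"
      by (induction \<psi>s) (auto intro!: ext sDir_eqI)
    finally show ?thesis by (simp add: G_def Dirs_eq_sDirs)
  qed
  define c where "c = (\<lambda>t. ddiff (lcs_power (Cinf \<Omega>)) R (\<phi> + t *\<^sub>R v) \<psi>s)"
  define l where "l = (\<lambda>\<epsilon>. if \<epsilon> \<in> eps_I then Dir v (G \<epsilon>) \<phi> else 0)"
  have c: "c t = (\<lambda>\<epsilon>. if \<epsilon> \<in> eps_I then G \<epsilon> (\<phi> + t *\<^sub>R v) else 0)" for t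
    unfolding c_def G_def by (rule Cons.IH[OF line_V[OF Cons.prems(1) vs(1)] vs(2)])
  have "lcs_has_deriv (lcs_power (Cinf \<Omega>)) c l 0"
  proof (rule lcs_has_deriv_powerI[OF W])
    show "c t \<in> carrier (lcs_power (Cinf \<Omega>))" for t
      using jsmooth_Csmooth[OF G line_V[OF Cons.prems(1) vs(1)]] G0[OF _ line_V[OF Cons.prems(1) vs(1)]]
      by (auto simp: carrier_power c carrier_Cinf)
    show "lcs_has_deriv (Cinf \<Omega>) (\<lambda>t. c t \<epsilon>) (l \<epsilon>) 0" if "\<epsilon> \<in> eps_I" for \<epsilon>
      using lcs_has_deriv_Dir[OF G[OF that] G0[OF that] Cons.prems(1) vs(1)] that by (simp add: c l_def)
  qed (simp add: l_def)
  then have "lcs_deriv (lcs_power (Cinf \<Omega>)) c 0 = l"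
    by (rule lcs_deriv_eq[OF power_wf[OF lcs_wfD(1)[OF W]] power_sep[OF W Cinf_sep]])
  then show ?case
    by (simp add: c_def[symmetric] l_def G_def fun_eq_iff)
qed

lemma ddiff_normed:
  fixes u :: "(real \<Rightarrow> 'a kernel) \<Rightarrow> real \<Rightarrow> 'b::banach"
  assumes u: "u \<in> net_maps \<Omega> normed_lcs"
  shows "\<phi> \<in> carrier (SKI \<Omega>) \<Longrightarrow> set \<psi>s \<subseteq> carrier (SKI \<Omega>) \<Longrightarrow>
    ddiff (lcs_power normed_lcs) u \<phi> \<psi>s = (\<lambda>\<epsilon>. if \<epsilon> \<in> eps_I then sDirs \<psi>s (\<lambda>\<phi>. u \<phi> \<epsilon>) \<phi> else 0)"
proof (induction \<psi>s arbitrary: \<phi>)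
  case Nil
  then show ?case
    using net_maps_value_zero[OF normed_lcs_wf u] by (auto simp: fun_eq_iff)
next
  case (Cons v \<psi>s)
  note W = normed_lcs_wf
  have vs: "v \<in> carrier (SKI \<Omega>)" "set \<psi>s \<subseteq> carrier (SKI \<Omega>)"
    using Cons.prems by auto
  define G where "G = (\<lambda>\<epsilon>. sDirs \<psi>s (\<lambda>\<phi>. u \<phi> \<epsilon>))"
  have ss: "ssmooth w \<Longrightarrow> set \<psi>s \<subseteq> carrier (SKI \<Omega>) \<Longrightarrow> ssmooth (sDirs \<psi>s w)" for \<psi>s and w :: "(real \<Rightarrow> 'a kernel) \<Rightarrow> 'b"
    by (induction \<psi>s) (auto intro: ssmooth_sDir)
  have G: "ssmooth (G \<epsilon>)" if "\<epsilon> \<in> eps_I" for \<epsilon>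
    using net_maps_normed_smooth[OF u] that vs(2) by (auto simp: G_def fam_smooth_def intro: ss)
  define c where "c = (\<lambda>t. ddiff (lcs_power normed_lcs) u (\<phi> + t *\<^sub>R v) \<psi>s)"
  define l where "l = (\<lambda>\<epsilon>. if \<epsilon> \<in> eps_I then sDir v (G \<epsilon>) \<phi> else 0)"
  have c: "c t = (\<lambda>\<epsilon>. if \<epsilon> \<in> eps_I then G \<epsilon> (\<phi> + t *\<^sub>R v) else 0)" for t
    unfolding c_def G_def by (rule Cons.IH[OF line_V[OF Cons.prems(1) vs(1)] vs(2)])
  have "lcs_has_deriv (lcs_power normed_lcs) c l 0"
  proof (rule lcs_has_deriv_powerI[OF W])
    show "c t \<in> carrier (lcs_power normed_lcs)" for t
      by (auto simp: carrier_power c) (simp add: normed_lcs_def)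
    show "lcs_has_deriv normed_lcs (\<lambda>t. c t \<epsilon>) (l \<epsilon>) 0" if "\<epsilon> \<in> eps_I" for \<epsilon>
      using sDir_has_vector_derivative[OF G[OF that] Cons.prems(1) vs(1)] that
      by (simp add: c l_def lcs_has_deriv_normed)
  qed (simp add: l_def)
  then have "lcs_deriv (lcs_power normed_lcs) c 0 = l"
    by (rule lcs_deriv_eq[OF power_wf[OF lcs_wfD(1)[OF W]] power_sep[OF W normed_lcs_sep]])
  then show ?case
    by (simp add: c_def[symmetric] l_def G_def fun_eq_iff)
qed

section \<open>Growth conditions in terms of directional derivatives\<close>

lemma wrt_normed_iff:
  fixes u :: "(real \<Rightarrow> 'a kernel) \<Rightarrow> real \<Rightarrow> 'b::banach"
  assumes u: "u \<in> net_maps \<Omega> normed_lcs"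
  shows "moderate_wrt \<Omega> normed_lcs norm u \<longleftrightarrow> (\<forall>\<phi>\<in>test_objects \<Omega>. \<forall>\<psi>s. set \<psi>s \<subseteq> zero_test_objects \<Omega> \<longrightarrow>
      moderate_net (\<lambda>\<epsilon>. sDirs \<psi>s (\<lambda>\<phi>. u \<phi> \<epsilon>) \<phi>))"
    and "negligible_wrt \<Omega> normed_lcs norm u \<longleftrightarrow> (\<forall>\<phi>\<in>test_objects \<Omega>. \<forall>\<psi>s. set \<psi>s \<subseteq> zero_test_objects \<Omega> \<longrightarrow>
      negligible_net (\<lambda>\<epsilon>. sDirs \<psi>s (\<lambda>\<phi>. u \<phi> \<epsilon>) \<phi>))"
proof -
  have eq: "(\<lambda>\<epsilon>. norm (ddiff (lcs_power normed_lcs) u \<phi> \<psi>s \<epsilon>)) \<in> O[at_right 0](g) \<longleftrightarrow>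
      (\<lambda>\<epsilon>. norm (sDirs \<psi>s (\<lambda>\<phi>. u \<phi> \<epsilon>) \<phi>)) \<in> O[at_right 0](g)"
    if "\<phi> \<in> test_objects \<Omega>" "set \<psi>s \<subseteq> zero_test_objects \<Omega>" for \<phi> \<psi>s and g :: "real \<Rightarrow> real"
  proof (rule landau_o.big.in_cong)
    have "\<phi> \<in> carrier (SKI \<Omega>)" "set \<psi>s \<subseteq> carrier (SKI \<Omega>)"
      using that S_sub S0_sub by auto
    from ddiff_normed[OF u this] eventually_eps_I
    show "\<forall>\<^sub>F \<epsilon> in at_right 0. norm (ddiff (lcs_power normed_lcs) u \<phi> \<psi>s \<epsilon>) = norm (sDirs \<psi>s (\<lambda>\<phi>. u \<phi> \<epsilon>) \<phi>)"
      by (auto elim!: eventually_mono)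
  qed
  show "moderate_wrt \<Omega> normed_lcs norm u \<longleftrightarrow> (\<forall>\<phi>\<in>test_objects \<Omega>. \<forall>\<psi>s. set \<psi>s \<subseteq> zero_test_objects \<Omega> \<longrightarrow>
      moderate_net (\<lambda>\<epsilon>. sDirs \<psi>s (\<lambda>\<phi>. u \<phi> \<epsilon>) \<phi>))"
    unfolding moderate_wrt_def moderate_net_def by (simp add: eq)
  show "negligible_wrt \<Omega> normed_lcs norm u \<longleftrightarrow> (\<forall>\<phi>\<in>test_objects \<Omega>. \<forall>\<psi>s. set \<psi>s \<subseteq> zero_test_objects \<Omega> \<longrightarrow>
      negligible_net (\<lambda>\<epsilon>. sDirs \<psi>s (\<lambda>\<phi>. u \<phi> \<epsilon>) \<phi>))"
    unfolding negligible_wrt_def negligible_net_def by (simp add: eq)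
qed

lemma wrt_complex_iff:
  assumes "u \<in> net_maps \<Omega> normed_lcs"
  shows "moderate_wrt \<Omega> normed_lcs norm u \<longleftrightarrow> (\<forall>n. growth moderate_net n u)"
    and "negligible_wrt \<Omega> normed_lcs norm u \<longleftrightarrow> (\<forall>n. growth negligible_net n u)"
  unfolding wrt_normed_iff[OF assms] growth_def by blast+

text \<open>Bounded linear maps commute with directional derivatives, and a coordinate is dominated
  by the norm.\<close>

lemma growth_coord:
  assumes X: "X \<in> net_maps \<Omega> normed_lcs" and i: "i \<in> Basis"
  shows "moderate_wrt \<Omega> normed_lcs norm X \<Longrightarrow> growth moderate_net n (coord X i)"
    and "negligible_wrt \<Omega> normed_lcs norm X \<Longrightarrow> growth negligible_net n (coord X i)"
proof -
  have le: "\<forall>\<^sub>F \<epsilon> in at_right 0. norm (sDirs \<psi>s (\<lambda>\<phi>. coord X i \<phi> \<epsilon>) \<phi>) \<le> norm (sDirs \<psi>s (\<lambda>\<phi>. X \<phi> \<epsilon>) \<phi>)"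
    if "\<phi> \<in> test_objects \<Omega>" "set \<psi>s \<subseteq> zero_test_objects \<Omega>" for \<phi> \<psi>s
    using eventually_eps_I
  proof eventually_elim
    case (elim \<epsilon>)
    have "ssmooth (\<lambda>\<phi>. X \<phi> \<epsilon>)"
      using net_maps_normed_smooth[OF X] elim by (simp add: fam_smooth_def)
    from sDirs_linear[OF bounded_linear_coord this, of \<phi> \<psi>s i]
    have "sDirs \<psi>s (\<lambda>\<phi>. coord X i \<phi> \<epsilon>) \<phi> = complex_of_real (sDirs \<psi>s (\<lambda>\<phi>. X \<phi> \<epsilon>) \<phi> \<bullet> i)"
      using that S_sub S0_sub by (auto simp: coord_def)
    then show ?case
      using Basis_le_norm[OF i] by simp
  qed
  show "growth moderate_net n (coord X i)" if "moderate_wrt \<Omega> normed_lcs norm X"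
    using that le unfolding wrt_normed_iff[OF X] growth_def by (blast intro: moderate_net_mono)
  show "growth negligible_net n (coord X i)" if "negligible_wrt \<Omega> normed_lcs norm X"
    using that le unfolding wrt_normed_iff[OF X] growth_def by (blast intro: negligible_net_mono)
qed

text \<open>The seminorm formed with \<open>K\<close> and \<open>vs\<close> dominates the
  corresponding derivative at every point selected from \<open>K\<close>; exchanging space and
  kernel derivatives makes it a seminorm of the differential.\<close>

lemma fam_growth_wrt:
  assumes R: "R \<in> net_maps \<Omega> (Cinf \<Omega>)"
  shows "\<forall>p\<in>csn (Cinf \<Omega>). moderate_wrt \<Omega> (Cinf \<Omega>) p R \<Longrightarrow> fam_growth moderate_net \<Omega> R"
    and "\<forall>p\<in>csn (Cinf \<Omega>). negligible_wrt \<Omega> (Cinf \<Omega>) p R \<Longrightarrow> fam_growth negligible_net \<Omega> R"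
proof -
  have *: "\<exists>p\<in>csn (Cinf \<Omega>). \<forall>\<^sub>F \<epsilon> in at_right 0. norm (Dirs \<psi>s (pds vs (\<lambda>\<phi>. R \<phi> \<epsilon>)) \<phi> (y \<epsilon>)) \<le>
      norm (p (ddiff (lcs_power (Cinf \<Omega>)) R \<phi> \<psi>s \<epsilon>))"
    if "\<phi> \<in> test_objects \<Omega>" "set \<psi>s \<subseteq> zero_test_objects \<Omega>" "set vs \<subseteq> Basis" and K: "compact K" "K \<subseteq> \<Omega>"
      and y: "\<forall>\<^sub>F \<epsilon> in at_right 0. y \<epsilon> \<in> K" for \<phi> \<psi>s vs K and y :: "real \<Rightarrow> 'a"
  proof -
    define p where "p = (\<lambda>f::'a \<Rightarrow> complex. SUP x\<in>K. norm (partial_deriv vs f x))"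
    \<comment> \<open>Generators of \<open>Cinf\<close> are formed with nonempty sets; here
      \<open>K\<close> contains some \<open>y \<epsilon>\<close>, the filter being
      nontrivial.\<close>
    have "K \<noteq> {}"
      using eventually_happens'[OF _ y] by auto
    then have "p \<in> gens (Cinf \<Omega>)"
      unfolding Cinf_def lcs.simps mem_Collect_eq p_def
      by (intro exI[of _ K] exI[of _ vs] conjI refl) (use that in auto)
    then have "p \<in> csn (Cinf \<Omega>)"
      using gens_subset_csn[OF Cinf_wf[OF \<Omega>]] by blast
    moreover have "\<forall>\<^sub>F \<epsilon> in at_right 0. norm (Dirs \<psi>s (pds vs (\<lambda>\<phi>. R \<phi> \<epsilon>)) \<phi> (y \<epsilon>)) \<le>
      norm (p (ddiff (lcs_power (Cinf \<Omega>)) R \<phi> \<psi>s \<epsilon>))"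
      using y eventually_eps_I
    proof eventually_elim
      case (elim \<epsilon>)
      have V: "\<phi> \<in> carrier (SKI \<Omega>)" "set \<psi>s \<subseteq> carrier (SKI \<Omega>)"
        using that S_sub S0_sub by auto
      have J: "jsmooth \<Omega> (\<lambda>\<phi>. R \<phi> \<epsilon>)"
        using net_maps_Cinf_jsmooth[OF R] elim by (simp add: fam_jsmooth_def)
      have "Dirs \<psi>s (pds vs (\<lambda>\<phi>. R \<phi> \<epsilon>)) \<phi> (y \<epsilon>) = partial_deriv vs (Dirs \<psi>s (\<lambda>\<phi>. R \<phi> \<epsilon>) \<phi>) (y \<epsilon>)"
        using pds_Dirs_commute[OF J \<Omega> V, of "y \<epsilon>" vs] elim(1) K(2) partial_deriv_eq_pds[of vs "Dirs \<psi>s (\<lambda>\<phi>. R \<phi> \<epsilon>)" \<phi>]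
        by auto
      moreover have "Csmooth \<Omega> (Dirs \<psi>s (\<lambda>\<phi>. R \<phi> \<epsilon>) \<phi>)"
        by (rule jsmooth_Csmooth[OF jsmooth_Dirs[OF J V(2)] V(1)])
      ultimately have "norm (Dirs \<psi>s (pds vs (\<lambda>\<phi>. R \<phi> \<epsilon>)) \<phi> (y \<epsilon>)) \<le> p (Dirs \<psi>s (\<lambda>\<phi>. R \<phi> \<epsilon>) \<phi>)"
        unfolding p_def using cSUP_upper[OF elim(1) Cinf_seminorm_bdd[OF _ K]] by simp
      also have "\<dots> \<le> norm (p (ddiff (lcs_power (Cinf \<Omega>)) R \<phi> \<psi>s \<epsilon>))"
        using elim(2) by (simp add: ddiff_Cinf[OF R V])
      finally show ?case .
    qed
    ultimately show ?thesis by blast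
  qed
  have main: "fam_growth P \<Omega> R" if P: "net_class P"
    and d: "\<And>\<phi> \<psi>s p. \<phi> \<in> test_objects \<Omega> \<Longrightarrow> set \<psi>s \<subseteq> zero_test_objects \<Omega> \<Longrightarrow> p \<in> csn (Cinf \<Omega>) \<Longrightarrow>
      P (\<lambda>\<epsilon>. complex_of_real (p (ddiff (lcs_power (Cinf \<Omega>)) R \<phi> \<psi>s \<epsilon>)))" for P
    unfolding fam_growth_def
  proof (intro ballI allI impI, elim conjE)
    fix \<phi> \<psi>s and vs :: "'a list" and K and y :: "real \<Rightarrow> 'a"
    assume a: "\<phi> \<in> test_objects \<Omega>" "set \<psi>s \<subseteq> zero_test_objects \<Omega>" "set vs \<subseteq> Basis" "compact K" "K \<subseteq> \<Omega>"
      "\<forall>\<^sub>F \<epsilon> in at_right 0. y \<epsilon> \<in> K"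
    obtain p where p: "p \<in> csn (Cinf \<Omega>)" "\<forall>\<^sub>F \<epsilon> in at_right 0. norm (Dirs \<psi>s (pds vs (\<lambda>\<phi>. R \<phi> \<epsilon>)) \<phi> (y \<epsilon>)) \<le>
      norm (p (ddiff (lcs_power (Cinf \<Omega>)) R \<phi> \<psi>s \<epsilon>))"
      using *[OF a] by blast
    show "P (\<lambda>\<epsilon>. Dirs \<psi>s (pds vs (\<lambda>\<phi>. R \<phi> \<epsilon>)) \<phi> (y \<epsilon>))"
      by (rule net_classD(2)[OF P d[OF a(1,2) p(1)]]) (use p(2) in simp)
  qed
  show "\<forall>p\<in>csn (Cinf \<Omega>). moderate_wrt \<Omega> (Cinf \<Omega>) p R \<Longrightarrow> fam_growth moderate_net \<Omega> R"
    by (rule main[OF net_class_moderate]) (simp add: moderate_wrt_def moderate_net_def)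
  show "\<forall>p\<in>csn (Cinf \<Omega>). negligible_wrt \<Omega> (Cinf \<Omega>) p R \<Longrightarrow> fam_growth negligible_net \<Omega> R"
    by (rule main[OF net_class_negligible]) (simp add: negligible_wrt_def negligible_net_def)
qed

section \<open>Equivalent representatives and the class of the point value\<close>

text \<open>Puts a representative into its own class, so that a generalized function is a nonempty
  set.\<close>

lemma E_negligible_zero: "(0 :: 'a gfun) \<in> E_negligible \<Omega>"
proof -
  note W = Cinf_wf[OF \<Omega>]
  have z: "(0 :: 'a gfun) \<in> net_maps \<Omega> (Cinf \<Omega>)"
    unfolding net_maps_iff[OF W] using smooth_curve_zero[OF W] by simp
  have "negligible_wrt \<Omega> (Cinf \<Omega>) p 0" if p: "p \<in> csn (Cinf \<Omega>)" for p
    unfolding negligible_wrt_def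
  proof (intro ballI allI impI)
    fix \<phi> \<psi>s and m :: nat assume "\<phi> \<in> test_objects \<Omega>" "set \<psi>s \<subseteq> zero_test_objects \<Omega>"
    then have V: "\<phi> \<in> carrier (SKI \<Omega>)" "set \<psi>s \<subseteq> carrier (SKI \<Omega>)"
      using S_sub S0_sub by auto
    have "Dirs \<psi>s (\<lambda>\<phi> x. 0 :: complex) = (\<lambda>\<phi> (x::'a). 0)"
      by (induction \<psi>s) (auto intro!: ext vd_eq simp: Dir_def)
    then have "ddiff (lcs_power (Cinf \<Omega>)) 0 \<phi> \<psi>s \<epsilon> = 0" for \<epsilon>
      unfolding ddiff_Cinf[OF z V] by (simp add: zero_fun_def)
    moreover have "p 0 = 0"
      using p seminorm_onD(4)[OF _ lcs_wfD(1)[OF W]] by (simp add: csn_def)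
    ultimately show "(\<lambda>\<epsilon>. p (ddiff (lcs_power (Cinf \<Omega>)) 0 \<phi> \<psi>s \<epsilon>)) \<in> O[at_right 0](\<lambda>\<epsilon>. \<epsilon> ^ m)"
      by simp
  qed
  with z show ?thesis
    by (simp add: E_negligible_def)
qed

lemma C_rel_iff:
  "(u, w) \<in> C_rel \<Omega> \<longleftrightarrow> u \<in> C_moderate \<Omega> \<and> w \<in> C_moderate \<Omega> \<and>
     (\<forall>n. growth negligible_net n (\<lambda>\<phi> \<epsilon>. u \<phi> \<epsilon> - w \<phi> \<epsilon>))"
proof -
  have "u - w \<in> C_negligible \<Omega> \<longleftrightarrow> (\<forall>n. growth negligible_net n (u - w))"
    if "u \<in> C_moderate \<Omega>" "w \<in> C_moderate \<Omega>"
  proof -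
    have "u - w \<in> net_maps \<Omega> normed_lcs"
      using that by (intro net_maps_normed_diff) (auto simp: C_moderate_def)
    then show ?thesis
      by (simp add: C_negligible_def wrt_complex_iff)
  qed
  moreover have "u - w = (\<lambda>\<phi> \<epsilon>. u \<phi> \<epsilon> - w \<phi> \<epsilon>)"
    by (simp add: fun_eq_iff)
  ultimately show ?thesis
    by (auto simp: C_rel_def)
qed

text \<open>Exchanging the two nets negates every derivative of the difference, and norms are
  unaffected.\<close>

lemma C_rel_sym: "(u, w) \<in> C_rel \<Omega> \<Longrightarrow> (w, u) \<in> C_rel \<Omega>"
proof -
  assume uw: "(u, w) \<in> C_rel \<Omega>"
  then have fs: "fam_smooth u" "fam_smooth w"
    by (auto simp: C_rel_iff C_moderate_def net_maps_normed_smooth)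
  have "growth negligible_net n (\<lambda>\<phi> \<epsilon>. w \<phi> \<epsilon> - u \<phi> \<epsilon>)" for n
    unfolding growth_def
  proof (intro ballI allI impI)
    fix \<phi> \<psi>s assume a: "\<phi> \<in> test_objects \<Omega>" "set \<psi>s \<subseteq> zero_test_objects \<Omega> \<and> length \<psi>s \<le> n"
    have eq: "sDirs \<psi>s (\<lambda>\<phi>. w \<phi> \<epsilon> - u \<phi> \<epsilon>) \<phi> = - sDirs \<psi>s (\<lambda>\<phi>. u \<phi> \<epsilon> - w \<phi> \<epsilon>) \<phi>" if "\<epsilon> \<in> eps_I" for \<epsilon>
      using sDirs_linear[OF bounded_linear_minus[OF bounded_linear_ident], of "\<lambda>\<phi>. u \<phi> \<epsilon> - w \<phi> \<epsilon>" \<phi> \<psi>s]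
        fam_smooth_diff[OF fs] that a S_sub S0_sub by (force simp: fam_smooth_def)
    have "negligible_net (\<lambda>\<epsilon>. sDirs \<psi>s (\<lambda>\<phi>. u \<phi> \<epsilon> - w \<phi> \<epsilon>) \<phi>)"
      using uw a unfolding C_rel_iff growth_def by blast
    then show "negligible_net (\<lambda>\<epsilon>. sDirs \<psi>s (\<lambda>\<phi>. w \<phi> \<epsilon> - u \<phi> \<epsilon>) \<phi>)"
      by (rule negligible_net_mono) (use eventually_eps_I in \<open>eventually_elim, simp add: eq\<close>)
  qed
  with uw show ?thesis
    by (simp add: C_rel_iff)
qed

lemma C_rel_trans:
  assumes "(u, v) \<in> C_rel \<Omega>" "(v, w) \<in> C_rel \<Omega>"
  shows "(u, w) \<in> C_rel \<Omega>"
proof -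
  have fs: "fam_smooth u" "fam_smooth v" "fam_smooth w"
    using assms by (auto simp: C_rel_iff C_moderate_def net_maps_normed_smooth)
  have "growth negligible_net n (\<lambda>\<phi> \<epsilon>. (u \<phi> \<epsilon> - v \<phi> \<epsilon>) + (v \<phi> \<epsilon> - w \<phi> \<epsilon>))" for n
    using assms by (intro growth_add[OF net_class_negligible] fam_smooth_diff fs) (auto simp: C_rel_iff)
  then show ?thesis
    using assms by (simp add: C_rel_iff)
qed

lemma gen_number_class_eq: "(u, w) \<in> C_rel \<Omega> \<Longrightarrow> gen_number_class \<Omega> u = gen_number_class \<Omega> w"
  unfolding gen_number_class_def using C_rel_sym C_rel_trans by blast

lemma point_moderateD:
  assumes "X \<in> point_moderate \<Omega>"
  shows "X \<in> net_maps \<Omega> normed_lcs" "point_fam \<Omega> X" "i \<in> Basis \<Longrightarrow> growth moderate_net n (coord X i)"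
  using assms net_maps_normed_smooth[of X] growth_coord(1)[of X]
  by (auto simp: point_moderate_def point_fam_def)

lemma point_rel_coord:
  assumes "(X, Y) \<in> point_rel \<Omega>" "i \<in> Basis"
  shows "growth negligible_net n (\<lambda>\<phi> \<epsilon>. coord X i \<phi> \<epsilon> - coord Y i \<phi> \<epsilon>)"
proof -
  have "X - Y \<in> net_maps \<Omega> normed_lcs"
    using assms by (intro net_maps_normed_diff) (auto simp: point_rel_def point_moderate_def)
  from growth_coord(2)[OF this assms(2), of n] have "growth negligible_net n (coord (X - Y) i)"
    using assms(1) by (simp add: point_rel_def)
  moreover have "coord (X - Y) i = (\<lambda>\<phi> \<epsilon>. coord X i \<phi> \<epsilon> - coord Y i \<phi> \<epsilon>)"
    by (simp add: coord_def fun_eq_iff inner_diff_left)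
  ultimately show ?thesis by simp
qed

text \<open>Phrased for one test object at a time, with \<open>K\<close> chosen after
  \<open>\<phi>\<close>, as the growth estimates are.\<close>

definition compactly_supported :: "'a gpoint \<Rightarrow> bool" where
  "compactly_supported X \<longleftrightarrow> (\<forall>\<phi>\<in>test_objects \<Omega>. \<exists>K. compact K \<and> K \<subseteq> \<Omega> \<and> (\<forall>\<^sub>F \<epsilon> in at_right 0. X \<phi> \<epsilon> \<in> K))"

text \<open>Eventually the segment joining the two points lies in an enlarged compact set, and with
  it the second point. The auxiliary claim is expressed by negligibility of coordinates, so that it
  can be used in both directions.\<close>

lemma compactly_supported_rel:
  assumes rel: "(X, Y) \<in> point_rel \<Omega>"
  shows "compactly_supported X \<longleftrightarrow> compactly_supported Y"
proof -
  have *: "compactly_supported Y" if X: "compactly_supported X"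
    and neg: "\<And>\<phi> i. \<phi> \<in> test_objects \<Omega> \<Longrightarrow> i \<in> Basis \<Longrightarrow>
      negligible_net (\<lambda>\<epsilon>. complex_of_real (X \<phi> \<epsilon> \<bullet> i) - complex_of_real (Y \<phi> \<epsilon> \<bullet> i))" for X Y
    unfolding compactly_supported_def
  proof
    fix \<phi> assume \<phi>: "\<phi> \<in> test_objects \<Omega>"
    then obtain K where K: "compact K" "K \<subseteq> \<Omega>" "\<forall>\<^sub>F \<epsilon> in at_right 0. X \<phi> \<epsilon> \<in> K"
      using X unfolding compactly_supported_def by blast
    obtain K' where K': "compact K'" "K' \<subseteq> \<Omega>" "\<forall>\<^sub>F \<epsilon> in at_right 0. closed_segment (Y \<phi> \<epsilon>) (X \<phi> \<epsilon>) \<subseteq> K'"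
      using segment_eventually_compact[OF \<Omega> K neg[OF \<phi>]] by blast
    have "\<forall>\<^sub>F \<epsilon> in at_right 0. Y \<phi> \<epsilon> \<in> K'"
      using K'(3) by eventually_elim auto
    with K' show "\<exists>K. compact K \<and> K \<subseteq> \<Omega> \<and> (\<forall>\<^sub>F \<epsilon> in at_right 0. Y \<phi> \<epsilon> \<in> K)"
      by blast
  qed
  have neg: "negligible_net (\<lambda>\<epsilon>. complex_of_real (X \<phi> \<epsilon> \<bullet> i) - complex_of_real (Y \<phi> \<epsilon> \<bullet> i))"
    if "\<phi> \<in> test_objects \<Omega>" "i \<in> Basis" for \<phi> i
    using point_rel_coord[OF rel that(2), of 0] that(1) by (simp add: growth_0 coord_def)
  have "negligible_net (\<lambda>\<epsilon>. complex_of_real (Y \<phi> \<epsilon> \<bullet> i) - complex_of_real (X \<phi> \<epsilon> \<bullet> i))"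
    if "\<phi> \<in> test_objects \<Omega>" "i \<in> Basis" for \<phi> i
    by (rule negligible_net_mono[OF neg[OF that]]) (simp add: norm_minus_commute)
  then show ?thesis
    using *[of X Y] *[of Y X] neg by blast
qed

lemma evalp_eq_insert_point: "evalp R X = insert_point R X"
  by (simp add: evalp_def insert_point_def)

lemma insert_point_moderate:
  assumes R: "R \<in> E_moderate \<Omega>" and X: "X \<in> point_moderate \<Omega>" "compactly_supported X"
  shows "insert_point R X \<in> C_moderate \<Omega>"
proof -
  have Rn: "R \<in> net_maps \<Omega> (Cinf \<Omega>)"
    using R by (simp add: E_moderate_def)
  have n: "insert_point R X \<in> net_maps \<Omega> normed_lcs"
    using X(1) by (intro insert_point_net_maps[OF Rn]) (auto simp: point_moderate_def)
  have "growth moderate_net n (evalp R X)" for n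
    by (rule growth_evalp[OF net_class_moderate \<Omega> point_moderateD(2,3)[OF X(1)] _ net_maps_Cinf_jsmooth[OF Rn] fam_growth_wrt(1)[OF Rn]])
       (use X(2) R in \<open>auto simp: compactly_supported_def E_moderate_def\<close>)
  with n show ?thesis
    by (simp add: C_moderate_def wrt_complex_iff(1) evalp_eq_insert_point)
qed

text \<open>\<open>R(X) - R'(X')\<close> is split into \<open>R(X) - R(X')\<close>, small because
  the points are close, and \<open>(R - R')(X')\<close>, small because the function is
  negligible.\<close>

lemma insert_point_rel:
  assumes R: "R \<in> E_moderate \<Omega>" "R' \<in> E_moderate \<Omega>" "R - R' \<in> E_negligible \<Omega>"
    and X: "(X, X') \<in> point_rel \<Omega>" "compactly_supported X"
  shows "(insert_point R X, insert_point R' X') \<in> C_rel \<Omega>"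
proof -
  have Rn: "R \<in> net_maps \<Omega> (Cinf \<Omega>)" "R' \<in> net_maps \<Omega> (Cinf \<Omega>)" "R - R' \<in> net_maps \<Omega> (Cinf \<Omega>)"
    using R by (auto simp: E_moderate_def E_negligible_def)
  have Xm: "X \<in> point_moderate \<Omega>" "X' \<in> point_moderate \<Omega>"
    using X(1) by (auto simp: point_rel_def)
  have X'c: "compactly_supported X'"
    using compactly_supported_rel[OF X(1)] X(2) by simp
  note pX = point_moderateD[OF Xm(1)] and pX' = point_moderateD[OF Xm(2)]
  have J: "fam_jsmooth \<Omega> R" "fam_jsmooth \<Omega> (R - R')"
    by (intro net_maps_Cinf_jsmooth Rn)+
  have 1: "growth negligible_net n (\<lambda>\<phi> \<epsilon>. evalp R X \<phi> \<epsilon> - evalp R X' \<phi> \<epsilon>)" for n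
    by (rule growth_evalp_diff[OF \<Omega> pX(2) pX'(2) pX(3) pX'(3) point_rel_coord[OF X(1)] _ _ J(1) fam_growth_wrt(1)[OF Rn(1)]])
       (use X(2) X'c R in \<open>auto simp: compactly_supported_def E_moderate_def\<close>)
  have 2: "growth negligible_net n (evalp (R - R') X')" for n
    by (rule growth_evalp[OF net_class_negligible \<Omega> pX'(2,3) _ J(2) fam_growth_wrt(2)[OF Rn(3)]])
       (use X'c R in \<open>auto simp: compactly_supported_def E_negligible_def\<close>)
  have "growth negligible_net n (\<lambda>\<phi> \<epsilon>. (evalp R X \<phi> \<epsilon> - evalp R X' \<phi> \<epsilon>) + evalp (R - R') X' \<phi> \<epsilon>)" for n
    by (intro growth_add[OF net_class_negligible] 1 2 fam_smooth_diff fam_smooth_evalp[OF J(1)] fam_smooth_evalp[OF J(2)] pX(2) pX'(2))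
  then have "growth negligible_net n (\<lambda>\<phi> \<epsilon>. insert_point R X \<phi> \<epsilon> - insert_point R' X' \<phi> \<epsilon>)" for n
    by (simp add: evalp_def insert_point_def)
  then show ?thesis
    unfolding C_rel_iff
    by (intro conjI insert_point_moderate R Xm X(2) X'c allI)
qed

lemma point_value_well_defined:
  assumes "Rt \<in> gen_functions \<Omega>" and "Xt \<in> compact_gen_points \<Omega>"
  shows "\<exists>!Z. Z \<in> gen_numbers \<Omega> \<and>
           (\<forall>R\<in>Rt. \<forall>X\<in>Xt. insert_point R X \<in> C_moderate \<Omega> \<and>
              gen_number_class \<Omega> (insert_point R X) = Z)"
proof -
  obtain R0 where R0: "R0 \<in> E_moderate \<Omega>"
    and Rt: "\<And>R. R \<in> Rt \<longleftrightarrow> R \<in> E_moderate \<Omega> \<and> R0 - R \<in> E_negligible \<Omega>"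
    using assms(1) unfolding gen_functions_def quotient_def by auto
  have R0t: "R0 \<in> Rt"
    using R0 E_negligible_zero by (simp add: Rt)
  obtain Y0 where Xt: "Xt = point_rel \<Omega> `` {Y0}"
    using assms(2) unfolding compact_gen_points_def gen_points_def quotient_def by blast
  obtain X0 K where X0: "X0 \<in> Xt" and K: "compact K" "K \<subseteq> \<Omega>"
    "\<And>\<phi>. \<phi> \<in> test_objects \<Omega> \<Longrightarrow> \<exists>\<epsilon>\<^sub>0>0. \<forall>\<epsilon>\<in>eps_I. \<epsilon> < \<epsilon>\<^sub>0 \<longrightarrow> X0 \<phi> \<epsilon> \<in> K"
    using assms(2) unfolding compact_gen_points_def by blast
  have "\<forall>\<^sub>F \<epsilon> in at_right 0. X0 \<phi> \<epsilon> \<in> K" if "\<phi> \<in> test_objects \<Omega>" for \<phi>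
  proof -
    obtain \<epsilon>0 where e0: "\<epsilon>0 > 0" "\<forall>\<epsilon>\<in>eps_I. \<epsilon> < \<epsilon>0 \<longrightarrow> X0 \<phi> \<epsilon> \<in> K"
      using K(3)[OF \<open>\<phi> \<in> test_objects \<Omega>\<close>] by blast
    show ?thesis
      using eventually_eps_I eventually_at_right_real[OF e0(1)]
      by eventually_elim (use e0(2) in auto)
  qed
  then have "compactly_supported X0"
    using K unfolding compactly_supported_def by blast
  then have Y0: "compactly_supported Y0"
    using compactly_supported_rel[of Y0 X0] X0 by (simp add: Xt)
  \<comment> \<open>The generating representative \<open>Y0\<close> serves as reference, since
    membership of \<open>X\<close> in \<open>Xt\<close> means exactly that \<open>(Y0, X)\<close>
    lies in \<open>point_rel\<close>; its compactness was inherited from \<open>X0\<close>.\<close>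
  define u0 where "u0 = insert_point R0 Y0"
  have rel: "(u0, insert_point R X) \<in> C_rel \<Omega>" if "R \<in> Rt" "X \<in> Xt" for R X
    unfolding u0_def using that R0 Y0 by (intro insert_point_rel) (auto simp: Rt Xt)
  then have u0: "u0 \<in> C_moderate \<Omega>"
    using R0t X0 by (auto simp: C_rel_iff)
  show ?thesis
  proof (rule ex1I[of _ "gen_number_class \<Omega> u0"])
    show "gen_number_class \<Omega> u0 \<in> gen_numbers \<Omega> \<and>
        (\<forall>R\<in>Rt. \<forall>X\<in>Xt. insert_point R X \<in> C_moderate \<Omega> \<and>
          gen_number_class \<Omega> (insert_point R X) = gen_number_class \<Omega> u0)"
    proof (intro conjI ballI)
      show "gen_number_class \<Omega> u0 \<in> gen_numbers \<Omega>"
        unfolding gen_numbers_def gen_number_class_def using u0 by (rule quotientI)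
      show "insert_point R X \<in> C_moderate \<Omega>" if "R \<in> Rt" "X \<in> Xt" for R X
        using rel[OF that] by (simp add: C_rel_iff)
      show "gen_number_class \<Omega> (insert_point R X) = gen_number_class \<Omega> u0" if "R \<in> Rt" "X \<in> Xt" for R X
        using gen_number_class_eq[OF rel[OF that]] by simp
    qed
    \<comment> \<open>Uniqueness rests on both classes being nonempty, as witnessed by
      \<open>R0\<close> and \<open>X0\<close>.\<close>
    show "Z = gen_number_class \<Omega> u0"
      if "Z \<in> gen_numbers \<Omega> \<and> (\<forall>R\<in>Rt. \<forall>X\<in>Xt. insert_point R X \<in> C_moderate \<Omega> \<and>
          gen_number_class \<Omega> (insert_point R X) = Z)" for Z
      using that gen_number_class_eq[OF rel[OF R0t X0]] R0t X0 by auto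
  qed
qed

end

theorem theorem30:
  fixes \<Omega> :: "(real^'n) set"
    and Rt :: "(real^'n) gfun set"
    and Xt :: "(real^'n) gpoint set"
  assumes "open \<Omega>"
    and "Rt \<in> gen_functions \<Omega>"
    and "Xt \<in> compact_gen_points \<Omega>"
  shows "\<exists>!Z. Z \<in> gen_numbers \<Omega> \<and>
           (\<forall>R\<in>Rt. \<forall>X\<in>Xt. insert_point R X \<in> C_moderate \<Omega> \<and>
              gen_number_class \<Omega> (insert_point R X) = Z)"
  using assms by (rule point_value_well_defined)

end
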